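(* There exists an absolute constant $\kappa>0$ such that the following holds for every $d\in\mathbb{Z}_+$, $\sigma\ge0$, $b\ge 0$ and $\eta$ with $4/\sqrt d\le\eta\le 1$. For every (possibly randomized) algorithm $\mathcal{A}$ that takes as input $\eta,\sigma,b$ and $n$ labeled examples in $(\mathbb{R}\cup\{\perp\})^d\times(\mathbb{R}\cup\{\perp\})$ and outputs $\hat\beta\in\mathbb{R}^d$, there exist $\beta\in\mathbb{R}^d$ with $\|\beta\|=b$ and an adversary as in the coordinate-wise missing data model such that, when $\mathcal{A}$ is run on $\eta,\sigma,b$ and the $\eta$-coordinate-wise incomplete version of $n$ i.i.d. samples from the linear regression model with regressor $\beta$ and noise level $\sigma$, its output satisfies $$\|\hat\beta-\beta\|\ \ge\ \tfrac{1}{\sqrt2}\,\|\beta\|$$ with probability at least $\tfrac12\big(1-(d+1)e^{-\kappa\eta n}\big)$.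
   Context: Linear regression model with regressor $\beta\in\mathbb{R}^d$ and noise level $\sigma\ge 0$: a labeled example $(X,y)$ with $X\sim\mathcal{N}(0,I_d)$ and $y=\beta^\top X+\xi$, where $\xi\sim\mathcal{N}(0,\sigma^2)$ is independent of $X$ ($\xi=0$ if $\sigma=0$). Coordinate-wise missing data model with rate $\eta\in[0,1]$: given a set $S=\{(X^{(i)},y^{(i)})\}_{i\in[n]}$ of $n$ i.i.d. labeled examples, an adversary (possibly randomized) inspects all of $S$ and, for each coordinate $j\in[d]$, may replace the $j$-th coordinate of at most $\eta n$ of the vectors $X^{(i)}$ by the symbol $\perp$, and may replace at most $\eta n$ of the labels $y^{(i)}$ by $\perp$; the resulting dataset is given to the algorithm. Probabilities are over the samples and the randomness of the adversary and the algorithm. *)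

theory Defs
  imports "HOL-Probability.Probability"
begin

text \<open>Vectors in R^d are functions nat => real; only coordinates j < d matter
  (elements of the product space are extensional on {..<d}).\<close>

definition vec_space :: "nat \<Rightarrow> (nat \<Rightarrow> real) measure" where
  "vec_space d = PiM {..<d} (\<lambda>_. borel)"

definition vnorm :: "nat \<Rightarrow> (nat \<Rightarrow> real) \<Rightarrow> real" where
  "vnorm d v = sqrt (\<Sum>j<d. (v j)\<^sup>2)"

text \<open>Observed coordinates: None stands for the missing symbol.\<close>
definition opt_borel :: "real option measure" where
  "opt_borel = sigma UNIV ({{None}} \<union> {Some ` A | A. A \<in> sets borel})"

definition example_space :: "nat \<Rightarrow> ((nat \<Rightarrow> real) \<times> real) measure" where
  "example_space d = vec_space d \<Otimes>\<^sub>M borel"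

definition data_space :: "nat \<Rightarrow> nat \<Rightarrow> (nat \<Rightarrow> (nat \<Rightarrow> real) \<times> real) measure" where
  "data_space d n = PiM {..<n} (\<lambda>_. example_space d)"

definition cexample_space :: "nat \<Rightarrow> ((nat \<Rightarrow> real option) \<times> real option) measure" where
  "cexample_space d = PiM {..<d} (\<lambda>_. opt_borel) \<Otimes>\<^sub>M opt_borel"

definition cdata_space :: "nat \<Rightarrow> nat \<Rightarrow> (nat \<Rightarrow> (nat \<Rightarrow> real option) \<times> real option) measure" where
  "cdata_space d n = PiM {..<n} (\<lambda>_. cexample_space d)"

definition noise :: "real \<Rightarrow> real measure" where
  "noise \<sigma> = (if \<sigma> = 0 then return borel 0 else density lborel (normal_density 0 \<sigma>))"

definition lr_example :: "nat \<Rightarrow> (nat \<Rightarrow> real) \<Rightarrow> real \<Rightarrow> ((nat \<Rightarrow> real) \<times> real) measure" where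
  "lr_example d \<beta> \<sigma> =
     distr (PiM {..<d} (\<lambda>_. density lborel std_normal_density) \<Otimes>\<^sub>M noise \<sigma>) (example_space d)
       (\<lambda>(x, \<xi>). (x, (\<Sum>j<d. \<beta> j * x j) + \<xi>))"

definition lr_data :: "nat \<Rightarrow> nat \<Rightarrow> (nat \<Rightarrow> real) \<Rightarrow> real \<Rightarrow> (nat \<Rightarrow> (nat \<Rightarrow> real) \<times> real) measure" where
  "lr_data d n \<beta> \<sigma> = PiM {..<n} (\<lambda>_. lr_example d \<beta> \<sigma>)"

definition valid_corruption ::
  "nat \<Rightarrow> nat \<Rightarrow> real \<Rightarrow> (nat \<Rightarrow> (nat \<Rightarrow> real) \<times> real) \<Rightarrow> (nat \<Rightarrow> (nat \<Rightarrow> real option) \<times> real option) \<Rightarrow> bool" where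
  "valid_corruption d n \<eta> S Z \<longleftrightarrow>
     (\<forall>i<n. (\<forall>j<d. fst (Z i) j = Some (fst (S i) j) \<or> fst (Z i) j = None) \<and>
            (snd (Z i) = Some (snd (S i)) \<or> snd (Z i) = None)) \<and>
     (\<forall>j<d. real (card {i. i < n \<and> fst (Z i) j = None}) \<le> \<eta> * real n) \<and>
     real (card {i. i < n \<and> snd (Z i) = None}) \<le> \<eta> * real n"

definition adversary :: "nat \<Rightarrow> nat \<Rightarrow> real \<Rightarrow> ((nat \<Rightarrow> (nat \<Rightarrow> real) \<times> real) \<Rightarrow> (nat \<Rightarrow> (nat \<Rightarrow> real option) \<times> real option) measure) \<Rightarrow> bool" where
  "adversary d n \<eta> adv \<longleftrightarrow>
     adv \<in> measurable (data_space d n) (prob_algebra (cdata_space d n)) \<and>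
     (\<forall>S \<in> space (data_space d n). AE Z in adv S. valid_corruption d n \<eta> S Z)"

text \<open>Distribution of the output of the algorithm (a Markov kernel from incomplete datasets to R^d)
  run on the adversarially corrupted samples.\<close>
definition output_dist where
  "output_dist d n \<beta> \<sigma> adv alg = lr_data d n \<beta> \<sigma> \<bind> (\<lambda>S. adv S \<bind> alg)"

end

theory Submission
  imports Defs
begin

text \<open>
  The hard regressors are $\beta = (b/\sqrt d)(1,\dots,1)$ and $-\beta$; no estimate is closer than $b/\sqrt 2$
  to both. Replacing $X$ by $-X$ turns data for $\beta$ into data for $-\beta$ with the same labels, so
  it suffices to hide coordinates of a standard normal vector $X$ at random in such a way that the
  masked vector and its negative have the same joint law with $\sum_k X_k$.

  To this end $X$ is coupled exchangeably with a vector $V$ of the same sum, and coordinate $k$ is shown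
  only if $V_k = -X_k$. Coordinates are treated one at a time. If $r$, $r'$ are the remaining sums of $X$, $V$,
  normalised to unit variance, the next coordinate of $X$ is $c r + s g$ with $g$ standard normal, where
  $c^2 + s^2 = 1$, and the reflection coupling of $N(c r, s^2)$ with $N(-c r', s^2)$ fails with probability at
  most $|c (r + r') / s| / 2$. As $r$ and $r'$ have unit variance, the expected number of hidden
  coordinates is at most $1 + 2\sqrt{d-1}$. A random cyclic shift makes each coordinate hidden with
  probability at most $\frac{9}{16}\eta$, and by a Chernoff bound the budget $\eta n$ is rarely exceeded.
\<close>

text \<open>Why exchangeability gives the symmetry: \<open>X\<close> and \<open>V\<close> are shown
  at the same places with opposite values, so the masked \<open>V\<close> is minus the masked
  \<open>X\<close>, and interchanging the two vectors mirrors the masked law without changing the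
  sum. The sum must be carried along because the label depends on \<open>X\<close> through it alone,
  up to independent noise. The obstacle is the order of the randomness. The adversary is handed
  \<open>X\<close> and has to mask it, whereas the symmetry is visible only when the sum is drawn
  first and the coordinates are generated from it. Hence there are two recursions,
  \<open>mask\<close> and \<open>gmask\<close>, linked by a plane reflection of two independent
  normals. A coordinate with \<open>V_k = - X_k\<close> makes the remaining sums of \<open>X\<close>
  and \<open>V\<close> differ, so the recursion carries two values \<open>r\<close> and
  \<open>r'\<close>, which are dependent. The number of hidden coordinates is therefore bounded by
  an expression \<open>A + B * (r^2 + r'^2)\<close>: being linear in the squares, it can be averaged
  using the marginal laws only.\<close>

subsection \<open>Gaussian integrals and the reflection coupling\<close>

definition gauss :: "real measure" where
  "gauss = density lborel std_normal_density"

definition unif :: "real measure" where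
  "unif = uniform_measure lborel {0..1}"

lemma prob_space_gauss [simp]: "prob_space gauss"
  unfolding gauss_def by (intro prob_space_normal_density) simp

lemma sets_gauss [simp, measurable_cong]: "sets gauss = sets borel"
  by (simp add: gauss_def)

lemma space_gauss [simp]: "space gauss = UNIV"
  by (simp add: gauss_def)

lemma prob_space_unif [simp]: "prob_space unif"
  unfolding unif_def by (intro prob_space_uniform_measure) simp_all

lemma sets_unif [simp, measurable_cong]: "sets unif = sets borel"
  by (simp add: unif_def)

lemma space_unif [simp]: "space unif = UNIV"
  by (simp add: unif_def)

lemma nn_integral_gauss:
  "f \<in> borel_measurable borel \<Longrightarrow>
    (\<integral>\<^sup>+x. f x \<partial>gauss) = (\<integral>\<^sup>+x. ennreal (std_normal_density x) * f x \<partial>lborel)"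
  unfolding gauss_def by (subst nn_integral_density) auto

lemma std_normal_density_pos: "0 < std_normal_density x"
  by (simp add: normal_density_pos)

lemma std_normal_density_minus: "std_normal_density (- x) = std_normal_density x"
  by (simp add: normal_density_def)

lemma std_normal_density_le_iff:
  "std_normal_density x \<le> std_normal_density y \<longleftrightarrow> \<bar>y\<bar> \<le> \<bar>x\<bar>"
  by (simp add: normal_density_def divide_le_cancel abs_le_square_iff)

lemma std_normal_density_mult_eq:
  "x\<^sup>2 + y\<^sup>2 = x'\<^sup>2 + y'\<^sup>2 \<Longrightarrow>
    std_normal_density x * std_normal_density y = std_normal_density x' * std_normal_density y'"
  by (simp add: normal_density_def mult_exp_exp add_divide_distrib[symmetric] minus_add[symmetric]
      del: minus_add_distrib)

text \<open>The map from \<open>(r, g)\<close> to \<open>(c r + s g, s r - c g)\<close> is an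
  orthogonal reflection of the plane, so it preserves the law of two independent standard normals.
  The substitution is done one variable at a time, with factors \<open>1/s\<close> and
  \<open>s\<close> that cancel.\<close>

lemma gauss_reflection_invariant:
  fixes c s :: real
  assumes [measurable]: "case_prod F \<in> borel_measurable (borel \<Otimes>\<^sub>M borel)"
    and cs: "c\<^sup>2 + s\<^sup>2 = 1" and s: "s > 0"
  shows "(\<integral>\<^sup>+r. \<integral>\<^sup>+g. F (c * r + s * g) (s * r - c * g) \<partial>gauss \<partial>gauss) =
    (\<integral>\<^sup>+x. \<integral>\<^sup>+y. F x y \<partial>gauss \<partial>gauss)"
proof -
  let ?\<phi> = std_normal_density
  have cc: "c * c + s * s = 1"
    using cs by (simp add: power2_eq_square)
  have pp: "pair_sigma_finite lborel (lborel :: real measure)"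
    by standard
  have "(\<integral>\<^sup>+r. \<integral>\<^sup>+g. F (c * r + s * g) (s * r - c * g) \<partial>gauss \<partial>gauss)
      = (\<integral>\<^sup>+r. \<integral>\<^sup>+g. ennreal (?\<phi> r * ?\<phi> g) * F (c * r + s * g) (s * r - c * g) \<partial>lborel \<partial>lborel)"
    by (subst nn_integral_gauss, measurable, subst nn_integral_gauss, measurable)
      (simp add: nn_integral_cmult[symmetric] ennreal_mult mult.assoc)
  also have "\<dots> = (\<integral>\<^sup>+r. ennreal (1/s) * (\<integral>\<^sup>+x. ennreal (?\<phi> r * ?\<phi> ((x - c * r) / s)) *
      F x ((r - c * x) / s) \<partial>lborel) \<partial>lborel)"
  proof (intro nn_integral_cong)
    fix r :: real
    have "(\<integral>\<^sup>+g. ennreal (?\<phi> r * ?\<phi> g) * F (c * r + s * g) (s * r - c * g) \<partial>lborel)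
       = ennreal \<bar>1/s\<bar> * (\<integral>\<^sup>+x. ennreal (?\<phi> r * ?\<phi> (-(c*r/s) + 1/s * x)) *
          F (c * r + s * (-(c*r/s) + 1/s * x)) (s * r - c * (-(c*r/s) + 1/s * x)) \<partial>lborel)"
      by (rule nn_integral_real_affine) (use s in simp_all)
    also have "\<dots> = ennreal (1/s) * (\<integral>\<^sup>+x. ennreal (?\<phi> r * ?\<phi> ((x - c * r) / s)) *
      F x ((r - c * x) / s) \<partial>lborel)"
    proof -
      have e1: "-(c*r/s) + 1/s * x = (x - c * r) / s" for x
        using s by (simp add: field_simps)
      have e2: "c * r + s * ((x - c * r) / s) = x" for x
        using s by simp
      have e3: "s * r - c * ((x - c * r) / s) = (r - c * x) / s" for x
      proof -
        have "s * r - c * ((x - c * r) / s) = ((c * c + s * s) * r - c * x) / s"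
          using s by (simp add: field_simps)
        then show ?thesis by (simp add: cc)
      qed
      show ?thesis unfolding e1 e2 e3 using s by simp
    qed
    finally show "(\<integral>\<^sup>+g. ennreal (?\<phi> r * ?\<phi> g) * F (c * r + s * g) (s * r - c * g) \<partial>lborel) = \<dots>" .
  qed
  also have "\<dots> = (\<integral>\<^sup>+r. \<integral>\<^sup>+x. ennreal (1/s) * (ennreal (?\<phi> r * ?\<phi> ((x - c * r) / s)) *
      F x ((r - c * x) / s)) \<partial>lborel \<partial>lborel)"
    by (intro nn_integral_cong nn_integral_cmult[symmetric]) measurable
  also have "\<dots> = (\<integral>\<^sup>+x. \<integral>\<^sup>+r. ennreal (1/s) * (ennreal (?\<phi> r * ?\<phi> ((x - c * r) / s)) *
      F x ((r - c * x) / s)) \<partial>lborel \<partial>lborel)"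
    by (rule pair_sigma_finite.Fubini'[OF pp]) measurable
  also have "\<dots> = (\<integral>\<^sup>+x. \<integral>\<^sup>+y. ennreal (?\<phi> x * ?\<phi> y) * F x y \<partial>lborel \<partial>lborel)"
  proof (rule nn_integral_cong)
    fix x :: real
    have "(\<integral>\<^sup>+r. ennreal (1/s) * (ennreal (?\<phi> r * ?\<phi> ((x - c * r) / s)) *
      F x ((r - c * x) / s)) \<partial>lborel)
      = ennreal \<bar>s\<bar> * (\<integral>\<^sup>+y. ennreal (1/s) * (ennreal (?\<phi> (c*x+s*y) * ?\<phi> ((x - c * (c*x+s*y)) / s)) *
      F x (((c*x+s*y) - c * x) / s)) \<partial>lborel)"
      by (rule nn_integral_real_affine) (use s in simp_all)
    also have "\<dots> = (\<integral>\<^sup>+y. ennreal \<bar>s\<bar> * (ennreal (1/s) * (ennreal (?\<phi> (c*x+s*y) * ?\<phi> ((x - c * (c*x+s*y)) / s)) *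
      F x (((c*x+s*y) - c * x) / s))) \<partial>lborel)"
      by (rule nn_integral_cmult[symmetric]) measurable
    also have "\<dots> = (\<integral>\<^sup>+y. ennreal (?\<phi> x * ?\<phi> y) * F x y \<partial>lborel)"
    proof (intro nn_integral_cong)
      fix y :: real
      have e1: "((c*x+s*y) - c * x) / s = y"
        using s by simp
      have e2: "(x - c * (c*x+s*y)) / s = s * x - c * y"
      proof -
        have "s * (s * x - c * y) = (c * c + s * s) * x - c * (c*x+s*y)"
          by (simp add: algebra_simps)
        then show ?thesis using s cc by (simp add: field_simps)
      qed
      have "(c*x+s*y)\<^sup>2 + (s*x-c*y)\<^sup>2 = (c\<^sup>2+s\<^sup>2) * (x\<^sup>2+y\<^sup>2)"
        by (simp add: power2_eq_square algebra_simps)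
      then have e3: "?\<phi> (c*x+s*y) * ?\<phi> (s*x-c*y) = ?\<phi> x * ?\<phi> y"
        by (intro std_normal_density_mult_eq) (simp add: cs)
      have e4: "ennreal \<bar>s\<bar> * (ennreal (1/s) * z) = z" for z
        using s by (simp add: mult.assoc[symmetric] ennreal_mult[symmetric])
      show "ennreal \<bar>s\<bar> * (ennreal (1/s) * (ennreal (?\<phi> (c*x+s*y) * ?\<phi> ((x - c * (c*x+s*y)) / s)) *
        F x (((c*x+s*y) - c * x) / s))) = ennreal (?\<phi> x * ?\<phi> y) * F x y"
        unfolding e1 e2 e3 e4 ..
    qed
    finally show "(\<integral>\<^sup>+r. ennreal (1/s) * (ennreal (?\<phi> r * ?\<phi> ((x - c * r) / s)) *
      F x ((r - c * x) / s)) \<partial>lborel) = (\<integral>\<^sup>+y. ennreal (?\<phi> x * ?\<phi> y) * F x y \<partial>lborel)" .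
  qed
  also have "\<dots> = (\<integral>\<^sup>+x. \<integral>\<^sup>+y. F x y \<partial>gauss \<partial>gauss)"
    by (subst nn_integral_gauss, measurable, subst nn_integral_gauss, measurable)
      (simp add: nn_integral_cmult[symmetric] ennreal_mult mult.assoc)
  finally show ?thesis .
qed

section \<open>Overlap and deficit of two shifted normal densities\<close>

lemma emeasure_unif_le:
  assumes "0 \<le> a"
  shows "emeasure unif {u. u \<le> a} = ennreal (min 1 a)"
proof -
  have "{0..1} \<inter> {u. u \<le> a} = {0..min 1 a}"
    by auto
  then have "emeasure unif {u. u \<le> a} = emeasure lborel {0..min 1 a} / emeasure lborel {0..1::real}"
    unfolding unif_def by (subst emeasure_uniform_measure) auto
  then show ?thesis
    using assms by (simp add: divide_ennreal_def)
qed

lemma nn_integral_unif_threshold: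
  assumes "0 \<le> a"
  shows "(\<integral>\<^sup>+u. (if u \<le> a then p else q) \<partial>unif) = ennreal (min 1 a) * p + ennreal (1 - min 1 a) * q"
proof -
  interpret prob_space unif by simp
  have A: "{u. u \<le> a} \<in> sets unif" "{u. \<not> u \<le> a} \<in> sets unif"
    by simp_all
  have "(\<integral>\<^sup>+u. (if u \<le> a then p else q) \<partial>unif) =
      (\<integral>\<^sup>+u. p * indicator {u. u \<le> a} u + q * indicator {u. \<not> u \<le> a} u \<partial>unif)"
    by (intro nn_integral_cong) (auto simp: indicator_def)
  also have "\<dots> = p * emeasure unif {u. u \<le> a} + q * emeasure unif {u. \<not> u \<le> a}"
    using A by (subst nn_integral_add) (auto simp: nn_integral_cmult_indicator)
  also have "emeasure unif {u. \<not> u \<le> a} = ennreal (1 - min 1 a)"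
  proof -
    have "emeasure unif (space unif - {u. u \<le> a}) = 1 - emeasure unif {u. u \<le> a}"
      using emeasure_compl[OF A(1)] emeasure_space_1 by simp
    moreover have "space unif - {u. u \<le> a} = {u. \<not> u \<le> a}"
      by auto
    ultimately show ?thesis
      using assms by (simp add: emeasure_unif_le ennreal_1[symmetric] ennreal_minus del: ennreal_1)
  qed
  finally show ?thesis
    using assms by (simp add: emeasure_unif_le mult.commute)
qed

text \<open>Rejection sampling: given \<open>g\<close>, the test succeeds with probability the ratio
  of the two densities, capped at 1. Multiplied by the density of \<open>g\<close>, the accepted
  part has the minimum of the two densities as its density (the overlap) and the rejected part has
  what remains (the deficit).\<close>

lemma nn_integral_threshold:
  assumes [measurable]: "f1 \<in> borel_measurable borel" "f2 \<in> borel_measurable borel"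
  shows "(\<integral>\<^sup>+g. \<integral>\<^sup>+u. (if u * std_normal_density g \<le> std_normal_density (g + \<delta>) then f1 g else f2 g) \<partial>unif \<partial>gauss)
    = (\<integral>\<^sup>+g. ennreal (min (std_normal_density g) (std_normal_density (g + \<delta>))) * f1 g +
        ennreal (std_normal_density g - min (std_normal_density g) (std_normal_density (g + \<delta>))) * f2 g \<partial>lborel)"
proof -
  let ?\<phi> = std_normal_density
  let ?a = "\<lambda>g. ?\<phi> (g + \<delta>) / ?\<phi> g"
  have pos: "0 < ?\<phi> x" for x
    by (rule std_normal_density_pos)
  have "(\<integral>\<^sup>+u. (if u * ?\<phi> g \<le> ?\<phi> (g + \<delta>) then f1 g else f2 g) \<partial>unif)
      = ennreal (min 1 (?a g)) * f1 g + ennreal (1 - min 1 (?a g)) * f2 g" for g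
  proof -
    have "u * ?\<phi> g \<le> ?\<phi> (g + \<delta>) \<longleftrightarrow> u \<le> ?a g" for u
      using pos[of g] by (simp add: field_simps)
    then show ?thesis
      using pos[of g] pos[of "g + \<delta>"] by (simp add: nn_integral_unif_threshold)
  qed
  then have "(\<integral>\<^sup>+g. \<integral>\<^sup>+u. (if u * ?\<phi> g \<le> ?\<phi> (g + \<delta>) then f1 g else f2 g) \<partial>unif \<partial>gauss)
    = (\<integral>\<^sup>+g. ennreal (min 1 (?a g)) * f1 g + ennreal (1 - min 1 (?a g)) * f2 g \<partial>gauss)"
    by simp
  also have "\<dots> = (\<integral>\<^sup>+g. ennreal (?\<phi> g) * (ennreal (min 1 (?a g)) * f1 g + ennreal (1 - min 1 (?a g)) * f2 g) \<partial>lborel)"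
    by (rule nn_integral_gauss) measurable
  also have "\<dots> = (\<integral>\<^sup>+g. ennreal (min (?\<phi> g) (?\<phi> (g + \<delta>))) * f1 g +
        ennreal (?\<phi> g - min (?\<phi> g) (?\<phi> (g + \<delta>))) * f2 g \<partial>lborel)"
  proof (intro nn_integral_cong)
    fix g :: real
    have e: "?\<phi> g * min 1 (?a g) = min (?\<phi> g) (?\<phi> (g + \<delta>))"
      using pos[of g] by (simp add: min_def field_simps)
    have m: "0 \<le> min 1 (?a g)"
      using pos[of g] pos[of "g + \<delta>"] by simp
    have "ennreal (?\<phi> g) * ennreal (min 1 (?a g)) = ennreal (min (?\<phi> g) (?\<phi> (g + \<delta>)))"
      unfolding e[symmetric] using pos[of g] m by (intro ennreal_mult[symmetric]) auto
    moreover have "ennreal (?\<phi> g) * ennreal (1 - min 1 (?a g)) = ennreal (?\<phi> g - min (?\<phi> g) (?\<phi> (g + \<delta>)))"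
      unfolding e[symmetric] using pos[of g] m
      by (subst ennreal_mult[symmetric]) (auto simp: right_diff_distrib)
    ultimately show "ennreal (?\<phi> g) * (ennreal (min 1 (?a g)) * f1 g + ennreal (1 - min 1 (?a g)) * f2 g) =
      ennreal (min (?\<phi> g) (?\<phi> (g + \<delta>))) * f1 g + ennreal (?\<phi> g - min (?\<phi> g) (?\<phi> (g + \<delta>))) * f2 g"
      by (simp add: distrib_left mult.assoc[symmetric])
  qed
  finally show ?thesis .
qed

text \<open>The reflection of the line about \<open>- \<delta> / 2\<close> exchanges the two
  densities and so fixes their minimum. This makes the accepted part of the coupling
  symmetric.\<close>

lemma nn_integral_overlap_reflect:
  assumes [measurable]: "f \<in> borel_measurable borel"
  shows "(\<integral>\<^sup>+g. ennreal (min (std_normal_density g) (std_normal_density (g + \<delta>))) * f (- g - \<delta>) \<partial>lborel)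
    = (\<integral>\<^sup>+g. ennreal (min (std_normal_density g) (std_normal_density (g + \<delta>))) * f g \<partial>lborel)"
proof -
  let ?\<phi> = std_normal_density
  have "(\<integral>\<^sup>+g. ennreal (min (?\<phi> g) (?\<phi> (g + \<delta>))) * f g \<partial>lborel)
     = ennreal \<bar>-1\<bar> * (\<integral>\<^sup>+g. ennreal (min (?\<phi> (-\<delta> + (-1) * g)) (?\<phi> (-\<delta> + (-1) * g + \<delta>))) * f (-\<delta> + (-1) * g) \<partial>lborel)"
    by (rule nn_integral_real_affine) simp_all
  also have "\<dots> = (\<integral>\<^sup>+g. ennreal (min (?\<phi> g) (?\<phi> (g + \<delta>))) * f (- g - \<delta>) \<partial>lborel)"
  proof -
    have "?\<phi> (-\<delta> + (-1) * g) = ?\<phi> (g + \<delta>)" "?\<phi> (-\<delta> + (-1) * g + \<delta>) = ?\<phi> g"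
      "-\<delta> + (-1) * g = - g - \<delta>" for g
      using std_normal_density_minus[of "g + \<delta>"] std_normal_density_minus[of g] by (simp_all add: algebra_simps)
    then show ?thesis
      by (simp only: min.commute) simp
  qed
  finally show ?thesis ..
qed

lemma nn_integral_gauss_split:
  assumes [measurable]: "f \<in> borel_measurable borel"
  shows "(\<integral>\<^sup>+g. f g \<partial>gauss)
    = (\<integral>\<^sup>+g. ennreal (min (std_normal_density g) (std_normal_density (g + \<delta>))) * f g \<partial>lborel) +
      (\<integral>\<^sup>+g. ennreal (std_normal_density g - min (std_normal_density g) (std_normal_density (g + \<delta>))) * f g \<partial>lborel)"
proof -
  let ?\<phi> = std_normal_density
  have "ennreal (?\<phi> g) = ennreal (min (?\<phi> g) (?\<phi> (g + \<delta>))) + ennreal (?\<phi> g - min (?\<phi> g) (?\<phi> (g + \<delta>)))" for g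
    by (subst ennreal_plus[symmetric]) auto
  then show ?thesis
    by (subst nn_integral_gauss, simp, subst nn_integral_add[symmetric])
      (simp_all add: distrib_right[symmetric])
qed

lemma std_normal_density_le_half: "std_normal_density x \<le> 1 / 2"
proof -
  have "2 \<le> sqrt (2 * pi)"
    using pi_gt3 by (intro real_le_rsqrt) simp
  moreover have "exp (- (x\<^sup>2 / 2)) \<le> 1"
    by simp
  ultimately have "exp (- (x\<^sup>2 / 2)) / sqrt (2 * pi) \<le> 1 / 2"
    by (intro frac_le) auto
  then show ?thesis
    by (simp add: normal_density_def)
qed

text \<open>The integral is the total variation distance of two unit normals with centres
  \<open>\<delta>\<close> apart, that is, the failure probability of the coupling. It equals the
  normal mass of an interval of length \<open>\<bar>\<delta>\<bar>\<close> around 0, where the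
  density is at most 1/2.\<close>

lemma nn_integral_std_normal_deficit:
  "(\<integral>\<^sup>+g. ennreal (std_normal_density g - min (std_normal_density g) (std_normal_density (g + \<delta>))) \<partial>lborel)
    \<le> ennreal (\<bar>\<delta>\<bar> / 2)"
proof -
  let ?\<phi> = std_normal_density
  have *: "(\<integral>\<^sup>+g. ennreal (?\<phi> g - min (?\<phi> g) (?\<phi> (g + \<delta>))) \<partial>lborel) \<le> ennreal (\<delta> / 2)"
    if d: "0 \<le> \<delta>" for \<delta> :: real
  proof -
    \<comment> \<open>The deficit lives on \<open>g > - \<delta> / 2\<close>, where it is a
      difference of densities. Adding the tail beyond \<open>\<delta> / 2\<close> cancels the
      subtracted density, and the tail, being finite, can be removed from both sides at the
      end.\<close>
    let ?tail = "\<integral>\<^sup>+g. ennreal (?\<phi> g) * indicator {\<delta>/2<..} g \<partial>lborel"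
    have fin: "?tail < \<infinity>"
    proof -
      have "?tail = (\<integral>\<^sup>+g. indicator {\<delta>/2<..} g \<partial>gauss)"
        by (rule nn_integral_gauss[symmetric]) simp
      also have "\<dots> = emeasure gauss {\<delta>/2<..}"
        by simp
      also have "\<dots> \<le> 1"
        using prob_space.emeasure_le_1[OF prob_space_gauss] .
      finally show ?thesis
        by (rule order.strict_trans1) simp
    qed
    have "(\<integral>\<^sup>+g. ennreal (?\<phi> g - min (?\<phi> g) (?\<phi> (g + \<delta>))) \<partial>lborel) + ?tail =
       (\<integral>\<^sup>+g. ennreal (?\<phi> g - min (?\<phi> g) (?\<phi> (g + \<delta>))) \<partial>lborel) +
       (\<integral>\<^sup>+g. ennreal (?\<phi> (\<delta> + 1 * g)) * indicator {\<delta>/2<..} (\<delta> + 1 * g) \<partial>lborel)"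
      by (subst nn_integral_real_affine[where c=1 and t=\<delta>]) simp_all
    also have "\<dots> = (\<integral>\<^sup>+g. ennreal (?\<phi> g - min (?\<phi> g) (?\<phi> (g + \<delta>))) +
        ennreal (?\<phi> (\<delta> + 1 * g)) * indicator {\<delta>/2<..} (\<delta> + 1 * g) \<partial>lborel)"
      by (subst nn_integral_add) simp_all
    also have "\<dots> = (\<integral>\<^sup>+g. ennreal (?\<phi> g) * indicator {-\<delta>/2<..} g \<partial>lborel)"
    proof (intro nn_integral_cong)
      fix g :: real
      show "ennreal (?\<phi> g - min (?\<phi> g) (?\<phi> (g + \<delta>))) +
        ennreal (?\<phi> (\<delta> + 1 * g)) * indicator {\<delta>/2<..} (\<delta> + 1 * g) = ennreal (?\<phi> g) * indicator {-\<delta>/2<..} g"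
      proof (cases "-\<delta>/2 < g")
        case True
        then have "?\<phi> (g + \<delta>) \<le> ?\<phi> g"
          using d by (simp add: std_normal_density_le_iff)
        then show ?thesis
          using True std_normal_density_pos[of "g + \<delta>"]
          by (auto simp: min_def ennreal_plus[symmetric] add.commute simp del: ennreal_plus)
      next
        case False
        then have "?\<phi> g \<le> ?\<phi> (g + \<delta>)"
          using d by (simp add: std_normal_density_le_iff)
        then show ?thesis
          using False by (auto simp: min_def)
      qed
    qed
    also have "\<dots> \<le> (\<integral>\<^sup>+g. ennreal (1/2) * indicator {-\<delta>/2..\<delta>/2} g +
       ennreal (?\<phi> g) * indicator {\<delta>/2<..} g \<partial>lborel)"
      using std_normal_density_le_half
      by (intro nn_integral_mono) (auto simp: indicator_def intro!: ennreal_leI simp del: ennreal_half)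
    also have "\<dots> = ennreal (1/2) * emeasure lborel {-\<delta>/2..\<delta>/2} + ?tail"
      by (subst nn_integral_add) (simp_all add: nn_integral_cmult_indicator del: emeasure_lborel_Icc)
    also have "ennreal (1/2) * emeasure lborel {-\<delta>/2..\<delta>/2} = ennreal (\<delta> / 2)"
      using d by (simp add: ennreal_mult[symmetric] del: ennreal_half)
    finally show ?thesis
      using fin by (auto simp: ennreal_add_left_cancel_le add.commute[of _ ?tail] simp del: ennreal_half)
  qed
  show ?thesis
  proof (cases "0 \<le> \<delta>")
    case True
    then show ?thesis using *[of \<delta>] by simp
  next
    case False
    have "(\<integral>\<^sup>+g. ennreal (?\<phi> g - min (?\<phi> g) (?\<phi> (g + \<delta>))) \<partial>lborel)
      = ennreal \<bar>-1\<bar> * (\<integral>\<^sup>+g. ennreal (?\<phi> (0 + (-1) * g) - min (?\<phi> (0 + (-1) * g)) (?\<phi> (0 + (-1) * g + \<delta>))) \<partial>lborel)"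
      by (rule nn_integral_real_affine) simp_all
    also have "\<dots> = (\<integral>\<^sup>+g. ennreal (?\<phi> g - min (?\<phi> g) (?\<phi> (g + (-\<delta>)))) \<partial>lborel)"
    proof -
      have "?\<phi> (0 + (-1) * g) = ?\<phi> g" "?\<phi> (0 + (-1) * g + \<delta>) = ?\<phi> (g + (-\<delta>))" for g
        using std_normal_density_minus[of g] std_normal_density_minus[of "g - \<delta>"] by simp_all
      then show ?thesis by simp
    qed
    also have "\<dots> \<le> ennreal (\<bar>\<delta>\<bar> / 2)"
      using *[of "-\<delta>"] False by simp
    finally show ?thesis .
  qed
qed

lemma nn_integral_gauss_affine_square:
  "(\<integral>\<^sup>+g. ennreal ((a + b * g)\<^sup>2) \<partial>gauss) = ennreal (a\<^sup>2 + b\<^sup>2)"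
proof -
  let ?\<phi> = std_normal_density
  have "has_bochner_integral lborel
     (\<lambda>g. a\<^sup>2 * ?\<phi> g + 2 * a * b * (?\<phi> g * g ^ (2 * 0 + 1)) + b\<^sup>2 * (?\<phi> g * g ^ (2 * 1)))
     (a\<^sup>2 * (fact (2 * 0) / (2^0 * fact 0)) + 2 * a * b * 0 + b\<^sup>2 * (fact (2 * 1) / (2^1 * fact 1)))"
    using std_normal_moment_even[of 0] std_normal_moment_odd[of 0] std_normal_moment_even[of 1]
    by (intro has_bochner_integral_add has_bochner_integral_mult_right) simp_all
  then have "has_bochner_integral lborel (\<lambda>g. ?\<phi> g * (a + b * g)\<^sup>2) (a\<^sup>2 + b\<^sup>2)"
    by (simp add: power2_eq_square algebra_simps)
  then have "(\<integral>\<^sup>+g. ennreal (?\<phi> g * (a + b * g)\<^sup>2) \<partial>lborel) = ennreal (a\<^sup>2 + b\<^sup>2)"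
    by (subst nn_integral_eq_integral) (auto simp: has_bochner_integral_iff)
  then show ?thesis
    by (subst nn_integral_gauss) (simp_all add: ennreal_mult)
qed

subsection \<open>The sequential mask\<close>

lemma sets_opt_borel: "sets opt_borel = sigma_sets UNIV ({{None}} \<union> {Some ` A | A. A \<in> sets borel})"
  unfolding opt_borel_def by (rule sets_measure_of) auto

lemma space_opt_borel [simp]: "space opt_borel = UNIV"
  unfolding opt_borel_def by (rule space_measure_of) auto

lemma measurable_Some_opt_borel [measurable]: "Some \<in> borel \<rightarrow>\<^sub>M opt_borel"
  unfolding opt_borel_def
proof (rule measurable_measure_of)
  fix A :: "real option set"
  assume "A \<in> {{None}} \<union> {Some ` A | A. A \<in> sets borel}"
  moreover have "Some -` {None} = ({} :: real set)" "Some -` Some ` B = B" for B :: "real set"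
    by auto
  ultimately show "Some -` A \<inter> space borel \<in> sets borel"
    by auto
qed auto

lemma measurable_map_uminus_opt_borel [measurable]: "map_option uminus \<in> opt_borel \<rightarrow>\<^sub>M opt_borel"
  unfolding opt_borel_def
proof (rule measurable_measure_of)
  fix A :: "real option set"
  assume A: "A \<in> {{None}} \<union> {Some ` A | A. A \<in> sets borel}"
  have N: "map_option uminus -` {None} = {None :: real option}"
    by auto
  have S: "map_option uminus -` Some ` B = Some ` (uminus -` B)" for B :: "real set"
    by (force simp: image_iff)
  have U: "uminus -` B \<in> sets borel" if "B \<in> sets borel" for B :: "real set"
    using measurable_sets[OF borel_measurable_uminus[OF measurable_ident], of B] that by simp
  have "map_option uminus -` A \<in> {{None}} \<union> {Some ` A | A. A \<in> sets borel}"
  proof (cases "A = {None}")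
    case False
    then obtain B where "A = Some ` B" "B \<in> sets borel"
      using A by blast
    then show ?thesis
      using S[of B] U[of B] by blast
  qed (simp add: N)
  then have "map_option uminus -` A \<in> sets opt_borel"
    unfolding sets_opt_borel by (rule sigma_sets.Basic)
  then show "map_option uminus -` A \<inter> space (sigma UNIV ({{None}} \<union> {Some ` A | A. A \<in> sets borel}))
    \<in> sets (sigma UNIV ({{None}} \<union> {Some ` A | A. A \<in> sets borel}))"
    by (simp add: opt_borel_def)
qed auto

lemma None_in_sets_opt_borel [measurable]: "{None} \<in> sets opt_borel"
  unfolding sets_opt_borel by (rule sigma_sets.Basic) auto

lemma Some_in_sets_opt_borel [measurable]: "{Some c} \<in> sets opt_borel"
proof -
  have "{Some c} = Some ` {c}"
    by simp
  then show ?thesis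
    unfolding sets_opt_borel
    by (intro sigma_sets.Basic UnI2 CollectI exI[of _ "{c}"]) simp
qed

lemma pred_opt_borel_eq: "Measurable.pred opt_borel (\<lambda>y. y = v)"
proof -
  have "{v} \<in> sets opt_borel"
    by (cases v) (simp_all add: None_in_sets_opt_borel Some_in_sets_opt_borel)
  then show ?thesis
    by (simp add: pred_def)
qed

text \<open>With $m + 2$ coordinates of sum $\sqrt{m+2}\,r$ left, the next coordinate is $x = c r + s g$ and the
  remaining $m + 1$ coordinates have sum $\sqrt{m+1}\,(s r - c g)$.\<close>

definition cw :: "nat \<Rightarrow> real" where
  "cw m = 1 / sqrt (real m + 2)"

definition sw :: "nat \<Rightarrow> real" where
  "sw m = sqrt ((real m + 1) / (real m + 2))"

lemma cw_sw: "(cw m)\<^sup>2 + (sw m)\<^sup>2 = 1" "cw m > 0" "sw m > 0"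
  by (auto simp: cw_def sw_def power_divide field_simps)

text \<open>\<open>(x - c r) / s\<close> is the innovation of \<open>x\<close>, and
  \<open>(x + c r') / s\<close> is minus the innovation that would give the partner the coordinate
  \<open>- x\<close>. The test is rejection sampling of the second density against the first with
  the coin \<open>u\<close>, so \<open>keep\<close> says that the partner takes
  \<open>- x\<close>.\<close>

definition keep :: "nat \<Rightarrow> real \<Rightarrow> real \<Rightarrow> real \<Rightarrow> real \<Rightarrow> bool" where
  "keep m r r' x u \<longleftrightarrow>
    u * std_normal_density ((x - cw m * r) / sw m) \<le> std_normal_density ((x + cw m * r') / sw m)"

text \<open>The solution \<open>r1\<close> of \<open>r = c x + s r1\<close>: the normalised sum of
  the coordinates left after \<open>x\<close>.\<close>

definition resid :: "nat \<Rightarrow> real \<Rightarrow> real \<Rightarrow> real" where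
  "resid m r x = (r - cw m * x) / sw m"

text \<open>If $x$ is hidden, the partner vector keeps the innovation $g$ of $x$, so that its coordinate is
  $c r' + s g = x + c (r' - r)$.\<close>

definition presid :: "nat \<Rightarrow> real \<Rightarrow> real \<Rightarrow> real \<Rightarrow> real \<Rightarrow> real" where
  "presid m r r' x u = resid m r' (if keep m r r' x u then - x else x + cw m * (r' - r))"

text \<open>The last coordinate is determined by the sum and always hidden.\<close>

primrec mask :: "nat \<Rightarrow> real \<Rightarrow> real \<Rightarrow> (nat \<Rightarrow> real) \<Rightarrow> (nat \<Rightarrow> real) \<Rightarrow> nat \<Rightarrow> real option" where
  "mask 0 = (\<lambda>r r' x w. (\<lambda>_. undefined)(0 := None))"
| "mask (Suc m) = (\<lambda>r r' x w.
    (mask m (resid m r (x (Suc m))) (presid m r r' (x (Suc m)) (w m)) x w)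
      (Suc m := if keep m r r' (x (Suc m)) (w m) then Some (x (Suc m)) else None))"

text \<open>The recursion of \<open>mask\<close> with the sum given and the coordinates generated
  from it by independent innovations and coins \<open>v k = (g, u)\<close>. For normal data this is
  the law of the mask conditional on the sum.\<close>

primrec gmask :: "nat \<Rightarrow> real \<Rightarrow> real \<Rightarrow> (nat \<Rightarrow> real \<times> real) \<Rightarrow> nat \<Rightarrow> real option" where
  "gmask 0 = (\<lambda>r r' v. (\<lambda>_. undefined)(0 := None))"
| "gmask (Suc m) = (\<lambda>r r' v. let x = cw m * r + sw m * fst (v m); u = snd (v m) in
    (gmask m (resid m r x) (presid m r r' x u) v)
      (Suc m := if keep m r r' x u then Some x else None))"

definition rsum :: "nat \<Rightarrow> (nat \<Rightarrow> real) \<Rightarrow> real" where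
  "rsum m x = (\<Sum>k<Suc m. x k) / sqrt (real m + 1)"

lemma mask_cong:
  "(\<And>k. k \<le> m \<Longrightarrow> x k = x' k) \<Longrightarrow> (\<And>k. k < m \<Longrightarrow> w k = w' k) \<Longrightarrow> mask m r r' x w = mask m r r' x' w'"
proof (induction m arbitrary: r r')
  case (Suc m)
  have "mask m a b x w = mask m a b x' w'" for a b
    using Suc.prems by (intro Suc.IH) auto
  then show ?case
    using Suc.prems(1)[of "Suc m"] Suc.prems(2)[of m] by (simp only: mask.simps le_refl lessI simp_thms)
qed simp

lemma gmask_cong:
  "(\<And>k. k < m \<Longrightarrow> v k = v' k) \<Longrightarrow> gmask m r r' v = gmask m r r' v'"
proof (induction m arbitrary: r r')
  case (Suc m)
  have "gmask m a b v = gmask m a b v'" for a b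
    using Suc.prems by (intro Suc.IH) auto
  then show ?case
    using Suc.prems[of m] by (simp only: gmask.simps lessI simp_thms)
qed simp

lemma rsum_Suc: "rsum (Suc m) (x(Suc m := y)) = cw m * y + sw m * rsum m x"
proof -
  have "sw m = sqrt (real m + 1) / sqrt (real m + 2)"
    by (simp only: sw_def real_sqrt_divide)
  moreover have "(\<Sum>k<Suc m. (x(Suc m := y)) k) = (\<Sum>k<Suc m. x k)"
    by (intro sum.cong) auto
  ultimately show ?thesis
    by (simp add: rsum_def cw_def add_divide_distrib add.commute sum.lessThan_Suc[of _ "Suc m"] del: sum.lessThan_Suc)
qed

section \<open>Measurability of the recursions\<close>

lemma measurable_keep [measurable (raw)]:
  assumes [measurable]: "a \<in> borel_measurable M" "b \<in> borel_measurable M" "x \<in> borel_measurable M" "u \<in> borel_measurable M"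
  shows "Measurable.pred M (\<lambda>p. keep m (a p) (b p) (x p) (u p))"
  unfolding keep_def by measurable

lemma measurable_resid [measurable (raw)]:
  assumes [measurable]: "a \<in> borel_measurable M" "x \<in> borel_measurable M"
  shows "(\<lambda>p. resid m (a p) (x p)) \<in> borel_measurable M"
  unfolding resid_def by measurable

lemma measurable_presid [measurable (raw)]:
  assumes [measurable]: "a \<in> borel_measurable M" "b \<in> borel_measurable M" "x \<in> borel_measurable M" "u \<in> borel_measurable M"
  shows "(\<lambda>p. presid m (a p) (b p) (x p) (u p)) \<in> borel_measurable M"
  unfolding presid_def by measurable

abbreviation obs_space :: "nat \<Rightarrow> (nat \<Rightarrow> real option) measure" where
  "obs_space d \<equiv> PiM {..<d} (\<lambda>_. opt_borel)"

lemma measurable_upd_obs [measurable (raw)]: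
  assumes "z \<in> M \<rightarrow>\<^sub>M obs_space n" "v \<in> M \<rightarrow>\<^sub>M opt_borel"
  shows "(\<lambda>p. (z p)(n := v p)) \<in> M \<rightarrow>\<^sub>M obs_space (Suc n)"
  using assms by (intro measurable_fun_upd[where J="{..<n}"]) auto

lemma pred_obs_None: "k < d \<Longrightarrow> Measurable.pred (obs_space d) (\<lambda>z. z k = None)"
proof -
  assume "k < d"
  then have "(\<lambda>z. z k) \<in> obs_space d \<rightarrow>\<^sub>M opt_borel"
    by (intro measurable_component_singleton) simp
  from measurable_compose[OF this pred_opt_borel_eq] show ?thesis .
qed

text \<open>Starting the recursion from \<open>undefined\<close> makes every mask extensional, as
  elements of a finite product space must be.\<close>

lemma undefined_upd_in_space: "(\<lambda>_. undefined)(0 := v) \<in> space (obs_space (Suc 0))"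
  by (auto simp: space_PiM PiE_def extensional_def)

lemma measurable_mask [measurable (raw)]:
  assumes "a \<in> borel_measurable M" "b \<in> borel_measurable M"
    and "x \<in> M \<rightarrow>\<^sub>M PiM {..<Suc m} (\<lambda>_. borel)" "w \<in> M \<rightarrow>\<^sub>M PiM {..<m} (\<lambda>_. borel)"
  shows "(\<lambda>p. mask m (a p) (b p) (x p) (w p)) \<in> M \<rightarrow>\<^sub>M obs_space (Suc m)"
proof -
  \<comment> \<open>The induction lowers \<open>m\<close> while \<open>x\<close> and
    \<open>w\<close> stay vectors on the larger index set, so it needs hypotheses on the components
    instead of membership in a product space.\<close>
  have "(\<lambda>p. mask m (a p) (b p) (x p) (w p)) \<in> M \<rightarrow>\<^sub>M obs_space (Suc m)"
    if "a \<in> borel_measurable M" "b \<in> borel_measurable M"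
      "\<And>k. k \<le> m \<Longrightarrow> (\<lambda>p. x p k) \<in> borel_measurable M" "\<And>k. k < m \<Longrightarrow> (\<lambda>p. w p k) \<in> borel_measurable M"
    using that
  proof (induction m arbitrary: a b)
    case 0
    show ?case
      unfolding mask.simps gmask.simps by (rule measurable_const) (rule undefined_upd_in_space)
  next
    case (Suc m)
    note [measurable] = Suc.prems(1,2) Suc.prems(3)[of "Suc m", simplified] Suc.prems(4)[of m, simplified]
    have [measurable]: "(\<lambda>p. mask m (a' p) (b' p) (x p) (w p)) \<in> M \<rightarrow>\<^sub>M obs_space (Suc m)"
      if "a' \<in> borel_measurable M" "b' \<in> borel_measurable M" for a' b'
      using Suc.IH[OF that] Suc.prems(3,4) by simp
    show ?case
      unfolding mask.simps by measurable
  qed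
  moreover have "(\<lambda>p. x p k) \<in> borel_measurable M" if "k \<le> m" for k
    using measurable_compose[OF assms(3) measurable_component_singleton[of k]] that by simp
  moreover have "(\<lambda>p. w p k) \<in> borel_measurable M" if "k < m" for k
    using measurable_compose[OF assms(4) measurable_component_singleton[of k]] that by simp
  ultimately show ?thesis
    using assms by blast
qed

lemma measurable_gmask [measurable (raw)]:
  assumes "a \<in> borel_measurable M" "b \<in> borel_measurable M"
    and "v \<in> M \<rightarrow>\<^sub>M PiM {..<m} (\<lambda>_. borel \<Otimes>\<^sub>M borel)"
  shows "(\<lambda>p. gmask m (a p) (b p) (v p)) \<in> M \<rightarrow>\<^sub>M obs_space (Suc m)"
proof -
  have "(\<lambda>p. gmask m (a p) (b p) (v p)) \<in> M \<rightarrow>\<^sub>M obs_space (Suc m)"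
    if "a \<in> borel_measurable M" "b \<in> borel_measurable M"
      "\<And>k. k < m \<Longrightarrow> (\<lambda>p. v p k) \<in> M \<rightarrow>\<^sub>M borel \<Otimes>\<^sub>M borel"
    using that
  proof (induction m arbitrary: a b)
    case 0
    show ?case
      unfolding mask.simps gmask.simps by (rule measurable_const) (rule undefined_upd_in_space)
  next
    case (Suc m)
    note [measurable] = Suc.prems(1,2) Suc.prems(3)[of m, simplified]
    have [measurable]: "(\<lambda>p. gmask m (a' p) (b' p) (v p)) \<in> M \<rightarrow>\<^sub>M obs_space (Suc m)"
      if "a' \<in> borel_measurable M" "b' \<in> borel_measurable M" for a' b'
      using Suc.IH[OF that] Suc.prems(3) by simp
    show ?case
      unfolding gmask.simps Let_def by measurable
  qed
  moreover have "(\<lambda>p. v p k) \<in> M \<rightarrow>\<^sub>M borel \<Otimes>\<^sub>M borel" if "k < m" for k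
    using measurable_compose[OF assms(3) measurable_component_singleton[of k]] that by simp
  ultimately show ?thesis
    using assms by blast
qed

lemma measurable_rsum [measurable (raw)]:
  assumes "x \<in> M \<rightarrow>\<^sub>M PiM {..<Suc m} (\<lambda>_. borel)"
  shows "(\<lambda>p. rsum m (x p)) \<in> borel_measurable M"
proof -
  have "(\<lambda>p. x p k) \<in> borel_measurable M" if "k < Suc m" for k
    using measurable_compose[OF assms measurable_component_singleton[of k]] that by simp
  then show ?thesis
    unfolding rsum_def by (intro borel_measurable_divide borel_measurable_sum) auto
qed

section \<open>The mask of a normal vector, given its sum\<close>

lemma sets_PiM_gauss_unif [measurable_cong]:
  "sets (PiM I (\<lambda>_. gauss)) = sets (PiM I (\<lambda>_. borel))"
  "sets (PiM I (\<lambda>_. unif)) = sets (PiM I (\<lambda>_. borel))"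
  "sets (PiM I (\<lambda>_. gauss \<Otimes>\<^sub>M unif)) = sets (PiM I (\<lambda>_. borel \<Otimes>\<^sub>M borel))"
  by (auto intro!: sets_PiM_cong sets_pair_measure_cong)

lemma prob_space_pair_gauss_unif: "prob_space (gauss \<Otimes>\<^sub>M unif)"
  by (rule prob_space_pair) simp_all

lemma nn_integral_PiM_lessThan_Suc:
  assumes M: "prob_space M" and f: "f \<in> borel_measurable (PiM {..<Suc n} (\<lambda>_. M))"
  shows "(\<integral>\<^sup>+x. f x \<partial>PiM {..<Suc n} (\<lambda>_. M)) = (\<integral>\<^sup>+y. \<integral>\<^sup>+x. f (x(n := y)) \<partial>PiM {..<n} (\<lambda>_. M) \<partial>M)"
proof -
  interpret product_sigma_finite "\<lambda>_::nat. M"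
    using M by (simp add: product_sigma_finite_def prob_space_imp_sigma_finite)
  show ?thesis
    using f unfolding lessThan_Suc by (subst product_nn_integral_insert_rev) auto
qed

lemma nn_integral_swap:
  assumes "prob_space M" "prob_space N" "case_prod f \<in> borel_measurable (M \<Otimes>\<^sub>M N)"
  shows "(\<integral>\<^sup>+x. \<integral>\<^sup>+y. f x y \<partial>N \<partial>M) = (\<integral>\<^sup>+y. \<integral>\<^sup>+x. f x y \<partial>M \<partial>N)"
  using assms by (intro pair_sigma_finite.Fubini'[symmetric])
    (auto simp: pair_sigma_finite_def prob_space_imp_sigma_finite)

lemma nn_integral_pair_prob:
  assumes "prob_space N" "case_prod f \<in> borel_measurable (M \<Otimes>\<^sub>M N)"
  shows "(\<integral>\<^sup>+x. \<integral>\<^sup>+y. f x y \<partial>N \<partial>M) = (\<integral>\<^sup>+p. f (fst p) (snd p) \<partial>(M \<Otimes>\<^sub>M N))"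
  using sigma_finite_measure.nn_integral_fst[OF prob_space_imp_sigma_finite[OF assms(1)] assms(2)]
  by (simp add: case_prod_beta')

lemma nn_integral_gauss_reflect:
  fixes m :: nat
  assumes "case_prod H \<in> borel_measurable (borel \<Otimes>\<^sub>M borel)"
  shows "(\<integral>\<^sup>+x. \<integral>\<^sup>+r. H x r \<partial>gauss \<partial>gauss) =
    (\<integral>\<^sup>+r. \<integral>\<^sup>+g. H (cw m * r + sw m * g) (sw m * r - cw m * g) \<partial>gauss \<partial>gauss)"
  using gauss_reflection_invariant[OF assms cw_sw(1)[of m] cw_sw(3)[of m]] by simp

lemma resid_sum: "resid m (cw m * x + sw m * r) x = r"
  using cw_sw(3)[of m] by (simp add: resid_def)

lemma borel_measurable_nn_integral_prob:
  assumes "prob_space N" "case_prod f \<in> borel_measurable (M \<Otimes>\<^sub>M N)"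
  shows "(\<lambda>x. \<integral>\<^sup>+y. f x y \<partial>N) \<in> borel_measurable M"
  by (rule sigma_finite_measure.borel_measurable_nn_integral[OF prob_space_imp_sigma_finite[OF assms(1)] assms(2)])

text \<open>The residual of the partner is an arbitrary function $\psi$ of the residual of $x$, because in the
  induction it depends on the coordinates of $x$ treated before.\<close>

lemma mask_eq_gmask:
  assumes "\<psi> \<in> borel_measurable borel" "F \<in> borel_measurable (obs_space (Suc m) \<Otimes>\<^sub>M borel)"
  shows "(\<integral>\<^sup>+x. \<integral>\<^sup>+w. F (mask m (rsum m x) (\<psi> (rsum m x)) x w, rsum m x)
      \<partial>PiM {..<m} (\<lambda>_. unif) \<partial>PiM {..<Suc m} (\<lambda>_. gauss))
    = (\<integral>\<^sup>+r. \<integral>\<^sup>+v. F (gmask m r (\<psi> r) v, r) \<partial>PiM {..<m} (\<lambda>_. gauss \<Otimes>\<^sub>M unif) \<partial>gauss)"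
  using assms
proof (induction m arbitrary: \<psi> F)
  case 0
  note [measurable] = 0
  interpret product_sigma_finite "\<lambda>_::nat. gauss"
    by (simp add: product_sigma_finite_def prob_space_imp_sigma_finite)
  have E: "prob_space (PiM {} (\<lambda>_::nat. unif))" "prob_space (PiM {} (\<lambda>_::nat. gauss \<Otimes>\<^sub>M unif))"
    by (auto intro!: prob_space_PiM prob_space_pair)
  define z where "z = (\<lambda>_. undefined)(0 :: nat := None :: real option)"
  have [measurable]: "z \<in> space (obs_space (Suc 0))"
    unfolding z_def by (rule undefined_upd_in_space)
  have "(\<integral>\<^sup>+x. F (z, x (0::nat)) \<partial>PiM {0} (\<lambda>_. gauss)) = (\<integral>\<^sup>+r. F (z, r) \<partial>gauss)"
    by (rule product_nn_integral_singleton) measurable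
  moreover have "{..<Suc 0} = {0::nat}"
    by auto
  ultimately show ?case
    by (simp add: rsum_def z_def[symmetric] prob_space.emeasure_space_1[OF E(1)] prob_space.emeasure_space_1[OF E(2)])
next
  case (Suc m)
  note [measurable] = Suc.prems
  let ?X = "\<lambda>n. PiM {..<n} (\<lambda>_. gauss)" and ?W = "PiM {..<m} (\<lambda>_. unif)"
    and ?G = "PiM {..<m} (\<lambda>_. gauss \<Otimes>\<^sub>M unif)"
  have P: "prob_space (?X n)" "prob_space ?W" "prob_space ?G" "prob_space (gauss \<Otimes>\<^sub>M unif)" for n
    by (auto intro!: prob_space_PiM prob_space_pair)
  note [measurable (raw)] = borel_measurable_nn_integral_prob[OF P(1)]
    borel_measurable_nn_integral_prob[OF P(2)] borel_measurable_nn_integral_prob[OF P(3)]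
    borel_measurable_nn_integral_prob[OF prob_space_unif] borel_measurable_nn_integral_prob[OF prob_space_gauss]
  define up where "up r r' x u z = z(Suc m := if keep m r r' x u then Some x else None)" for r r' x u and z :: "nat \<Rightarrow> real option"
  have [measurable]: "(\<lambda>p. up (a p) (b p) (x p) (u p) (z p)) \<in> M \<rightarrow>\<^sub>M obs_space (Suc (Suc m))"
    if [measurable]: "a \<in> borel_measurable M" "b \<in> borel_measurable M" "x \<in> borel_measurable M"
      "u \<in> borel_measurable M" "z \<in> M \<rightarrow>\<^sub>M obs_space (Suc m)" for a b x u z and M :: "'z measure"
    unfolding up_def by measurable
  define R where "R y r = cw m * y + sw m * r" for y r
  have [measurable]: "case_prod R \<in> borel_measurable (borel \<Otimes>\<^sub>M borel)"
    unfolding R_def by measurable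
  define T where "T y u z r = F (up (R y r) (\<psi> (R y r)) y u z, R y r)" for y u z r
  \<comment> \<open>With the top coordinate \<open>y\<close> and its coin \<open>u\<close> fixed,
    the residual of the partner depends on the own residual \<open>r\<close> alone, so
    \<open>\<Psi> y u\<close> can take the place of \<open>\<psi>\<close> in the induction
    hypothesis.\<close>
  define \<Psi> where "\<Psi> y u r = presid m (R y r) (\<psi> (R y r)) y u" for y u r
  have [measurable]: "(\<lambda>p. T (y p) (u p) (z p) (r p)) \<in> borel_measurable M"
    if [measurable]: "r \<in> borel_measurable M" "y \<in> borel_measurable M"
      "u \<in> borel_measurable M" "z \<in> M \<rightarrow>\<^sub>M obs_space (Suc m)" for y u z r and M :: "'z measure"
    unfolding T_def R_def by measurable
  have [measurable]: "(\<lambda>p. \<Psi> (y p) (u p) (r p)) \<in> borel_measurable M"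
    if [measurable]: "r \<in> borel_measurable M" "y \<in> borel_measurable M" "u \<in> borel_measurable M"
    for y u r and M :: "'z measure"
    unfolding \<Psi>_def R_def by measurable
  have mask_T: "F (mask (Suc m) (rsum (Suc m) (x(Suc m := y))) (\<psi> (rsum (Suc m) (x(Suc m := y)))) (x(Suc m := y)) (w(m := u)),
         rsum (Suc m) (x(Suc m := y)))
    = T y u (mask m (rsum m x) (\<Psi> y u (rsum m x)) x w) (rsum m x)" for x y w u
  proof -
    have "mask m a b (x(Suc m := y)) (w(m := u)) = mask m a b x w" for a b
      by (rule mask_cong) auto
    then show ?thesis
      by (simp add: rsum_Suc T_def \<Psi>_def R_def up_def resid_sum)
  qed
  have gmask_T: "F (gmask (Suc m) r (\<psi> r) (v(m := (g, u))), r) =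
     (let y = cw m * r + sw m * g; r1 = sw m * r - cw m * g in T y u (gmask m r1 (\<Psi> y u r1) v) r1)" for r v g u
  proof -
    have "gmask m a b (v(m := (g, u))) = gmask m a b v" for a b
      by (rule gmask_cong) auto
    moreover have "R (cw m * r + sw m * g) (sw m * r - cw m * g) = r"
    proof -
      have "R (cw m * r + sw m * g) (sw m * r - cw m * g) = ((cw m)\<^sup>2 + (sw m)\<^sup>2) * r"
        by (simp add: R_def power2_eq_square algebra_simps)
      then show ?thesis by (simp add: cw_sw(1))
    qed
    moreover have "resid m r (cw m * r + sw m * g) = sw m * r - cw m * g"
      using resid_sum[of m "cw m * r + sw m * g" "sw m * r - cw m * g"] calculation(2) by (simp add: R_def)
    ultimately show ?thesis
      by (simp add: T_def \<Psi>_def up_def Let_def)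
  qed
  have "(\<integral>\<^sup>+x. \<integral>\<^sup>+w. F (mask (Suc m) (rsum (Suc m) x) (\<psi> (rsum (Suc m) x)) x w, rsum (Suc m) x)
      \<partial>PiM {..<Suc m} (\<lambda>_. unif) \<partial>?X (Suc (Suc m)))
    = (\<integral>\<^sup>+y. \<integral>\<^sup>+x. \<integral>\<^sup>+w. F (mask (Suc m) (rsum (Suc m) (x(Suc m := y))) (\<psi> (rsum (Suc m) (x(Suc m := y)))) (x(Suc m := y)) w,
         rsum (Suc m) (x(Suc m := y))) \<partial>PiM {..<Suc m} (\<lambda>_. unif) \<partial>?X (Suc m) \<partial>gauss)"
  proof (rule nn_integral_PiM_lessThan_Suc)
    have "prob_space (PiM {..<Suc m} (\<lambda>_. unif))"
      by (auto intro!: prob_space_PiM)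
    from borel_measurable_nn_integral_prob[OF this]
    show "(\<lambda>x. \<integral>\<^sup>+w. F (mask (Suc m) (rsum (Suc m) x) (\<psi> (rsum (Suc m) x)) x w, rsum (Suc m) x)
      \<partial>PiM {..<Suc m} (\<lambda>_. unif)) \<in> borel_measurable (?X (Suc (Suc m)))"
      by measurable
  qed simp
  also have "\<dots> = (\<integral>\<^sup>+y. \<integral>\<^sup>+x. \<integral>\<^sup>+u. \<integral>\<^sup>+w. T y u (mask m (rsum m x) (\<Psi> y u (rsum m x)) x w) (rsum m x)
      \<partial>?W \<partial>unif \<partial>?X (Suc m) \<partial>gauss)"
  proof (rule nn_integral_cong, rule nn_integral_cong)
    fix y :: real and x assume x: "x \<in> space (?X (Suc m))"
    then have [measurable]: "x(Suc m := y) \<in> space (PiM {..<Suc (Suc m)} (\<lambda>_. borel))"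
      by (auto simp: space_PiM PiE_def extensional_def)
    show "(\<integral>\<^sup>+w. F (mask (Suc m) (rsum (Suc m) (x(Suc m := y))) (\<psi> (rsum (Suc m) (x(Suc m := y)))) (x(Suc m := y)) w,
         rsum (Suc m) (x(Suc m := y))) \<partial>PiM {..<Suc m} (\<lambda>_. unif))
       = (\<integral>\<^sup>+u. \<integral>\<^sup>+w. T y u (mask m (rsum m x) (\<Psi> y u (rsum m x)) x w) (rsum m x) \<partial>?W \<partial>unif)"
      unfolding mask_T[symmetric] by (rule nn_integral_PiM_lessThan_Suc) measurable
  qed
  also have "\<dots> = (\<integral>\<^sup>+y. \<integral>\<^sup>+u. \<integral>\<^sup>+x. \<integral>\<^sup>+w. T y u (mask m (rsum m x) (\<Psi> y u (rsum m x)) x w) (rsum m x)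
      \<partial>?W \<partial>?X (Suc m) \<partial>unif \<partial>gauss)"
    by (rule nn_integral_cong, rule nn_integral_swap) (use P in measurable)
  also have "\<dots> = (\<integral>\<^sup>+y. \<integral>\<^sup>+u. \<integral>\<^sup>+r. \<integral>\<^sup>+v. T y u (gmask m r (\<Psi> y u r) v) r \<partial>?G \<partial>gauss \<partial>unif \<partial>gauss)"
  proof (rule nn_integral_cong, rule nn_integral_cong)
    fix y u :: real
    show "(\<integral>\<^sup>+x. \<integral>\<^sup>+w. T y u (mask m (rsum m x) (\<Psi> y u (rsum m x)) x w) (rsum m x) \<partial>?W \<partial>?X (Suc m))
      = (\<integral>\<^sup>+r. \<integral>\<^sup>+v. T y u (gmask m r (\<Psi> y u r) v) r \<partial>?G \<partial>gauss)"
      using Suc.IH[of "\<Psi> y u" "\<lambda>p. T y u (fst p) (snd p)"] by simp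
  qed
  also have "\<dots> = (\<integral>\<^sup>+y. \<integral>\<^sup>+r. \<integral>\<^sup>+u. \<integral>\<^sup>+v. T y u (gmask m r (\<Psi> y u r) v) r \<partial>?G \<partial>unif \<partial>gauss \<partial>gauss)"
    by (rule nn_integral_cong, rule nn_integral_swap) (use P in measurable)
  \<comment> \<open>The top coordinate and the residual are independent standard normals. The
    reflection trades them for the total \<open>r\<close> and the innovation \<open>g\<close> of the
    top coordinate, which are the inputs of \<open>gmask\<close>.\<close>
  also have "\<dots> = (\<integral>\<^sup>+r. \<integral>\<^sup>+g. \<integral>\<^sup>+u. \<integral>\<^sup>+v. F (gmask (Suc m) r (\<psi> r) (v(m := (g, u))), r) \<partial>?G \<partial>unif \<partial>gauss \<partial>gauss)"
    unfolding gmask_T Let_def by (rule nn_integral_gauss_reflect) measurable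
  also have "\<dots> = (\<integral>\<^sup>+r. \<integral>\<^sup>+v. F (gmask (Suc m) r (\<psi> r) v, r) \<partial>PiM {..<Suc m} (\<lambda>_. gauss \<Otimes>\<^sub>M unif) \<partial>gauss)"
  proof (rule nn_integral_cong)
    fix r :: real
    have "(\<integral>\<^sup>+g. \<integral>\<^sup>+u. \<integral>\<^sup>+v. F (gmask (Suc m) r (\<psi> r) (v(m := (g, u))), r) \<partial>?G \<partial>unif \<partial>gauss)
      = (\<integral>\<^sup>+p. \<integral>\<^sup>+v. F (gmask (Suc m) r (\<psi> r) (v(m := p)), r) \<partial>?G \<partial>(gauss \<Otimes>\<^sub>M unif))"
    proof -
      define Q where "Q g u = (\<integral>\<^sup>+v. T (cw m * r + sw m * g) u
        (gmask m (sw m * r - cw m * g) (\<Psi> (cw m * r + sw m * g) u (sw m * r - cw m * g)) v)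
        (sw m * r - cw m * g) \<partial>?G)" for g u
      have "case_prod Q \<in> borel_measurable (gauss \<Otimes>\<^sub>M unif)"
        unfolding Q_def by measurable
      from nn_integral_pair_prob[OF prob_space_unif this] show ?thesis
        using gmask_T[of r _ "fst p" "snd p" for p] by (simp add: gmask_T Q_def Let_def del: gmask.simps)
    qed
    also have "\<dots> = (\<integral>\<^sup>+v. F (gmask (Suc m) r (\<psi> r) v, r) \<partial>PiM {..<Suc m} (\<lambda>_. gauss \<Otimes>\<^sub>M unif))"
      by (rule nn_integral_PiM_lessThan_Suc[symmetric, OF P(4)]) measurable
    finally show "(\<integral>\<^sup>+g. \<integral>\<^sup>+u. \<integral>\<^sup>+v. F (gmask (Suc m) r (\<psi> r) (v(m := (g, u))), r) \<partial>?G \<partial>unif \<partial>gauss) = \<dots>" .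
  qed
  finally show ?case .
qed

subsection \<open>Symmetry of the mask and the number of hidden coordinates\<close>

definition neg_obs :: "nat \<Rightarrow> (nat \<Rightarrow> real option) \<Rightarrow> nat \<Rightarrow> real option" where
  "neg_obs d z = (\<lambda>k\<in>{..<d}. map_option uminus (z k))"

lemma measurable_neg_obs [measurable]: "neg_obs d \<in> obs_space d \<rightarrow>\<^sub>M obs_space d"
  unfolding neg_obs_def
proof (rule measurable_restrict)
  fix k assume "k \<in> {..<d}"
  then have "(\<lambda>z. z k) \<in> obs_space d \<rightarrow>\<^sub>M opt_borel"
    by (intro measurable_component_singleton)
  then show "(\<lambda>z. map_option uminus (z k)) \<in> obs_space d \<rightarrow>\<^sub>M opt_borel"
    by (rule measurable_compose) (rule measurable_map_uminus_opt_borel)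
qed

lemma neg_obs_upd: "neg_obs (Suc n) (z(n := v)) = (neg_obs n z)(n := map_option uminus v)"
  by (auto simp: neg_obs_def fun_eq_iff restrict_def)

text \<open>Expressed through the innovation, the residual is the second component of the plane
  reflection.\<close>

lemma resid_step: "resid m r (cw m * r + sw m * g) = sw m * r - cw m * g"
proof -
  have "cw m * (cw m * r + sw m * g) + sw m * (sw m * r - cw m * g) = ((cw m)\<^sup>2 + (sw m)\<^sup>2) * r"
    by (simp add: power2_eq_square algebra_simps)
  then show ?thesis
    using resid_sum[of m "cw m * r + sw m * g" "sw m * r - cw m * g"] by (simp add: cw_sw(1))
qed

lemma prob_space_innovations: "prob_space (PiM I (\<lambda>_. gauss \<Otimes>\<^sub>M unif))"
  by (intro prob_space_PiM prob_space_pair_gauss_unif)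

lemma measurable_nn_integral_innovations [measurable (raw)]:
  "case_prod f \<in> borel_measurable (M \<Otimes>\<^sub>M PiM I (\<lambda>_. gauss \<Otimes>\<^sub>M unif)) \<Longrightarrow>
    (\<lambda>x. \<integral>\<^sup>+y. f x y \<partial>PiM I (\<lambda>_. gauss \<Otimes>\<^sub>M unif)) \<in> borel_measurable M"
  by (rule borel_measurable_nn_integral_prob[OF prob_space_innovations])

text \<open>One step of the recursion in terms of the innovation \<open>g\<close>. On acceptance the
  innovation of the partner is \<open>- (g + \<delta>)\<close>, which explains the sign in its
  residual \<open>s r' + c (g + \<delta>)\<close>; on rejection the partner uses \<open>g\<close>
  itself.\<close>

lemma nn_integral_gmask_Suc:
  fixes m :: nat and r r' :: real
  defines "\<delta> \<equiv> cw m * (r + r') / sw m"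
  assumes [measurable]: "F \<in> borel_measurable (obs_space (Suc (Suc m)))"
  shows "(\<integral>\<^sup>+v. F (gmask (Suc m) r r' v) \<partial>PiM {..<Suc m} (\<lambda>_. gauss \<Otimes>\<^sub>M unif)) =
    (\<integral>\<^sup>+g. \<integral>\<^sup>+u. (if u * std_normal_density g \<le> std_normal_density (g + \<delta>)
      then \<integral>\<^sup>+v. F ((gmask m (sw m * r - cw m * g) (sw m * r' + cw m * (g + \<delta>)) v)(Suc m := Some (cw m * r + sw m * g)))
        \<partial>PiM {..<m} (\<lambda>_. gauss \<Otimes>\<^sub>M unif)
      else \<integral>\<^sup>+v. F ((gmask m (sw m * r - cw m * g) (sw m * r' - cw m * g) v)(Suc m := None))
        \<partial>PiM {..<m} (\<lambda>_. gauss \<Otimes>\<^sub>M unif)) \<partial>unif \<partial>gauss)"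
proof -
  let ?G = "PiM {..<m} (\<lambda>_. gauss \<Otimes>\<^sub>M unif)" and ?\<phi> = std_normal_density
  let ?x = "\<lambda>g. cw m * r + sw m * g"
  have s: "sw m > 0" by (rule cw_sw)
  have k1: "(?x g - cw m * r) / sw m = g" for g
    using s by simp
  have k2: "(?x g + cw m * r') / sw m = g + \<delta>" for g
    using s by (simp add: \<delta>_def field_simps)
  have keep: "keep m r r' (?x g) u \<longleftrightarrow> u * ?\<phi> g \<le> ?\<phi> (g + \<delta>)" for g u
    unfolding keep_def k1 k2 ..
  have p1: "resid m r' (- ?x g) = sw m * r' + cw m * (g + \<delta>)" for g
  proof -
    have "- ?x g = cw m * r' + sw m * (- (g + \<delta>))"
      using s by (simp add: \<delta>_def field_simps)
    then show ?thesis
      using resid_step[of m r' "- (g + \<delta>)"] by (simp only: mult_minus_right diff_minus_eq_add)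
  qed
  have p2: "resid m r' (?x g + cw m * (r' - r)) = sw m * r' - cw m * g" for g
    using resid_step[of m r' g] by (simp add: algebra_simps)
  define Q where "Q g u = (\<integral>\<^sup>+v. F (gmask (Suc m) r r' (v(m := (g, u)))) \<partial>?G)" for g u
  have Q: "Q g u = (if u * ?\<phi> g \<le> ?\<phi> (g + \<delta>)
      then \<integral>\<^sup>+v. F ((gmask m (sw m * r - cw m * g) (sw m * r' + cw m * (g + \<delta>)) v)(Suc m := Some (cw m * r + sw m * g))) \<partial>?G
      else \<integral>\<^sup>+v. F ((gmask m (sw m * r - cw m * g) (sw m * r' - cw m * g) v)(Suc m := None)) \<partial>?G)" for g u
  proof -
    have "gmask m a b (v(m := (g, u))) = gmask m a b v" for a b v
      by (rule gmask_cong) auto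
    then show ?thesis
      by (simp add: Q_def Let_def keep presid_def p1[simplified] p2 resid_step)
  qed
  have "case_prod Q \<in> borel_measurable (gauss \<Otimes>\<^sub>M unif)"
    unfolding Q by measurable
  then have "(\<integral>\<^sup>+g. \<integral>\<^sup>+u. Q g u \<partial>unif \<partial>gauss) = (\<integral>\<^sup>+p. Q (fst p) (snd p) \<partial>(gauss \<Otimes>\<^sub>M unif))"
    by (rule nn_integral_pair_prob[OF prob_space_unif])
  also have "\<dots> = (\<integral>\<^sup>+v. F (gmask (Suc m) r r' v) \<partial>PiM {..<Suc m} (\<lambda>_. gauss \<Otimes>\<^sub>M unif))"
    unfolding Q_def prod.collapse
    by (rule nn_integral_PiM_lessThan_Suc[symmetric, OF prob_space_pair_gauss_unif]) measurable
  finally show ?thesis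
    unfolding Q by simp
qed

text \<open>This is the interchange of the vector with its partner. In an accepted step, replacing
  \<open>g\<close> by \<open>- g - \<delta>\<close> preserves the overlap and takes the coordinate
  \<open>c r + s g\<close> to \<open>- (c r' + s g)\<close>. In a rejected step both vectors have
  the same innovation and nothing is shown. The test itself is unaffected since
  \<open>\<delta>\<close> is symmetric in \<open>r\<close> and \<open>r'\<close>. At the bottom the
  only entry is hidden, which is its own negative.\<close>

lemma gmask_neg_symmetric:
  assumes "F \<in> borel_measurable (obs_space (Suc m))"
  shows "(\<integral>\<^sup>+v. F (gmask m r r' v) \<partial>PiM {..<m} (\<lambda>_. gauss \<Otimes>\<^sub>M unif)) =
    (\<integral>\<^sup>+v. F (neg_obs (Suc m) (gmask m r' r v)) \<partial>PiM {..<m} (\<lambda>_. gauss \<Otimes>\<^sub>M unif))"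
  using assms
proof (induction m arbitrary: F r r')
  case 0
  have "neg_obs (Suc 0) (gmask 0 r' r v) = gmask 0 r r' v" for v
    by (auto simp: neg_obs_def fun_eq_iff restrict_def)
  then show ?case
    by (simp only:)
next
  case (Suc m)
  note [measurable] = Suc.prems
  let ?G = "PiM {..<m} (\<lambda>_. gauss \<Otimes>\<^sub>M unif)" and ?\<phi> = std_normal_density
  define \<delta> where "\<delta> = cw m * (r + r') / sw m"
  have s: "sw m > 0" by (rule cw_sw)
  define f1 where "f1 g = (\<integral>\<^sup>+v. F ((gmask m (sw m * r - cw m * g) (sw m * r' + cw m * (g + \<delta>)) v)
    (Suc m := Some (cw m * r + sw m * g))) \<partial>?G)" for g
  define f2 where "f2 g = (\<integral>\<^sup>+v. F ((gmask m (sw m * r - cw m * g) (sw m * r' - cw m * g) v)(Suc m := None)) \<partial>?G)" for g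
  have [measurable]: "f1 \<in> borel_measurable borel" "f2 \<in> borel_measurable borel"
    unfolding f1_def f2_def by measurable
  have IH: "(\<integral>\<^sup>+v. F ((gmask m a b v)(Suc m := y)) \<partial>?G) =
      (\<integral>\<^sup>+v. F ((neg_obs (Suc m) (gmask m b a v))(Suc m := y)) \<partial>?G)" for a b y
    by (rule Suc.IH[of "\<lambda>z. F (z(Suc m := y))"]) measurable
  have "(\<integral>\<^sup>+v. F (neg_obs (Suc (Suc m)) (gmask (Suc m) r' r v)) \<partial>PiM {..<Suc m} (\<lambda>_. gauss \<Otimes>\<^sub>M unif)) =
    (\<integral>\<^sup>+g. \<integral>\<^sup>+u. (if u * ?\<phi> g \<le> ?\<phi> (g + \<delta>) then f1 (- g - \<delta>) else f2 g) \<partial>unif \<partial>gauss)"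
  proof -
    have e1: "sw m * r - cw m * (- g - \<delta>) = sw m * r + cw m * (g + \<delta>)"
      "sw m * r' + cw m * ((- g - \<delta>) + \<delta>) = sw m * r' - cw m * g"
      "cw m * r + sw m * (- g - \<delta>) = - (cw m * r' + sw m * g)" for g
      using s by (simp_all add: \<delta>_def field_simps)
    have "f1 (- g - \<delta>) = (\<integral>\<^sup>+v. F (neg_obs (Suc (Suc m)) ((gmask m (sw m * r' - cw m * g) (sw m * r + cw m * (g + \<delta>)) v)
        (Suc m := Some (cw m * r' + sw m * g)))) \<partial>?G)" for g
      unfolding f1_def e1 neg_obs_upd IH by simp
    moreover have "f2 g = (\<integral>\<^sup>+v. F (neg_obs (Suc (Suc m)) ((gmask m (sw m * r' - cw m * g) (sw m * r - cw m * g) v)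
        (Suc m := None))) \<partial>?G)" for g
      unfolding f2_def neg_obs_upd IH by simp
    moreover have "cw m * (r' + r) / sw m = \<delta>"
      by (simp add: \<delta>_def add.commute)
    moreover have "(\<lambda>z. F (neg_obs (Suc (Suc m)) z)) \<in> borel_measurable (obs_space (Suc (Suc m)))"
      by measurable
    from nn_integral_gmask_Suc[OF this, of r' r] calculation show ?thesis
      by (simp only:)
  qed
  also have "\<dots> = (\<integral>\<^sup>+g. ennreal (min (?\<phi> g) (?\<phi> (g + \<delta>))) * f1 (- g - \<delta>) \<partial>lborel) +
      (\<integral>\<^sup>+g. ennreal (?\<phi> g - min (?\<phi> g) (?\<phi> (g + \<delta>))) * f2 g \<partial>lborel)"
    by (subst nn_integral_threshold) (simp_all add: nn_integral_add)
  also have "\<dots> = (\<integral>\<^sup>+g. ennreal (min (?\<phi> g) (?\<phi> (g + \<delta>))) * f1 g \<partial>lborel) +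
      (\<integral>\<^sup>+g. ennreal (?\<phi> g - min (?\<phi> g) (?\<phi> (g + \<delta>))) * f2 g \<partial>lborel)"
    by (subst nn_integral_overlap_reflect) simp_all
  also have "\<dots> = (\<integral>\<^sup>+g. \<integral>\<^sup>+u. (if u * ?\<phi> g \<le> ?\<phi> (g + \<delta>) then f1 g else f2 g) \<partial>unif \<partial>gauss)"
    by (subst nn_integral_threshold) (simp_all add: nn_integral_add)
  also have "\<dots> = (\<integral>\<^sup>+v. F (gmask (Suc m) r r' v) \<partial>PiM {..<Suc m} (\<lambda>_. gauss \<Otimes>\<^sub>M unif))"
    unfolding f1_def f2_def \<delta>_def by (rule nn_integral_gmask_Suc[symmetric]) measurable
  finally show ?case ..
qed

section \<open>The expected number of hidden coordinates\<close>

definition missing :: "nat \<Rightarrow> (nat \<Rightarrow> real option) \<Rightarrow> ennreal" where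
  "missing d z = (\<Sum>k<d. if z k = None then 1 else 0)"

lemma measurable_missing [measurable]: "missing d \<in> borel_measurable (obs_space d)"
proof -
  have "(\<lambda>z. if z k = None then 1 else 0 :: ennreal) \<in> borel_measurable (obs_space d)" if "k \<in> {..<d}" for k
  proof -
    have [measurable]: "Measurable.pred (obs_space d) (\<lambda>z. z k = None)"
      using that by (intro pred_obs_None) simp
    show ?thesis by measurable
  qed
  then show ?thesis
    unfolding missing_def by (intro borel_measurable_sum) simp
qed

lemma missing_upd: "missing (Suc n) (z(n := v)) = missing n z + (if v = None then 1 else 0)"
proof -
  have "(\<Sum>k<n. if (z(n := v)) k = None then 1 else 0 :: ennreal) = missing n z"
    unfolding missing_def by (intro sum.cong) auto
  then show ?thesis
    by (simp add: missing_def)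
qed

text \<open>Taken alone, each of the two vectors has a standard normal innovation, so each squared
  residual averages to \<open>s^2 r^2 + c^2\<close> (with \<open>r'\<close> for the partner),
  however the two depend on each other. The rest is the probability that this coordinate is
  hidden.\<close>

lemma gmask_missing_step:
  assumes AB: "0 \<le> A" "0 \<le> B"
    and IH: "\<And>r r'. (\<integral>\<^sup>+v. missing (Suc m) (gmask m r r' v) \<partial>PiM {..<m} (\<lambda>_. gauss \<Otimes>\<^sub>M unif))
      \<le> ennreal (A + B * (r\<^sup>2 + r'\<^sup>2))"
  shows "(\<integral>\<^sup>+v. missing (Suc (Suc m)) (gmask (Suc m) r r' v) \<partial>PiM {..<Suc m} (\<lambda>_. gauss \<Otimes>\<^sub>M unif))
    \<le> ennreal (A + B * ((sw m)\<^sup>2 * (r\<^sup>2 + r'\<^sup>2) + 2 * (cw m)\<^sup>2) + \<bar>cw m * (r + r') / sw m\<bar> / 2)"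
proof -
  let ?G = "PiM {..<m} (\<lambda>_. gauss \<Otimes>\<^sub>M unif)" and ?\<phi> = std_normal_density
  define \<delta> where "\<delta> = cw m * (r + r') / sw m"
  \<comment> \<open>\<open>P\<close> holds \<open>A\<close> and the own residual, \<open>Q\<close>
    the residual of the partner, each as a function of the respective innovation. Acceptance changes
    only the argument of \<open>Q\<close>.\<close>
  define P where "P g = ennreal (A + B * (sw m * r - cw m * g)\<^sup>2)" for g
  define Q where "Q g = ennreal (B * (sw m * r' - cw m * g)\<^sup>2)" for g
  have [measurable]: "P \<in> borel_measurable borel" "Q \<in> borel_measurable borel"
    unfolding P_def Q_def by measurable
  let ?lo = "\<lambda>g. ennreal (min (?\<phi> g) (?\<phi> (g + \<delta>)))"
    and ?de = "\<lambda>g. ennreal (?\<phi> g - min (?\<phi> g) (?\<phi> (g + \<delta>)))"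
  interpret G: prob_space ?G
    by (rule prob_space_innovations)
  have f1: "(\<integral>\<^sup>+v. missing (Suc (Suc m)) ((gmask m (sw m * r - cw m * g) (sw m * r' + cw m * (g + \<delta>)) v)(Suc m := Some y)) \<partial>?G)
      \<le> P g + Q (- g - \<delta>)" for g y
  proof -
    have "P g + Q (- g - \<delta>) = ennreal (A + B * ((sw m * r - cw m * g)\<^sup>2 + (sw m * r' + cw m * (g + \<delta>))\<^sup>2))"
      using AB by (simp add: P_def Q_def ennreal_plus[symmetric] algebra_simps del: ennreal_plus)
    then show ?thesis
      using IH[of "sw m * r - cw m * g" "sw m * r' + cw m * (g + \<delta>)"] by (simp add: missing_upd)
  qed
  have f2: "(\<integral>\<^sup>+v. missing (Suc (Suc m)) ((gmask m (sw m * r - cw m * g) (sw m * r' - cw m * g) v)(Suc m := None)) \<partial>?G)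
      \<le> P g + Q g + 1" for g
  proof -
    have "P g + Q g = ennreal (A + B * ((sw m * r - cw m * g)\<^sup>2 + (sw m * r' - cw m * g)\<^sup>2))"
      using AB by (simp add: P_def Q_def ennreal_plus[symmetric] algebra_simps del: ennreal_plus)
    moreover have "(\<integral>\<^sup>+v. missing (Suc (Suc m)) ((gmask m (sw m * r - cw m * g) (sw m * r' - cw m * g) v)(Suc m := None)) \<partial>?G)
      = (\<integral>\<^sup>+v. missing (Suc m) (gmask m (sw m * r - cw m * g) (sw m * r' - cw m * g) v) \<partial>?G) + 1"
      by (simp add: missing_upd nn_integral_add G.emeasure_space_1)
    ultimately show ?thesis
      using IH[of "sw m * r - cw m * g" "sw m * r' - cw m * g"] by (simp add: add_right_mono)
  qed
  have "(\<integral>\<^sup>+v. missing (Suc (Suc m)) (gmask (Suc m) r r' v) \<partial>PiM {..<Suc m} (\<lambda>_. gauss \<Otimes>\<^sub>M unif))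
    \<le> (\<integral>\<^sup>+g. \<integral>\<^sup>+u. (if u * ?\<phi> g \<le> ?\<phi> (g + \<delta>) then P g + Q (- g - \<delta>) else P g + Q g + 1) \<partial>unif \<partial>gauss)"
    unfolding nn_integral_gmask_Suc[OF measurable_missing] \<delta>_def[symmetric]
    by (intro nn_integral_mono) (use f1 f2 in auto)
  also have "\<dots> = (\<integral>\<^sup>+g. ?lo g * (P g + Q (- g - \<delta>)) + ?de g * (P g + Q g + 1) \<partial>lborel)"
    by (rule nn_integral_threshold) measurable
  also have "\<dots> = (\<integral>\<^sup>+g. ?lo g * P g \<partial>lborel) + (\<integral>\<^sup>+g. ?lo g * Q (- g - \<delta>) \<partial>lborel) +
      ((\<integral>\<^sup>+g. ?de g * P g \<partial>lborel) + (\<integral>\<^sup>+g. ?de g * Q g \<partial>lborel) + (\<integral>\<^sup>+g. ?de g \<partial>lborel))"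
    by (simp add: distrib_left nn_integral_add)
  \<comment> \<open>Reflecting the overlap back and adding the deficit restores the full normal
    density, which says that the innovation of the partner is standard normal as well.\<close>
  also have "\<dots> = (\<integral>\<^sup>+g. P g \<partial>gauss) + (\<integral>\<^sup>+g. Q g \<partial>gauss) + (\<integral>\<^sup>+g. ?de g \<partial>lborel)"
  proof -
    have "(\<integral>\<^sup>+g. ?lo g * Q (- g - \<delta>) \<partial>lborel) = (\<integral>\<^sup>+g. ?lo g * Q g \<partial>lborel)"
      by (rule nn_integral_overlap_reflect) measurable
    moreover have "(\<integral>\<^sup>+g. P g \<partial>gauss) = (\<integral>\<^sup>+g. ?lo g * P g \<partial>lborel) + (\<integral>\<^sup>+g. ?de g * P g \<partial>lborel)"
      "(\<integral>\<^sup>+g. Q g \<partial>gauss) = (\<integral>\<^sup>+g. ?lo g * Q g \<partial>lborel) + (\<integral>\<^sup>+g. ?de g * Q g \<partial>lborel)"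
      by (rule nn_integral_gauss_split; measurable)+
    ultimately show ?thesis
      by (simp only: ac_simps)
  qed
  also have "\<dots> \<le> (\<integral>\<^sup>+g. P g \<partial>gauss) + (\<integral>\<^sup>+g. Q g \<partial>gauss) + ennreal (\<bar>\<delta>\<bar> / 2)"
    by (intro add_left_mono nn_integral_std_normal_deficit)
  also have "(\<integral>\<^sup>+g. P g \<partial>gauss) = ennreal (A + B * ((sw m * r)\<^sup>2 + (cw m)\<^sup>2))"
  proof -
    have "P g = ennreal A + ennreal B * ennreal ((sw m * r + (- cw m) * g)\<^sup>2)" for g
      using AB by (simp add: P_def ennreal_plus ennreal_mult)
    then have "(\<integral>\<^sup>+g. P g \<partial>gauss) = ennreal A + ennreal B * ennreal ((sw m * r)\<^sup>2 + (- cw m)\<^sup>2)"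
      using prob_space.emeasure_space_1[OF prob_space_gauss]
      by (simp only:) (subst nn_integral_add, simp, simp, subst nn_integral_cmult, simp,
        subst nn_integral_gauss_affine_square, simp)
    then show ?thesis
      using AB by (simp add: ennreal_plus[symmetric] ennreal_mult[symmetric] del: ennreal_plus)
  qed
  also have "(\<integral>\<^sup>+g. Q g \<partial>gauss) = ennreal (B * ((sw m * r')\<^sup>2 + (cw m)\<^sup>2))"
  proof -
    have "Q g = ennreal B * ennreal ((sw m * r' + (- cw m) * g)\<^sup>2)" for g
      using AB by (simp add: Q_def ennreal_mult)
    then have "(\<integral>\<^sup>+g. Q g \<partial>gauss) = ennreal B * ennreal ((sw m * r')\<^sup>2 + (- cw m)\<^sup>2)"
      by (simp only:) (subst nn_integral_cmult, simp, subst nn_integral_gauss_affine_square, simp)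
    then show ?thesis
      using AB by (simp add: ennreal_mult[symmetric] ennreal_plus[symmetric] del: ennreal_plus)
  qed
  also have "ennreal (A + B * ((sw m * r)\<^sup>2 + (cw m)\<^sup>2)) + ennreal (B * ((sw m * r')\<^sup>2 + (cw m)\<^sup>2)) + ennreal (\<bar>\<delta>\<bar> / 2)
     = ennreal (A + B * ((sw m)\<^sup>2 * (r\<^sup>2 + r'\<^sup>2) + 2 * (cw m)\<^sup>2) + \<bar>\<delta>\<bar> / 2)"
    using AB by (subst ennreal_plus[symmetric], simp, simp, subst ennreal_plus[symmetric], simp, simp)
      (simp add: power_mult_distrib algebra_simps)
  finally show ?thesis
    by (simp only: \<delta>_def)
qed

text \<open>One step replaces $r^2$ by $s^2 r^2 + c^2$ on average, which leaves $A + 2B$ unchanged up to the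
  failure probability of the coupling.\<close>

lemma gmask_missing:
  "\<exists>A B. 0 \<le> A \<and> 0 \<le> B \<and> A + 2 * B \<le> 1 + 2 * sqrt (real m) \<and>
    (\<forall>r r'. (\<integral>\<^sup>+v. missing (Suc m) (gmask m r r' v) \<partial>PiM {..<m} (\<lambda>_. gauss \<Otimes>\<^sub>M unif))
      \<le> ennreal (A + B * (r\<^sup>2 + r'\<^sup>2)))"
proof (induction m)
  case 0
  have "missing (Suc 0) (gmask 0 r r' v) = 1" for r r' v
    by (simp add: missing_def)
  then have "(\<integral>\<^sup>+v. missing (Suc 0) (gmask 0 r r' v) \<partial>PiM {..<0} (\<lambda>_. gauss \<Otimes>\<^sub>M unif)) = 1" for r r'
    by (simp only: nn_integral_const prob_space.emeasure_space_1[OF prob_space_innovations]) simp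
  \<comment> \<open>\<open>A = 1\<close> and \<open>B = 0\<close>: the last coordinate is hidden
    whatever \<open>r\<close> and \<open>r'\<close> are.\<close>
  then show ?case
    by (intro exI[of _ 1] exI[of _ 0]) (simp del: gmask.simps lessThan_0)
next
  case (Suc m)
  then obtain A B where AB: "0 \<le> A" "0 \<le> B" "A + 2 * B \<le> 1 + 2 * sqrt (real m)"
    and IH: "\<And>r r'. (\<integral>\<^sup>+v. missing (Suc m) (gmask m r r' v) \<partial>PiM {..<m} (\<lambda>_. gauss \<Otimes>\<^sub>M unif))
      \<le> ennreal (A + B * (r\<^sup>2 + r'\<^sup>2))"
    by blast
  define q where "q = 1 / sqrt (real m + 1)"
  have q: "q \<ge> 0" by (simp add: q_def)
  have "cw m = q * sw m"
    unfolding cw_def q_def sw_def by (simp add: real_sqrt_divide)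
  then have cq: "cw m / sw m = q"
    using cw_sw(3)[of m] by simp
  \<comment> \<open>The failure probability is at most \<open>q * \<bar>r + r'\<bar> / 2\<close>,
    hence at most \<open>q / 2 + q / 4 * (r^2 + r'^2)\<close>. Thus \<open>A + 2 * B\<close> grows
    by exactly \<open>q\<close> in one step.\<close>
  define A' where "A' = A + 2 * B * (cw m)\<^sup>2 + q / 2"
  define B' where "B' = B * (sw m)\<^sup>2 + q / 4"
  have "A' + 2 * B' = A + 2 * B * ((cw m)\<^sup>2 + (sw m)\<^sup>2) + q"
    by (simp add: A'_def B'_def algebra_simps)
  also have "\<dots> \<le> 1 + 2 * sqrt (real m) + q"
    using AB by (simp add: cw_sw(1))
  \<comment> \<open>The increment \<open>q = 1 / sqrt (m + 1)\<close> is at most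
    \<open>2 * (sqrt (m + 1) - sqrt m)\<close>, so the bounds telescope.\<close>
  also have "\<dots> \<le> 1 + 2 * sqrt (real (Suc m))"
  proof -
    define x y where "x = sqrt (real m)" and "y = sqrt (real m + 1)"
    have xy: "y * y = x * x + 1" "0 \<le> x" "0 < y"
      by (simp_all add: x_def y_def)
    have "0 \<le> (y - x) * (y - x)" by simp
    then have "1 \<le> 2 * (y - x) * y"
      using xy by (simp add: algebra_simps)
    then have "1 / y \<le> 2 * (y - x)"
      using xy by (simp add: divide_le_eq)
    then show ?thesis
      by (simp add: q_def x_def y_def add.commute)
  qed
  finally have "A' + 2 * B' \<le> 1 + 2 * sqrt (real (Suc m))" .
  moreover have "(\<integral>\<^sup>+v. missing (Suc (Suc m)) (gmask (Suc m) r r' v) \<partial>PiM {..<Suc m} (\<lambda>_. gauss \<Otimes>\<^sub>M unif))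
    \<le> ennreal (A' + B' * (r\<^sup>2 + r'\<^sup>2))" for r r'
  proof -
    have "\<bar>cw m * (r + r') / sw m\<bar> = q * \<bar>r + r'\<bar>"
      using q by (simp add: cq[symmetric] abs_mult) (simp add: cw_sw abs_of_pos)
    moreover have "\<bar>r + r'\<bar> \<le> 1 + (r\<^sup>2 + r'\<^sup>2) / 2"
    proof -
      have "0 \<le> (\<bar>r\<bar> - 1)\<^sup>2" "0 \<le> (\<bar>r'\<bar> - 1)\<^sup>2" by simp_all
      then have "\<bar>r\<bar> \<le> (r\<^sup>2 + 1) / 2" "\<bar>r'\<bar> \<le> (r'\<^sup>2 + 1) / 2"
        by (simp_all add: power2_diff)
      from order_trans[OF abs_triangle_ineq add_mono[OF this]] show ?thesis
        by (simp add: add_divide_distrib)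
    qed
    ultimately have "\<bar>cw m * (r + r') / sw m\<bar> \<le> q * (1 + (r\<^sup>2 + r'\<^sup>2) / 2)"
      using q by (simp add: mult_left_mono)
    moreover have "A' + B' * (r\<^sup>2 + r'\<^sup>2) = A + B * ((sw m)\<^sup>2 * (r\<^sup>2 + r'\<^sup>2) + 2 * (cw m)\<^sup>2)
        + q * (1 + (r\<^sup>2 + r'\<^sup>2) / 2) / 2"
      by (simp add: A'_def B'_def algebra_simps)
    ultimately have "A + B * ((sw m)\<^sup>2 * (r\<^sup>2 + r'\<^sup>2) + 2 * (cw m)\<^sup>2) + \<bar>cw m * (r + r') / sw m\<bar> / 2
      \<le> A' + B' * (r\<^sup>2 + r'\<^sup>2)"
      by simp
    then show ?thesis
      using gmask_missing_step[OF AB(1,2) IH, of r r'] by (meson ennreal_leI order_trans)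
  qed
  moreover have "0 \<le> A'" "0 \<le> B'"
    using AB q by (simp_all add: A'_def B'_def)
  ultimately show ?case
    by blast
qed

text \<open>The partner starts with the same sum. With \<open>r = r'\<close> the interchange of the
  two vectors becomes a symmetry of a single law.\<close>

definition self_mask :: "nat \<Rightarrow> (nat \<Rightarrow> real) \<Rightarrow> (nat \<Rightarrow> real) \<Rightarrow> nat \<Rightarrow> real option" where
  "self_mask m x w = mask m (rsum m x) (rsum m x) x w"

lemma measurable_self_mask [measurable (raw)]:
  assumes [measurable]: "x \<in> M \<rightarrow>\<^sub>M PiM {..<Suc m} (\<lambda>_. borel)" "w \<in> M \<rightarrow>\<^sub>M PiM {..<m} (\<lambda>_. borel)"
  shows "(\<lambda>p. self_mask m (x p) (w p)) \<in> M \<rightarrow>\<^sub>M obs_space (Suc m)"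
  unfolding self_mask_def by measurable

text \<open>Conditionally on the sum this is \<open>gmask_neg_symmetric\<close> with
  \<open>r' = r\<close>. The sum is kept in the joint law because labels are built from it.\<close>

lemma self_mask_neg_symmetric:
  assumes [measurable]: "F \<in> borel_measurable (obs_space (Suc m) \<Otimes>\<^sub>M borel)"
  shows "(\<integral>\<^sup>+x. \<integral>\<^sup>+w. F (self_mask m x w, rsum m x) \<partial>PiM {..<m} (\<lambda>_. unif) \<partial>PiM {..<Suc m} (\<lambda>_. gauss))
    = (\<integral>\<^sup>+x. \<integral>\<^sup>+w. F (neg_obs (Suc m) (self_mask m x w), rsum m x) \<partial>PiM {..<m} (\<lambda>_. unif) \<partial>PiM {..<Suc m} (\<lambda>_. gauss))"
proof -
  have "(\<integral>\<^sup>+v. F (gmask m r r v, r) \<partial>PiM {..<m} (\<lambda>_. gauss \<Otimes>\<^sub>M unif)) =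
    (\<integral>\<^sup>+v. F (neg_obs (Suc m) (gmask m r r v), r) \<partial>PiM {..<m} (\<lambda>_. gauss \<Otimes>\<^sub>M unif))" for r
    by (rule gmask_neg_symmetric[of "\<lambda>z. F (z, r)"]) measurable
  then show ?thesis
    using mask_eq_gmask[of "\<lambda>r. r" F m] mask_eq_gmask[of "\<lambda>r. r" "\<lambda>p. F (neg_obs (Suc m) (fst p), snd p)" m]
    by (simp add: self_mask_def)
qed

text \<open>At the start \<open>r = r'\<close> is standard normal, so the bound
  \<open>A + B * (r^2 + r'^2)\<close> has mean \<open>A + 2 * B\<close>.\<close>

lemma self_mask_missing:
  "(\<integral>\<^sup>+x. \<integral>\<^sup>+w. missing (Suc m) (self_mask m x w) \<partial>PiM {..<m} (\<lambda>_. unif) \<partial>PiM {..<Suc m} (\<lambda>_. gauss))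
    \<le> ennreal (1 + 2 * sqrt (real m))"
proof -
  obtain A B where AB: "0 \<le> A" "0 \<le> B" "A + 2 * B \<le> 1 + 2 * sqrt (real m)"
    and le: "\<And>r r'. (\<integral>\<^sup>+v. missing (Suc m) (gmask m r r' v) \<partial>PiM {..<m} (\<lambda>_. gauss \<Otimes>\<^sub>M unif))
      \<le> ennreal (A + B * (r\<^sup>2 + r'\<^sup>2))"
    using gmask_missing[of m] by blast
  have "(\<integral>\<^sup>+x. \<integral>\<^sup>+w. missing (Suc m) (self_mask m x w) \<partial>PiM {..<m} (\<lambda>_. unif) \<partial>PiM {..<Suc m} (\<lambda>_. gauss))
    = (\<integral>\<^sup>+r. \<integral>\<^sup>+v. missing (Suc m) (gmask m r r v) \<partial>PiM {..<m} (\<lambda>_. gauss \<Otimes>\<^sub>M unif) \<partial>gauss)"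
    using mask_eq_gmask[of "\<lambda>r. r" "\<lambda>p. missing (Suc m) (fst p)" m] by (simp add: self_mask_def)
  also have "\<dots> \<le> (\<integral>\<^sup>+r. ennreal A + ennreal (2 * B) * ennreal ((0 + 1 * r)\<^sup>2) \<partial>gauss)"
  proof (rule nn_integral_mono)
    fix r :: real
    have "ennreal (A + B * (r\<^sup>2 + r\<^sup>2)) = ennreal A + ennreal (2 * B) * ennreal ((0 + 1 * r)\<^sup>2)"
      using AB by (simp add: ennreal_mult[symmetric] ennreal_plus[symmetric] algebra_simps del: ennreal_plus)
    then show "(\<integral>\<^sup>+v. missing (Suc m) (gmask m r r v) \<partial>PiM {..<m} (\<lambda>_. gauss \<Otimes>\<^sub>M unif))
      \<le> ennreal A + ennreal (2 * B) * ennreal ((0 + 1 * r)\<^sup>2)"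
      using le[of r r] by simp
  qed
  also have "\<dots> = ennreal A + ennreal (2 * B) * ennreal (0\<^sup>2 + 1\<^sup>2)"
    using prob_space.emeasure_space_1[OF prob_space_gauss]
    by (subst nn_integral_add, simp, simp, subst nn_integral_cmult, simp, subst nn_integral_gauss_affine_square) simp
  also have "\<dots> = ennreal (A + 2 * B)"
    using AB by simp
  finally show ?thesis
    using AB(3) by (meson ennreal_leI order_trans)
qed

subsection \<open>Random cyclic shifts\<close>

definition rot :: "nat \<Rightarrow> nat \<Rightarrow> nat \<Rightarrow> nat" where
  "rot d t k = (k + t) mod d"

text \<open>This is \<open>j - t\<close> modulo \<open>d\<close>, written so as to stay within the
  natural numbers; it inverts \<open>rot d t\<close> on indices below \<open>d\<close>.\<close>

definition unrot :: "nat \<Rightarrow> nat \<Rightarrow> nat \<Rightarrow> nat" where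
  "unrot d t j = (j + (d - t mod d)) mod d"

lemma rot_unrot:
  assumes "j < d"
  shows "rot d t (unrot d t j) = j"
proof -
  have "((j + (d - t mod d)) mod d + t) mod d = (j + (d - t mod d) + t mod d) mod d"
    by (simp add: mod_simps)
  also have "j + (d - t mod d) + t mod d = j + d"
    using assms mod_less_divisor[of d t] by linarith
  finally show ?thesis
    using assms by (simp add: rot_def unrot_def)
qed

lemma rot_less: "0 < d \<Longrightarrow> rot d t k < d" and unrot_less: "0 < d \<Longrightarrow> unrot d t j < d"
  by (simp_all add: rot_def unrot_def)

lemma bij_betw_rot: "bij_betw (rot d t) {..<d} {..<d}"
proof -
  have "rot d t ` {..<d} = {..<d}"
  proof (intro equalityI subsetI)
    fix j assume "j \<in> {..<d}"
    then show "j \<in> rot d t ` {..<d}"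
      using rot_unrot[of j d t] unrot_less[of d t j] by (intro image_eqI[of _ _ "unrot d t j"]) auto
  qed (auto simp: rot_less)
  then show ?thesis
    by (simp add: bij_betw_def eq_card_imp_inj_on)
qed

text \<open>Modulo \<open>d\<close>, \<open>j - (j - t) = t\<close>. As \<open>t\<close> runs
  through all shifts with \<open>j\<close> fixed, the position in the recursion that decides about
  coordinate \<open>j\<close> therefore runs through all positions once.\<close>

lemma unrot_involutive:
  assumes "j < d" "t < d"
  shows "unrot d (unrot d t j) j = t"
proof (cases "t \<le> j")
  case True
  then have "unrot d t j = (j - t + d) mod d"
    using assms by (simp add: unrot_def)
  then have "unrot d t j = j - t"
    using assms by simp
  moreover have "unrot d (j - t) j = (t + d) mod d"
    using assms True by (simp add: unrot_def)
  ultimately show ?thesis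
    using assms by simp
next
  case False
  then have "unrot d t j = j + (d - t)"
    using assms by (simp add: unrot_def)
  then show ?thesis
    using assms False by (simp add: unrot_def)
qed

lemma sum_unrot:
  assumes "j < d"
  shows "(\<Sum>t<d. h (unrot d t j)) = (\<Sum>k<d. h k)"
  using assms by (intro sum.reindex_bij_witness[where i="\<lambda>t. unrot d t j" and j="\<lambda>t. unrot d t j"])
    (auto simp: unrot_involutive unrot_less)

definition rotate_vec :: "nat \<Rightarrow> nat \<Rightarrow> (nat \<Rightarrow> real) \<Rightarrow> nat \<Rightarrow> real" where
  "rotate_vec d t x = (\<lambda>k\<in>{..<d}. x (rot d t k))"

definition unrotate_obs :: "nat \<Rightarrow> nat \<Rightarrow> (nat \<Rightarrow> real option) \<Rightarrow> nat \<Rightarrow> real option" where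
  "unrotate_obs d t z = (\<lambda>j\<in>{..<d}. z (unrot d t j))"

definition neg_vec :: "nat \<Rightarrow> (nat \<Rightarrow> real) \<Rightarrow> nat \<Rightarrow> real" where
  "neg_vec d x = (\<lambda>k\<in>{..<d}. - x k)"

lemma measurable_PiM_subindex:
  assumes "\<And>k. k \<in> I \<Longrightarrow> f k \<in> J"
  shows "(\<lambda>x. \<lambda>k\<in>I. x (f k)) \<in> PiM J (\<lambda>_. M) \<rightarrow>\<^sub>M PiM I (\<lambda>_. M)"
  using assms by (intro measurable_restrict measurable_component_singleton) auto

lemma measurable_rotate_vec [measurable]:
  "rotate_vec (Suc m) t \<in> PiM {..<Suc m} (\<lambda>_. borel) \<rightarrow>\<^sub>M PiM {..<Suc m} (\<lambda>_. borel)"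
  unfolding rotate_vec_def by (rule measurable_PiM_subindex) (auto intro: rot_less)

lemma measurable_unrotate_obs [measurable]:
  "unrotate_obs (Suc m) t \<in> obs_space (Suc m) \<rightarrow>\<^sub>M obs_space (Suc m)"
  unfolding unrotate_obs_def by (rule measurable_PiM_subindex) (auto intro: unrot_less)

lemma measurable_neg_vec [measurable]:
  "neg_vec d \<in> PiM {..<d} (\<lambda>_. borel) \<rightarrow>\<^sub>M PiM {..<d} (\<lambda>_. borel)"
  unfolding neg_vec_def
  by (intro measurable_restrict borel_measurable_uminus measurable_component_singleton)

lemma nn_integral_rotate_vec:
  assumes "f \<in> borel_measurable (PiM {..<Suc m} (\<lambda>_. borel))"
  shows "(\<integral>\<^sup>+x. f (rotate_vec (Suc m) t x) \<partial>PiM {..<Suc m} (\<lambda>_. gauss)) = (\<integral>\<^sup>+x. f x \<partial>PiM {..<Suc m} (\<lambda>_. gauss))"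
proof -
  note [measurable] = assms
  have "distr (PiM {..<Suc m} (\<lambda>_. gauss)) (PiM {..<Suc m} (\<lambda>_. gauss)) (rotate_vec (Suc m) t) = PiM {..<Suc m} (\<lambda>_. gauss)"
    unfolding rotate_vec_def
    by (rule distr_PiM_reindex) (use bij_betw_rot[of "Suc m" t] in \<open>auto simp: bij_betw_def rot_less\<close>)
  then have "(\<integral>\<^sup>+x. f x \<partial>PiM {..<Suc m} (\<lambda>_. gauss)) =
      (\<integral>\<^sup>+x. f x \<partial>distr (PiM {..<Suc m} (\<lambda>_. gauss)) (PiM {..<Suc m} (\<lambda>_. gauss)) (rotate_vec (Suc m) t))"
    by simp
  also have "\<dots> = (\<integral>\<^sup>+x. f (rotate_vec (Suc m) t x) \<partial>PiM {..<Suc m} (\<lambda>_. gauss))"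
    by (rule nn_integral_distr) measurable
  finally show ?thesis ..
qed

lemma distr_gauss_uminus: "distr gauss gauss uminus = gauss"
proof (rule measure_eqI)
  fix A assume "A \<in> sets (distr gauss gauss uminus)"
  then have [measurable]: "A \<in> sets borel" by simp
  have "emeasure (distr gauss gauss uminus) A = (\<integral>\<^sup>+x. indicator A (- x) \<partial>gauss)"
    by (simp add: nn_integral_indicator[symmetric] nn_integral_distr del: nn_integral_indicator)
  also have "\<dots> = (\<integral>\<^sup>+x. ennreal (std_normal_density x) * indicator A (- x) \<partial>lborel)"
    by (rule nn_integral_gauss) measurable
  also have "\<dots> = (\<integral>\<^sup>+x. ennreal (std_normal_density x) * indicator A x \<partial>lborel)"
    by (subst (2) nn_integral_real_affine[where c="-1" and t=0]) (simp_all add: std_normal_density_minus)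
  also have "\<dots> = emeasure gauss A"
    by (subst nn_integral_gauss[symmetric]) simp_all
  finally show "emeasure (distr gauss gauss uminus) A = emeasure gauss A" .
qed simp

lemma nn_integral_neg_vec:
  assumes "f \<in> borel_measurable (PiM {..<d} (\<lambda>_. borel))"
  shows "(\<integral>\<^sup>+x. f (neg_vec d x) \<partial>PiM {..<d} (\<lambda>_. gauss)) = (\<integral>\<^sup>+x. f x \<partial>PiM {..<d} (\<lambda>_. gauss))"
proof -
  note [measurable] = assms
  have "distr (PiM {..<d} (\<lambda>_. gauss)) (PiM {..<d} (\<lambda>_. gauss)) (compose {..<d} uminus) = PiM {..<d} (\<lambda>_. gauss)"
    by (subst distr_PiM_finite_prob_space') (simp_all add: distr_gauss_uminus)
  moreover have "compose {..<d} uminus = neg_vec d"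
    by (simp add: compose_def neg_vec_def fun_eq_iff)
  ultimately have "(\<integral>\<^sup>+x. f x \<partial>PiM {..<d} (\<lambda>_. gauss)) =
      (\<integral>\<^sup>+x. f x \<partial>distr (PiM {..<d} (\<lambda>_. gauss)) (PiM {..<d} (\<lambda>_. gauss)) (neg_vec d))"
    by simp
  also have "\<dots> = (\<integral>\<^sup>+x. f (neg_vec d x) \<partial>PiM {..<d} (\<lambda>_. gauss))"
    by (rule nn_integral_distr) measurable
  finally show ?thesis ..
qed

lemma rsum_rotate_vec: "rsum m (rotate_vec (Suc m) t x) = rsum m x"
proof -
  have "(\<Sum>k<Suc m. rotate_vec (Suc m) t x k) = (\<Sum>k<Suc m. x (rot (Suc m) t k))"
    by (intro sum.cong) (auto simp: rotate_vec_def)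
  also have "\<dots> = (\<Sum>k<Suc m. x k)"
    by (rule sum.reindex_bij_betw[OF bij_betw_rot])
  finally show ?thesis
    by (simp add: rsum_def)
qed

lemma rsum_neg_vec: "rsum m (neg_vec (Suc m) x) = - rsum m x"
proof -
  have "(\<Sum>k<Suc m. neg_vec (Suc m) x k) = (\<Sum>k<Suc m. - x k)"
    by (intro sum.cong) (auto simp: neg_vec_def)
  then show ?thesis
    by (simp add: rsum_def sum_negf minus_divide_left)
qed

lemma neg_vec_involutive: "x \<in> space (PiM {..<d} (\<lambda>_. M)) \<Longrightarrow> neg_vec d (neg_vec d x) = x"
  by (auto simp: neg_vec_def fun_eq_iff restrict_def space_PiM PiE_def extensional_def)

text \<open>The recursion treats positions unequally, hiding position 0 always, while the budget is
  per coordinate. The shift \<open>t\<close> is a parameter here and becomes random only in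
  \<open>coins\<close>.\<close>

definition sym_mask :: "nat \<Rightarrow> (nat \<Rightarrow> real) \<Rightarrow> (nat \<Rightarrow> real) \<Rightarrow> nat \<Rightarrow> nat \<Rightarrow> real option" where
  "sym_mask m x w t = unrotate_obs (Suc m) t (self_mask m (rotate_vec (Suc m) t x) w)"

lemma mask_values: "k \<le> m \<Longrightarrow> mask m r r' x w k = None \<or> mask m r r' x w k = Some (x k)"
  by (induction m arbitrary: r r') (auto simp: le_Suc_eq)

lemma sym_mask_values:
  assumes "j < Suc m"
  shows "sym_mask m x w t j = None \<or> sym_mask m x w t j = Some (x j)"
proof -
  have "unrot (Suc m) t j \<le> m"
    using unrot_less[of "Suc m" t j] by simp
  then show ?thesis
    using assms mask_values[of "unrot (Suc m) t j" m _ _ "rotate_vec (Suc m) t x" w] unrot_less[of "Suc m" t j]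
      rot_unrot[OF assms, of t]
    by (auto simp: sym_mask_def unrotate_obs_def self_mask_def rotate_vec_def)
qed

lemma measurable_sym_mask [measurable (raw)]:
  assumes [measurable]: "x \<in> M \<rightarrow>\<^sub>M PiM {..<Suc m} (\<lambda>_. borel)" "w \<in> M \<rightarrow>\<^sub>M PiM {..<m} (\<lambda>_. borel)"
    and t: "t \<in> M \<rightarrow>\<^sub>M count_space UNIV"
  shows "(\<lambda>p. sym_mask m (x p) (w p) (t p)) \<in> M \<rightarrow>\<^sub>M obs_space (Suc m)"
proof (rule measurable_compose_countable[OF _ t])
  show "(\<lambda>p. sym_mask m (x p) (w p) t) \<in> M \<rightarrow>\<^sub>M obs_space (Suc m)" for t
    unfolding sym_mask_def by measurable
qed

lemma neg_unrotate_obs: "neg_obs (Suc m) (unrotate_obs (Suc m) t z) = unrotate_obs (Suc m) t (neg_obs (Suc m) z)"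
  by (auto simp: neg_obs_def unrotate_obs_def fun_eq_iff restrict_def unrot_less)

lemma prob_space_PiM_unif: "prob_space (PiM I (\<lambda>_. unif))"
  by (intro prob_space_PiM) simp

lemma prob_space_PiM_gauss: "prob_space (PiM I (\<lambda>_. gauss))"
  by (intro prob_space_PiM) simp

lemma measurable_nn_integral_unif [measurable (raw)]:
  "case_prod f \<in> borel_measurable (M \<Otimes>\<^sub>M PiM I (\<lambda>_. unif)) \<Longrightarrow>
    (\<lambda>x. \<integral>\<^sup>+y. f x y \<partial>PiM I (\<lambda>_. unif)) \<in> borel_measurable M"
  by (rule borel_measurable_nn_integral_prob[OF prob_space_PiM_unif])

text \<open>The symmetry holds for every fixed shift: a rotation preserves the law of the vector and
  the value of \<open>rsum\<close>, and it commutes with negation.\<close>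

lemma sym_mask_neg_symmetric:
  assumes [measurable]: "F \<in> borel_measurable (obs_space (Suc m) \<Otimes>\<^sub>M borel)"
  shows "(\<integral>\<^sup>+x. \<integral>\<^sup>+w. F (sym_mask m x w t, rsum m x) \<partial>PiM {..<m} (\<lambda>_. unif) \<partial>PiM {..<Suc m} (\<lambda>_. gauss))
    = (\<integral>\<^sup>+x. \<integral>\<^sup>+w. F (neg_obs (Suc m) (sym_mask m x w t), rsum m x) \<partial>PiM {..<m} (\<lambda>_. unif) \<partial>PiM {..<Suc m} (\<lambda>_. gauss))"
proof -
  let ?X = "PiM {..<Suc m} (\<lambda>_. gauss)" and ?W = "PiM {..<m} (\<lambda>_. unif)"
  define K where "K G x = (\<integral>\<^sup>+w. F (unrotate_obs (Suc m) t (G (self_mask m x w)), rsum m x) \<partial>?W)" for G x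
  have K: "(\<integral>\<^sup>+x. K G (rotate_vec (Suc m) t x) \<partial>?X) = (\<integral>\<^sup>+x. K G x \<partial>?X)"
    if [measurable]: "G \<in> obs_space (Suc m) \<rightarrow>\<^sub>M obs_space (Suc m)" for G
    by (rule nn_integral_rotate_vec) (unfold K_def, measurable)
  have "(\<integral>\<^sup>+x. K (\<lambda>z. z) x \<partial>?X) = (\<integral>\<^sup>+x. K (neg_obs (Suc m)) x \<partial>?X)"
    unfolding K_def
    using self_mask_neg_symmetric[of "\<lambda>p. F (unrotate_obs (Suc m) t (fst p), snd p)" m] by simp
  then have "(\<integral>\<^sup>+x. K (\<lambda>z. z) (rotate_vec (Suc m) t x) \<partial>?X) = (\<integral>\<^sup>+x. K (neg_obs (Suc m)) (rotate_vec (Suc m) t x) \<partial>?X)"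
    by (simp add: K)
  then show ?thesis
    by (simp add: K_def sym_mask_def neg_unrotate_obs rsum_rotate_vec)
qed

text \<open>Rotation invariance turns the summand for \<open>t\<close> into the probability that
  position \<open>unrot (Suc m) t j\<close> is hidden by \<open>self_mask\<close>. These positions
  exhaust \<open>{..<Suc m}\<close>, so the sum is the expected total number of hidden
  entries.\<close>

lemma sym_mask_missing:
  assumes j: "j < Suc m"
  shows "(\<Sum>t<Suc m. \<integral>\<^sup>+x. \<integral>\<^sup>+w. (if sym_mask m x w t j = None then 1 else 0)
      \<partial>PiM {..<m} (\<lambda>_. unif) \<partial>PiM {..<Suc m} (\<lambda>_. gauss)) \<le> ennreal (1 + 2 * sqrt (real m))"
proof -
  let ?X = "PiM {..<Suc m} (\<lambda>_. gauss)" and ?W = "PiM {..<m} (\<lambda>_. unif)"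
  have [measurable]: "(\<lambda>p. if self_mask m (x p) (w p) k = None then 1 else 0 :: ennreal) \<in> borel_measurable M"
    if [measurable]: "x \<in> M \<rightarrow>\<^sub>M PiM {..<Suc m} (\<lambda>_. borel)" "w \<in> M \<rightarrow>\<^sub>M PiM {..<m} (\<lambda>_. borel)" and k: "k < Suc m"
    for x w k and M :: "'z measure"
  proof -
    have [measurable]: "Measurable.pred M (\<lambda>p. self_mask m (x p) (w p) k = None)"
      by (rule measurable_compose[OF _ pred_obs_None[OF k]]) measurable
    show ?thesis by measurable
  qed
  define h where "h k = (\<integral>\<^sup>+x. \<integral>\<^sup>+w. (if self_mask m x w k = None then 1 else 0) \<partial>?W \<partial>?X)" for k
  have "(\<integral>\<^sup>+x. \<integral>\<^sup>+w. (if sym_mask m x w t j = None then 1 else 0) \<partial>?W \<partial>?X) = h (unrot (Suc m) t j)" for t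
  proof -
    have [simp]: "unrot (Suc m) t j < Suc m"
      by (rule unrot_less) simp
    have "(\<lambda>x. \<integral>\<^sup>+w. (if self_mask m x w (unrot (Suc m) t j) = None then 1 else 0) \<partial>?W)
      \<in> borel_measurable (PiM {..<Suc m} (\<lambda>_. borel))"
      by measurable
    from nn_integral_rotate_vec[OF this, of t] show ?thesis
      using j by (simp add: h_def sym_mask_def unrotate_obs_def)
  qed
  then have "(\<Sum>t<Suc m. \<integral>\<^sup>+x. \<integral>\<^sup>+w. (if sym_mask m x w t j = None then 1 else 0) \<partial>?W \<partial>?X)
      = (\<Sum>k<Suc m. h k)"
    using sum_unrot[OF j, of h] by simp
  also have "\<dots> = (\<integral>\<^sup>+x. \<integral>\<^sup>+w. missing (Suc m) (self_mask m x w) \<partial>?W \<partial>?X)"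
  proof -
    have "(\<integral>\<^sup>+x. \<integral>\<^sup>+w. missing (Suc m) (self_mask m x w) \<partial>?W \<partial>?X)
      = (\<integral>\<^sup>+x. (\<Sum>k<Suc m. \<integral>\<^sup>+w. (if self_mask m x w k = None then 1 else 0) \<partial>?W) \<partial>?X)"
      unfolding missing_def
    proof (intro nn_integral_cong nn_integral_sum)
      fix x k assume "x \<in> space ?X" and [simp]: "k \<in> {..<Suc m}"
      then have [measurable]: "x \<in> space (PiM {..<Suc m} (\<lambda>_. borel))"
        by (simp add: space_PiM)
      have [simp]: "k < Suc m" using \<open>k \<in> {..<Suc m}\<close> by auto
      show "(\<lambda>w. if self_mask m x w k = None then 1 else 0 :: ennreal) \<in> borel_measurable ?W"
        by measurable
    qed
    also have "\<dots> = (\<Sum>k<Suc m. h k)"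
      unfolding h_def by (intro nn_integral_sum) measurable
    finally show ?thesis ..
  qed
  also have "\<dots> \<le> ennreal (1 + 2 * sqrt (real m))"
    by (rule self_mask_missing)
  finally show ?thesis .
qed

subsection \<open>The observed law of one example\<close>

definition const_vec :: "nat \<Rightarrow> real \<Rightarrow> nat \<Rightarrow> real" where
  "const_vec d c = (\<lambda>j\<in>{..<d}. c)"

definition coins :: "nat \<Rightarrow> ((nat \<Rightarrow> real) \<times> nat) measure" where
  "coins m = PiM {..<m} (\<lambda>_. unif) \<Otimes>\<^sub>M measure_pmf (pmf_of_set {..<Suc m})"

definition observe :: "nat \<Rightarrow> ((nat \<Rightarrow> real) \<times> real) \<times> ((nat \<Rightarrow> real) \<times> nat) \<Rightarrow> (nat \<Rightarrow> real option) \<times> real option" where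
  "observe m p = (sym_mask m (fst (fst p)) (fst (snd p)) (snd (snd p)), Some (snd (fst p)))"

text \<open>The strategy for the opposite regressor: with the label kept, the negated vector is
  distributed like an example for the original regressor and is masked as such. The outer negation
  makes the shown entries those of the actual vector, as a valid corruption requires.\<close>

definition observe_mirrored :: "nat \<Rightarrow> ((nat \<Rightarrow> real) \<times> real) \<times> ((nat \<Rightarrow> real) \<times> nat) \<Rightarrow> (nat \<Rightarrow> real option) \<times> real option" where
  "observe_mirrored m p =
    (neg_obs (Suc m) (sym_mask m (neg_vec (Suc m) (fst (fst p))) (fst (snd p)) (snd (snd p))), Some (snd (fst p)))"

lemma sets_example_space [measurable_cong]: "sets (example_space d) = sets (PiM {..<d} (\<lambda>_. borel) \<Otimes>\<^sub>M borel)"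
  by (simp add: example_space_def vec_space_def)

lemma sets_cexample_space [measurable_cong]: "sets (cexample_space d) = sets (obs_space d \<Otimes>\<^sub>M opt_borel)"
  by (simp add: cexample_space_def)

lemma sets_coins [measurable_cong]: "sets (coins m) = sets (PiM {..<m} (\<lambda>_. borel) \<Otimes>\<^sub>M count_space UNIV)"
  unfolding coins_def by (intro sets_pair_measure_cong sets_PiM_gauss_unif) simp

lemma prob_space_coins: "prob_space (coins m)"
  unfolding coins_def by (intro prob_space_pair prob_space_PiM_unif measure_pmf.prob_space_axioms)

lemma sets_noise [simp, measurable_cong]: "sets (noise \<sigma>) = sets borel"
  by (simp add: noise_def)

lemma prob_space_noise: "0 \<le> \<sigma> \<Longrightarrow> prob_space (noise \<sigma>)"
  by (auto simp: noise_def intro!: prob_space_return prob_space_normal_density)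

lemma measurable_observe [measurable]: "observe m \<in> example_space (Suc m) \<Otimes>\<^sub>M coins m \<rightarrow>\<^sub>M cexample_space (Suc m)"
  unfolding observe_def by measurable

lemma measurable_observe_mirrored [measurable]:
  "observe_mirrored m \<in> example_space (Suc m) \<Otimes>\<^sub>M coins m \<rightarrow>\<^sub>M cexample_space (Suc m)"
  unfolding observe_mirrored_def by measurable

lemma measurable_label [measurable]:
  "(\<lambda>p. (fst p, (\<Sum>j<d. \<beta> j * fst p j) + snd p)) \<in> PiM {..<d} (\<lambda>_. borel) \<Otimes>\<^sub>M borel \<rightarrow>\<^sub>M example_space d"
proof -
  have [measurable]: "(\<lambda>p. fst p j) \<in> PiM {..<d} (\<lambda>_. borel :: real measure) \<Otimes>\<^sub>M (borel :: real measure) \<rightarrow>\<^sub>M borel"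
    if "j \<in> {..<d}" for j
    using that by (intro measurable_compose[OF measurable_fst] measurable_component_singleton)
  have "(\<lambda>p. \<Sum>j<d. \<beta> j * fst p j) \<in> borel_measurable (PiM {..<d} (\<lambda>_. borel) \<Otimes>\<^sub>M (borel :: real measure))"
    by (intro borel_measurable_sum borel_measurable_times) measurable
  note [measurable] = this
  show ?thesis
    unfolding measurable_cong_sets[OF refl sets_example_space] by measurable
qed

lemma lr_example_eq:
  "lr_example d \<beta> \<sigma> = distr (PiM {..<d} (\<lambda>_. gauss) \<Otimes>\<^sub>M noise \<sigma>) (example_space d)
    (\<lambda>p. (fst p, (\<Sum>j<d. \<beta> j * fst p j) + snd p))"
  by (simp add: lr_example_def gauss_def case_prod_beta')

lemma sets_lr_example [simp, measurable_cong]: "sets (lr_example d \<beta> \<sigma>) = sets (example_space d)"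
  by (simp add: lr_example_def)

lemma prob_space_lr_example: "0 \<le> \<sigma> \<Longrightarrow> prob_space (lr_example d \<beta> \<sigma>)"
  unfolding lr_example_eq
  by (intro prob_space.prob_space_distr prob_space_pair prob_space_PiM_gauss prob_space_noise) measurable

lemma nn_integral_lr_example:
  assumes \<sigma>: "0 \<le> \<sigma>" and [measurable]: "H \<in> borel_measurable (example_space d)"
  shows "(\<integral>\<^sup>+e. H e \<partial>lr_example d \<beta> \<sigma>) =
    (\<integral>\<^sup>+\<xi>. \<integral>\<^sup>+x. H (x, (\<Sum>j<d. \<beta> j * x j) + \<xi>) \<partial>PiM {..<d} (\<lambda>_. gauss) \<partial>noise \<sigma>)"
proof -
  have m: "(\<lambda>p. H (fst p, (\<Sum>j<d. \<beta> j * fst p j) + snd p)) \<in> borel_measurable (PiM {..<d} (\<lambda>_. borel) \<Otimes>\<^sub>M borel)"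
    by (rule measurable_compose[OF measurable_label]) measurable
  then have m': "case_prod (\<lambda>x \<xi>. H (x, (\<Sum>j<d. \<beta> j * x j) + \<xi>)) \<in> borel_measurable (PiM {..<d} (\<lambda>_. gauss) \<Otimes>\<^sub>M noise \<sigma>)"
    by (simp add: case_prod_beta' cong: measurable_cong_sets)
  have "(\<integral>\<^sup>+e. H e \<partial>lr_example d \<beta> \<sigma>) =
      (\<integral>\<^sup>+p. H (fst p, (\<Sum>j<d. \<beta> j * fst p j) + snd p) \<partial>(PiM {..<d} (\<lambda>_. gauss) \<Otimes>\<^sub>M noise \<sigma>))"
    unfolding lr_example_eq by (rule nn_integral_distr) measurable
  also have "\<dots> = (\<integral>\<^sup>+x. \<integral>\<^sup>+\<xi>. H (x, (\<Sum>j<d. \<beta> j * x j) + \<xi>) \<partial>noise \<sigma> \<partial>PiM {..<d} (\<lambda>_. gauss))"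
    using nn_integral_pair_prob[OF prob_space_noise[OF \<sigma>] m'] by simp
  also have "\<dots> = (\<integral>\<^sup>+\<xi>. \<integral>\<^sup>+x. H (x, (\<Sum>j<d. \<beta> j * x j) + \<xi>) \<partial>PiM {..<d} (\<lambda>_. gauss) \<partial>noise \<sigma>)"
    by (rule nn_integral_swap[OF prob_space_PiM_gauss prob_space_noise[OF \<sigma>] m'])
  finally show ?thesis .
qed

lemma nn_integral_coins:
  assumes [measurable]: "H \<in> borel_measurable (coins m)"
  shows "(\<integral>\<^sup>+a. H a \<partial>coins m) =
    (\<Sum>t<Suc m. \<integral>\<^sup>+w. H (w, t) \<partial>PiM {..<m} (\<lambda>_. unif)) / of_nat (Suc m)"
proof -
  let ?T = "measure_pmf (pmf_of_set {..<Suc m})" and ?W = "PiM {..<m} (\<lambda>_. unif)"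
  have mm: "case_prod (\<lambda>w t. H (w, t)) \<in> borel_measurable (?W \<Otimes>\<^sub>M ?T)"
    using assms by (simp add: coins_def)
  have "(\<integral>\<^sup>+a. H a \<partial>coins m) = (\<integral>\<^sup>+w. \<integral>\<^sup>+t. H (w, t) \<partial>?T \<partial>?W)"
    using nn_integral_pair_prob[OF measure_pmf.prob_space_axioms mm] by (simp add: coins_def)
  also have "\<dots> = (\<integral>\<^sup>+t. \<integral>\<^sup>+w. H (w, t) \<partial>?W \<partial>?T)"
    by (rule nn_integral_swap[OF prob_space_PiM_unif measure_pmf.prob_space_axioms mm])
  also have "\<dots> = (\<Sum>t<Suc m. \<integral>\<^sup>+w. H (w, t) \<partial>?W) / of_nat (Suc m)"
    by (subst nn_integral_pmf_of_set) (auto simp: ennreal_of_nat_eq_real_of_nat)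
  finally show ?thesis .
qed

text \<open>The reason for regressors with equal entries: the label then sees the vector only
  through \<open>rsum\<close>, the quantity preserved by the symmetry of the mask.\<close>

lemma sum_const_vec: "(\<Sum>j<Suc m. const_vec (Suc m) c j * x j) = c * sqrt (real m + 1) * rsum m x"
proof -
  have "(\<Sum>j<Suc m. const_vec (Suc m) c j * x j) = (\<Sum>j<Suc m. c * x j)"
    by (intro sum.cong) (auto simp: const_vec_def)
  also have "\<dots> = c * (\<Sum>j<Suc m. x j)"
    by (simp only: sum_distrib_left)
  finally show ?thesis
    by (simp add: rsum_def)
qed

text \<open>Noise and shift are moved outside, since the symmetry of the mask is available for each
  fixed noise value and shift.\<close>

lemma nn_integral_lr_coins:
  assumes \<sigma>: "0 \<le> \<sigma>" and G: "G \<in> borel_measurable (example_space (Suc m) \<Otimes>\<^sub>M coins m)"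
  shows "(\<integral>\<^sup>+p. G p \<partial>(lr_example (Suc m) (const_vec (Suc m) c) \<sigma> \<Otimes>\<^sub>M coins m)) =
    (\<integral>\<^sup>+\<xi>. (\<Sum>t<Suc m. \<integral>\<^sup>+x. \<integral>\<^sup>+w. G ((x, c * sqrt (real m + 1) * rsum m x + \<xi>), (w, t))
      \<partial>PiM {..<m} (\<lambda>_. unif) \<partial>PiM {..<Suc m} (\<lambda>_. gauss)) / of_nat (Suc m) \<partial>noise \<sigma>)"
proof -
  let ?L = "lr_example (Suc m) (const_vec (Suc m) c) \<sigma>" and ?W = "PiM {..<m} (\<lambda>_. unif)"
    and ?X = "PiM {..<Suc m} (\<lambda>_. gauss)"
  note [measurable] = G
  have Ge [measurable]: "(\<lambda>a. G (e, a)) \<in> borel_measurable (coins m)" if "e \<in> space (example_space (Suc m))" for e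
    using that by measurable
  have "(\<integral>\<^sup>+p. G p \<partial>(?L \<Otimes>\<^sub>M coins m)) = (\<integral>\<^sup>+e. \<integral>\<^sup>+a. G (e, a) \<partial>coins m \<partial>?L)"
    by (subst nn_integral_pair_prob[OF prob_space_coins]) simp_all
  also have "\<dots> = (\<integral>\<^sup>+\<xi>. \<integral>\<^sup>+x. \<integral>\<^sup>+a. G ((x, c * sqrt (real m + 1) * rsum m x + \<xi>), a) \<partial>coins m \<partial>?X \<partial>noise \<sigma>)"
  proof -
    have "(\<lambda>e. \<integral>\<^sup>+a. G (e, a) \<partial>coins m) \<in> borel_measurable (example_space (Suc m))"
      by (rule borel_measurable_nn_integral_prob[OF prob_space_coins]) simp
    from nn_integral_lr_example[OF \<sigma> this] show ?thesis
      by (simp only: sum_const_vec)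
  qed
  also have "\<dots> = (\<integral>\<^sup>+\<xi>. (\<Sum>t<Suc m. \<integral>\<^sup>+x. \<integral>\<^sup>+w. G ((x, c * sqrt (real m + 1) * rsum m x + \<xi>), (w, t))
      \<partial>?W \<partial>?X) / of_nat (Suc m) \<partial>noise \<sigma>)"
  proof (rule nn_integral_cong)
    fix \<xi> :: real
    let ?e = "\<lambda>x. (x, c * sqrt (real m + 1) * rsum m x + \<xi>)"
    have e: "?e \<in> PiM {..<Suc m} (\<lambda>_. borel) \<rightarrow>\<^sub>M example_space (Suc m)"
      by measurable
    have Gt: "(\<lambda>p. G (?e (fst p), (snd p, t))) \<in> borel_measurable (PiM {..<Suc m} (\<lambda>_. borel) \<Otimes>\<^sub>M PiM {..<m} (\<lambda>_. borel))" for t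
      by measurable
    have "(\<integral>\<^sup>+x. \<integral>\<^sup>+a. G (?e x, a) \<partial>coins m \<partial>?X) =
        (\<integral>\<^sup>+x. (\<Sum>t<Suc m. \<integral>\<^sup>+w. G (?e x, (w, t)) \<partial>?W) / of_nat (Suc m) \<partial>?X)"
    proof (rule nn_integral_cong)
      fix x assume "x \<in> space ?X"
      then have "?e x \<in> space (example_space (Suc m))"
        using measurable_space[OF e] by (simp add: space_PiM)
      then show "(\<integral>\<^sup>+a. G (?e x, a) \<partial>coins m) = (\<Sum>t<Suc m. \<integral>\<^sup>+w. G (?e x, (w, t)) \<partial>?W) / of_nat (Suc m)"
        by (intro nn_integral_coins) measurable
    qed
    also have "\<dots> = (\<integral>\<^sup>+x. (\<Sum>t<Suc m. \<integral>\<^sup>+w. G (?e x, (w, t)) \<partial>?W) \<partial>?X) / of_nat (Suc m)"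
      by (rule nn_integral_divide) measurable
    also have "(\<integral>\<^sup>+x. (\<Sum>t<Suc m. \<integral>\<^sup>+w. G (?e x, (w, t)) \<partial>?W) \<partial>?X) =
        (\<Sum>t<Suc m. \<integral>\<^sup>+x. \<integral>\<^sup>+w. G (?e x, (w, t)) \<partial>?W \<partial>?X)"
      by (rule nn_integral_sum) measurable
    finally show "(\<integral>\<^sup>+x. \<integral>\<^sup>+a. G (?e x, a) \<partial>coins m \<partial>?X) = \<dots> / of_nat (Suc m)" .
  qed
  finally show ?thesis .
qed

definition observed_law :: "nat \<Rightarrow> real \<Rightarrow> real \<Rightarrow> ((nat \<Rightarrow> real option) \<times> real option) measure" where
  "observed_law m c \<sigma> = distr (lr_example (Suc m) (const_vec (Suc m) c) \<sigma> \<Otimes>\<^sub>M coins m) (cexample_space (Suc m)) (observe m)"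

text \<open>Negating the normal vector turns the label for \<open>- c\<close> into the one for
  \<open>c\<close> and undoes the inner negation of \<open>observe_mirrored\<close>. The outer
  negation is then absorbed by \<open>sym_mask_neg_symmetric\<close>. Hence the masked examples
  carry no information on the sign of the regressor.\<close>

lemma observed_law_mirrored:
  assumes \<sigma>: "0 \<le> \<sigma>"
  shows "distr (lr_example (Suc m) (const_vec (Suc m) (- c)) \<sigma> \<Otimes>\<^sub>M coins m) (cexample_space (Suc m)) (observe_mirrored m)
    = observed_law m c \<sigma>" (is "?D = _")
proof (rule measure_eqI)
  fix A assume "A \<in> sets ?D"
  then have [measurable]: "A \<in> sets (cexample_space (Suc m))" by simp
  let ?W = "PiM {..<m} (\<lambda>_. unif)" and ?X = "PiM {..<Suc m} (\<lambda>_. gauss)"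
  have em: "emeasure (distr (lr_example (Suc m) (const_vec (Suc m) c') \<sigma> \<Otimes>\<^sub>M coins m) (cexample_space (Suc m)) f) A =
      (\<integral>\<^sup>+p. indicator A (f p) \<partial>(lr_example (Suc m) (const_vec (Suc m) c') \<sigma> \<Otimes>\<^sub>M coins m))"
    if [measurable]: "f \<in> example_space (Suc m) \<Otimes>\<^sub>M coins m \<rightarrow>\<^sub>M cexample_space (Suc m)" for f c'
    by (simp add: nn_integral_indicator[symmetric] nn_integral_distr del: nn_integral_indicator)
  let ?k = "c * sqrt (real m + 1)"
  have inner: "(\<integral>\<^sup>+x. \<integral>\<^sup>+w. indicator A (observe_mirrored m ((x, - c * sqrt (real m + 1) * rsum m x + \<xi>), (w, t))) \<partial>?W \<partial>?X) =
      (\<integral>\<^sup>+x. \<integral>\<^sup>+w. indicator A (observe m ((x, c * sqrt (real m + 1) * rsum m x + \<xi>), (w, t))) \<partial>?W \<partial>?X :: ennreal)" for \<xi> t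
  proof -
    have F: "(\<lambda>p. indicator A (fst p, Some (?k * snd p + \<xi>)) :: ennreal) \<in> borel_measurable (obs_space (Suc m) \<Otimes>\<^sub>M borel)"
      by measurable
    have mm: "(\<lambda>x. \<integral>\<^sup>+w. indicator A (neg_obs (Suc m) (sym_mask m (neg_vec (Suc m) x) w t), Some (- ?k * rsum m x + \<xi>)) \<partial>?W :: ennreal)
        \<in> borel_measurable (PiM {..<Suc m} (\<lambda>_. borel))"
      by measurable
    have "(\<integral>\<^sup>+x. \<integral>\<^sup>+w. indicator A (observe_mirrored m ((x, - c * sqrt (real m + 1) * rsum m x + \<xi>), (w, t))) \<partial>?W \<partial>?X) =
        (\<integral>\<^sup>+x. \<integral>\<^sup>+w. indicator A (neg_obs (Suc m) (sym_mask m (neg_vec (Suc m) (neg_vec (Suc m) x)) w t),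
          Some (- ?k * rsum m (neg_vec (Suc m) x) + \<xi>)) \<partial>?W \<partial>?X :: ennreal)"
      unfolding nn_integral_neg_vec[OF mm] by (simp add: observe_mirrored_def)
    also have "\<dots> = (\<integral>\<^sup>+x. \<integral>\<^sup>+w. indicator A (neg_obs (Suc m) (sym_mask m x w t), Some (?k * rsum m x + \<xi>)) \<partial>?W \<partial>?X)"
      by (intro nn_integral_cong) (simp add: neg_vec_involutive rsum_neg_vec)
    also have "\<dots> = (\<integral>\<^sup>+x. \<integral>\<^sup>+w. indicator A (sym_mask m x w t, Some (?k * rsum m x + \<xi>)) \<partial>?W \<partial>?X)"
      using sym_mask_neg_symmetric[OF F, of t] by simp
    finally show ?thesis
      by (simp add: observe_def)
  qed
  show "emeasure ?D A = emeasure (observed_law m c \<sigma>) A"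
    unfolding observed_law_def
    by (subst em, measurable, subst em, measurable, subst nn_integral_lr_coins[OF \<sigma>], measurable,
        subst nn_integral_lr_coins[OF \<sigma>], measurable) (simp only: inner)
qed (simp add: observed_law_def)

lemma pred_obs_missing:
  assumes "k < d"
  shows "Measurable.pred (cexample_space d) (\<lambda>z. fst z k = None)"
proof -
  have "fst \<in> cexample_space d \<rightarrow>\<^sub>M obs_space d"
    unfolding cexample_space_def by (rule measurable_fst)
  from measurable_compose[OF this pred_obs_None[OF assms]] show ?thesis .
qed

lemma prob_space_observed_law: "0 \<le> \<sigma> \<Longrightarrow> prob_space (observed_law m c \<sigma>)"
  unfolding observed_law_def
  by (intro prob_space.prob_space_distr prob_space_pair prob_space_lr_example prob_space_coins) measurable

lemma emeasure_observed_law_missing: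
  assumes \<sigma>: "0 \<le> \<sigma>" and j: "j < Suc m"
  shows "emeasure (observed_law m c \<sigma>) {z \<in> space (cexample_space (Suc m)). fst z j = None}
    \<le> ennreal ((1 + 2 * sqrt (real m)) / real (Suc m))"
proof -
  let ?W = "PiM {..<m} (\<lambda>_. unif)" and ?X = "PiM {..<Suc m} (\<lambda>_. gauss)"
  let ?A = "{z \<in> space (cexample_space (Suc m)). fst z j = None}"
  have [measurable]: "?A \<in> sets (cexample_space (Suc m))"
    using pred_obs_missing[OF j] by (simp add: pred_def)
  have sp: "observe m p \<in> space (cexample_space (Suc m))" if "p \<in> space (example_space (Suc m) \<Otimes>\<^sub>M coins m)" for p
    using measurable_space[OF measurable_observe that] .
  have mp: "Measurable.pred (example_space (Suc m) \<Otimes>\<^sub>M coins m) (\<lambda>p. fst (observe m p) j = None)"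
    by (rule measurable_compose[OF measurable_observe pred_obs_missing[OF j]])
  have "emeasure (observed_law m c \<sigma>) ?A = (\<integral>\<^sup>+p. indicator ?A (observe m p) \<partial>(lr_example (Suc m) (const_vec (Suc m) c) \<sigma> \<Otimes>\<^sub>M coins m))"
    by (simp add: observed_law_def nn_integral_indicator[symmetric] nn_integral_distr del: nn_integral_indicator)
  also have "\<dots> = (\<integral>\<^sup>+p. (if fst (observe m p) j = None then 1 else 0) \<partial>(lr_example (Suc m) (const_vec (Suc m) c) \<sigma> \<Otimes>\<^sub>M coins m))"
  proof (rule nn_integral_cong)
    fix p assume "p \<in> space (lr_example (Suc m) (const_vec (Suc m) c) \<sigma> \<Otimes>\<^sub>M coins m)"
    moreover have "sets (lr_example (Suc m) (const_vec (Suc m) c) \<sigma> \<Otimes>\<^sub>M coins m) = sets (example_space (Suc m) \<Otimes>\<^sub>M coins m)"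
      by (intro sets_pair_measure_cong) simp_all
    ultimately have "p \<in> space (example_space (Suc m) \<Otimes>\<^sub>M coins m)"
      using sets_eq_imp_space_eq by blast
    then show "indicator ?A (observe m p) = (if fst (observe m p) j = None then 1 else 0 :: ennreal)"
      using sp by (simp add: indicator_def)
  qed
  also have "\<dots> = (\<integral>\<^sup>+\<xi>. (\<Sum>t<Suc m. \<integral>\<^sup>+x. \<integral>\<^sup>+w. (if sym_mask m x w t j = None then 1 else 0) \<partial>?W \<partial>?X) / of_nat (Suc m) \<partial>noise \<sigma>)"
    by (subst nn_integral_lr_coins[OF \<sigma>]) (use mp in \<open>measurable, simp add: observe_def\<close>)
  also have "\<dots> \<le> (\<integral>\<^sup>+\<xi>. ennreal (1 + 2 * sqrt (real m)) / of_nat (Suc m) \<partial>noise \<sigma>)"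
    by (intro nn_integral_mono divide_right_mono_ennreal sym_mask_missing j)
  also have "\<dots> = ennreal (1 + 2 * sqrt (real m)) / of_nat (Suc m)"
    using prob_space.emeasure_space_1[OF prob_space_noise[OF \<sigma>]] by simp
  also have "\<dots> = ennreal ((1 + 2 * sqrt (real m)) / real (Suc m))"
    unfolding ennreal_of_nat_eq_real_of_nat by (subst divide_ennreal) (auto simp: add_nonneg_nonneg)
  finally show ?thesis .
qed

subsection \<open>Incomplete datasets and the adversary\<close>

text \<open>Independent examples masked with independent coins give independent masked examples. The
  two laws of the masked sample are compared on boxes, where both factorise.\<close>

lemma nn_integral_PiM_pair:
  assumes L: "prob_space L" and A: "prob_space A" and f: "f \<in> L \<Otimes>\<^sub>M A \<rightarrow>\<^sub>M N"
    and h: "h \<in> borel_measurable (PiM {..<n::nat} (\<lambda>_. N))"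
  shows "(\<integral>\<^sup>+S. \<integral>\<^sup>+a. h (\<lambda>i\<in>{..<n}. f (S i, a i)) \<partial>PiM {..<n} (\<lambda>_. A) \<partial>PiM {..<n} (\<lambda>_. L)) =
    (\<integral>\<^sup>+Z. h Z \<partial>PiM {..<n} (\<lambda>_. distr (L \<Otimes>\<^sub>M A) N f))"
proof -
  let ?L = "PiM {..<n} (\<lambda>_. L)" and ?A = "PiM {..<n} (\<lambda>_. A)" and ?Q = "distr (L \<Otimes>\<^sub>M A) N f"
  let ?g = "\<lambda>p. \<lambda>i\<in>{..<n}. f (fst p i, snd p i)"
  note [measurable] = f h
  interpret A: product_sigma_finite "\<lambda>_::nat. A"
    using A by (simp add: product_sigma_finite_def prob_space_imp_sigma_finite)
  interpret L: product_sigma_finite "\<lambda>_::nat. L"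
    using L by (simp add: product_sigma_finite_def prob_space_imp_sigma_finite)
  have Q: "prob_space ?Q"
    by (intro prob_space.prob_space_distr prob_space_pair L A) measurable
  interpret Q: product_sigma_finite "\<lambda>_::nat. ?Q"
    using Q by (simp add: product_sigma_finite_def prob_space_imp_sigma_finite)
  have PA: "prob_space ?A"
    by (intro prob_space_PiM A)
  have comp: "(\<lambda>p. f (fst p i, snd p i)) \<in> ?L \<Otimes>\<^sub>M ?A \<rightarrow>\<^sub>M N" if "i \<in> {..<n}" for i
  proof -
    have [measurable]: "(\<lambda>p. fst p i) \<in> ?L \<Otimes>\<^sub>M ?A \<rightarrow>\<^sub>M L" "(\<lambda>p. snd p i) \<in> ?L \<Otimes>\<^sub>M ?A \<rightarrow>\<^sub>M A"
      using that by (auto intro!: measurable_compose[OF measurable_fst] measurable_compose[OF measurable_snd]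
          measurable_component_singleton)
    show ?thesis by measurable
  qed
  have g [measurable]: "?g \<in> ?L \<Otimes>\<^sub>M ?A \<rightarrow>\<^sub>M PiM {..<n} (\<lambda>_. N)"
    by (rule measurable_restrict) (rule comp)
  have "distr (?L \<Otimes>\<^sub>M ?A) (PiM {..<n} (\<lambda>_. N)) ?g = PiM {..<n} (\<lambda>_. ?Q)"
  proof (rule Q.PiM_eqI)
    fix X assume X: "\<And>i. i \<in> {..<n} \<Longrightarrow> X i \<in> sets ?Q"
    then have XN: "X i \<in> sets N" if "i \<in> {..<n}" for i
      using that by simp
    then have XS: "PiE {..<n} X \<in> sets (PiM {..<n} (\<lambda>_. N))"
      by (intro sets_PiM_I_finite) auto
    have ind: "(\<lambda>p. indicator (X i) (f p) :: ennreal) \<in> borel_measurable (L \<Otimes>\<^sub>M A)" if "i \<in> {..<n}" for i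
      using XN[OF that] by measurable
    have "emeasure (distr (?L \<Otimes>\<^sub>M ?A) (PiM {..<n} (\<lambda>_. N)) ?g) (PiE {..<n} X) =
        (\<integral>\<^sup>+p. indicator (PiE {..<n} X) (?g p) \<partial>(?L \<Otimes>\<^sub>M ?A))"
      using XS by (simp add: nn_integral_indicator[symmetric] nn_integral_distr del: nn_integral_indicator)
    also have "\<dots> = (\<integral>\<^sup>+p. (\<Prod>i<n. indicator (X i) (f (fst p i, snd p i))) \<partial>(?L \<Otimes>\<^sub>M ?A))"
      by (intro nn_integral_cong) (auto simp: indicator_def PiE_def Pi_def intro!: prod_zero)
    also have "\<dots> = (\<integral>\<^sup>+S. \<integral>\<^sup>+a. (\<Prod>i<n. indicator (X i) (f (S i, a i))) \<partial>?A \<partial>?L)"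
    proof (rule nn_integral_pair_prob[OF PA, symmetric])
      have "(\<lambda>p. \<Prod>i<n. indicator (X i) (f (fst p i, snd p i)) :: ennreal) \<in> borel_measurable (?L \<Otimes>\<^sub>M ?A)"
      proof (intro borel_measurable_prod_ennreal)
        fix i assume i: "i \<in> {..<n}"
        note [measurable] = comp[OF i] XN[OF i]
        show "(\<lambda>p. indicator (X i) (f (fst p i, snd p i)) :: ennreal) \<in> borel_measurable (?L \<Otimes>\<^sub>M ?A)"
          by measurable
      qed
      then show "case_prod (\<lambda>S a. \<Prod>i<n. indicator (X i) (f (S i, a i)) :: ennreal) \<in> borel_measurable (?L \<Otimes>\<^sub>M ?A)"
        by (simp add: case_prod_beta')
    qed
    also have "\<dots> = (\<integral>\<^sup>+S. (\<Prod>i<n. \<integral>\<^sup>+a. indicator (X i) (f (S i, a)) \<partial>A) \<partial>?L)"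
    proof (rule nn_integral_cong)
      fix S assume S: "S \<in> space ?L"
      show "(\<integral>\<^sup>+a. (\<Prod>i<n. indicator (X i) (f (S i, a i))) \<partial>?A) = (\<Prod>i<n. \<integral>\<^sup>+a. indicator (X i) (f (S i, a)) \<partial>A :: ennreal)"
      proof (rule A.product_nn_integral_prod)
        fix i assume i: "i \<in> {..<n}"
        then have "S i \<in> space L"
          using S by (auto simp: space_PiM PiE_def Pi_def)
        then show "(\<lambda>a. indicator (X i) (f (S i, a)) :: ennreal) \<in> borel_measurable A"
          using measurable_compose[OF measurable_Pair1' ind[OF i]] by simp
      qed simp
    qed
    also have "\<dots> = (\<Prod>i<n. \<integral>\<^sup>+s. \<integral>\<^sup>+a. indicator (X i) (f (s, a)) \<partial>A \<partial>L)"
    proof (rule L.product_nn_integral_prod)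
      fix i assume i: "i \<in> {..<n}"
      show "(\<lambda>s. \<integral>\<^sup>+a. indicator (X i) (f (s, a)) \<partial>A :: ennreal) \<in> borel_measurable L"
        using ind[OF i] by (intro borel_measurable_nn_integral_prob[OF A]) simp
    qed simp
    also have "\<dots> = (\<Prod>i<n. emeasure ?Q (X i))"
    proof (rule prod.cong)
      fix i assume i: "i \<in> {..<n}"
      have "(\<integral>\<^sup>+s. \<integral>\<^sup>+a. indicator (X i) (f (s, a)) \<partial>A \<partial>L) = (\<integral>\<^sup>+p. indicator (X i) (f p) \<partial>(L \<Otimes>\<^sub>M A) :: ennreal)"
        using ind[OF i] by (subst nn_integral_pair_prob[OF A]) simp_all
      then show "(\<integral>\<^sup>+s. \<integral>\<^sup>+a. indicator (X i) (f (s, a)) \<partial>A \<partial>L) = emeasure ?Q (X i)"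
        using XN[OF i] by (simp add: nn_integral_indicator[symmetric] nn_integral_distr del: nn_integral_indicator)
    qed simp
    finally show "emeasure (distr (?L \<Otimes>\<^sub>M ?A) (PiM {..<n} (\<lambda>_. N)) ?g) (PiE {..<n} X) = (\<Prod>i<n. emeasure ?Q (X i))" .
  qed (auto intro!: sets_PiM_cong)
  then have "(\<integral>\<^sup>+Z. h Z \<partial>PiM {..<n} (\<lambda>_. ?Q)) = (\<integral>\<^sup>+Z. h Z \<partial>distr (?L \<Otimes>\<^sub>M ?A) (PiM {..<n} (\<lambda>_. N)) ?g)"
    by simp
  also have "\<dots> = (\<integral>\<^sup>+p. h (?g p) \<partial>(?L \<Otimes>\<^sub>M ?A))"
    by (rule nn_integral_distr[OF g]) simp
  also have "\<dots> = (\<integral>\<^sup>+S. \<integral>\<^sup>+a. h (\<lambda>i\<in>{..<n}. f (S i, a i)) \<partial>?A \<partial>?L)"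
    by (rule nn_integral_pair_prob[OF PA, symmetric])
      (use measurable_compose[OF g h] in \<open>simp add: case_prod_beta'\<close>)
  finally show ?thesis ..
qed

definition few_missing :: "nat \<Rightarrow> nat \<Rightarrow> real \<Rightarrow> (nat \<Rightarrow> (nat \<Rightarrow> real option) \<times> real option) \<Rightarrow> bool" where
  "few_missing d n \<eta> Z \<longleftrightarrow> (\<forall>j\<in>{..<d}. real (card {i. i < n \<and> fst (Z i) j = None}) \<le> \<eta> * real n)"

definition reveal :: "nat \<Rightarrow> nat \<Rightarrow> (nat \<Rightarrow> (nat \<Rightarrow> real) \<times> real) \<Rightarrow> nat \<Rightarrow> (nat \<Rightarrow> real option) \<times> real option" where
  "reveal d n S = (\<lambda>i\<in>{..<n}. (\<lambda>j\<in>{..<d}. Some (fst (S i) j), Some (snd (S i))))"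

text \<open>The independent masks respect the budget only with high probability, while
  \<open>adversary\<close> demands it almost surely for every sample. If the budget is exceeded,
  everything is therefore revealed.\<close>

definition corrupt :: "nat \<Rightarrow> nat \<Rightarrow> real \<Rightarrow> (((nat \<Rightarrow> real) \<times> real) \<times> 'a \<Rightarrow> (nat \<Rightarrow> real option) \<times> real option) \<Rightarrow>
    (nat \<Rightarrow> (nat \<Rightarrow> real) \<times> real) \<Rightarrow> (nat \<Rightarrow> 'a) \<Rightarrow> nat \<Rightarrow> (nat \<Rightarrow> real option) \<times> real option" where
  "corrupt d n \<eta> f S a =
    (let Z = \<lambda>i\<in>{..<n}. f (S i, a i) in if few_missing d n \<eta> Z then Z else reveal d n S)"

definition coin_adversary :: "nat \<Rightarrow> nat \<Rightarrow> real \<Rightarrow> 'a measure \<Rightarrow>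
    (((nat \<Rightarrow> real) \<times> real) \<times> 'a \<Rightarrow> (nat \<Rightarrow> real option) \<times> real option) \<Rightarrow>
    (nat \<Rightarrow> (nat \<Rightarrow> real) \<times> real) \<Rightarrow> (nat \<Rightarrow> (nat \<Rightarrow> real option) \<times> real option) measure" where
  "coin_adversary d n \<eta> A f S = distr (PiM {..<n} (\<lambda>_. A)) (cdata_space d n) (corrupt d n \<eta> f S)"

lemma measurable_cdata_nth: "i < n \<Longrightarrow> (\<lambda>Z. Z i) \<in> cdata_space d n \<rightarrow>\<^sub>M cexample_space d"
  unfolding cdata_space_def by (intro measurable_component_singleton) auto

lemma measurable_cdata_coord:
  assumes "i < n" "j < d"
  shows "(\<lambda>Z. fst (Z i) j) \<in> cdata_space d n \<rightarrow>\<^sub>M opt_borel"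
proof -
  have "fst \<in> cexample_space d \<rightarrow>\<^sub>M obs_space d"
    unfolding cexample_space_def by (rule measurable_fst)
  from measurable_compose[OF this measurable_component_singleton[of j]] assms(2)
  have "(\<lambda>z. fst z j) \<in> cexample_space d \<rightarrow>\<^sub>M opt_borel"
    by simp
  from measurable_compose[OF measurable_cdata_nth[OF assms(1)] this] show ?thesis .
qed

lemma measurable_cdata_label:
  assumes "i < n"
  shows "(\<lambda>Z. snd (Z i)) \<in> cdata_space d n \<rightarrow>\<^sub>M opt_borel"
proof -
  have "snd \<in> cexample_space d \<rightarrow>\<^sub>M opt_borel"
    unfolding cexample_space_def by (rule measurable_snd)
  from measurable_compose[OF measurable_cdata_nth[OF assms(1)] this] show ?thesis .
qed

lemma pred_card_le:
  fixes n :: nat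
  assumes "\<And>i. i < n \<Longrightarrow> Measurable.pred M (P i)"
  shows "Measurable.pred M (\<lambda>z. real (card {i. i < n \<and> P i z}) \<le> c)"
proof -
  have [measurable]: "(\<lambda>z. \<Sum>i<n. if P i z then 1 else 0 :: real) \<in> borel_measurable M"
  proof (rule borel_measurable_sum)
    fix i assume "i \<in> {..<n}"
    then have [measurable]: "Measurable.pred M (P i)"
      using assms by simp
    show "(\<lambda>z. if P i z then 1 else 0 :: real) \<in> borel_measurable M"
      by measurable
  qed
  have eq: "real (card {i. i < n \<and> P i z}) = (\<Sum>i<n. if P i z then 1 else 0 :: real)" for z
  proof -
    have "{i. i < n \<and> P i z} = {i \<in> {..<n}. P i z}" by auto
    then show ?thesis
      using sum.inter_filter[OF finite_lessThan[of n], of "\<lambda>_. 1 :: real" "\<lambda>i. P i z"] by simp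
  qed
  show ?thesis
    unfolding eq by measurable
qed

lemma pred_few_missing [measurable]: "Measurable.pred (cdata_space d n) (few_missing d n \<eta>)"
  unfolding few_missing_def
proof (rule pred_intros_finite)
  fix j assume "j \<in> {..<d}"
  then show "Measurable.pred (cdata_space d n) (\<lambda>Z. real (card {i. i < n \<and> fst (Z i) j = None}) \<le> \<eta> * real n)"
    by (intro pred_card_le measurable_compose[OF measurable_cdata_coord pred_opt_borel_eq]) auto
qed simp

lemma pred_valid_corruption: "Measurable.pred (cdata_space d n) (valid_corruption d n \<eta> S)"
proof -
  have "valid_corruption d n \<eta> S = (\<lambda>Z.
     (\<forall>i\<in>{..<n}. (\<forall>j\<in>{..<d}. fst (Z i) j = Some (fst (S i) j) \<or> fst (Z i) j = None) \<and>
            (snd (Z i) = Some (snd (S i)) \<or> snd (Z i) = None)) \<and>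
     few_missing d n \<eta> Z \<and>
     real (card {i. i < n \<and> snd (Z i) = None}) \<le> \<eta> * real n)"
    by (rule ext) (simp only: valid_corruption_def few_missing_def Ball_def lessThan_iff)
  also have "Measurable.pred (cdata_space d n) \<dots>"
    by (intro pred_intros_logic(3,5) pred_intros_finite pred_few_missing pred_card_le
        measurable_compose[OF measurable_cdata_coord pred_opt_borel_eq]
        measurable_compose[OF measurable_cdata_label pred_opt_borel_eq]) auto
  finally show ?thesis .
qed

text \<open>A randomised mask for one example that may hide coordinates, but never alters a value or
  hides the label. It is instantiated by \<open>observe\<close> and by
  \<open>observe_mirrored\<close>, so that the adversary is built and analysed once for
  both.\<close>

locale masking_kernel =
  fixes d n :: nat and \<eta> :: real and A :: "'a measure"
    and f :: "((nat \<Rightarrow> real) \<times> real) \<times> 'a \<Rightarrow> (nat \<Rightarrow> real option) \<times> real option"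
  assumes \<eta>: "0 \<le> \<eta>" and A: "prob_space A"
    and f [measurable]: "f \<in> example_space d \<Otimes>\<^sub>M A \<rightarrow>\<^sub>M cexample_space d"
    and f_fst: "j < d \<Longrightarrow> fst (f ((x, y), a)) j = None \<or> fst (f ((x, y), a)) j = Some (x j)"
    and f_snd: "snd (f ((x, y), a)) = Some y"
begin

lemma valid_corrupt: "valid_corruption d n \<eta> S (corrupt d n \<eta> f S a)"
proof -
  let ?Z = "\<lambda>i\<in>{..<n}. f (S i, a i)"
  have nn: "0 \<le> \<eta> * real n"
    using \<eta> by simp
  have "valid_corruption d n \<eta> S ?Z" if "few_missing d n \<eta> ?Z"
  proof -
    have "fst (?Z i) j = Some (fst (S i) j) \<or> fst (?Z i) j = None" if "i < n" "j < d" for i j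
      using f_fst[OF \<open>j < d\<close>, of "fst (S i)" "snd (S i)" "a i"] that by auto
    moreover have "snd (?Z i) = Some (snd (S i))" if "i < n" for i
      using f_snd[of "fst (S i)" "snd (S i)" "a i"] that by auto
    moreover from this have "{i. i < n \<and> snd (?Z i) = None} = {}"
      by auto
    ultimately show ?thesis
      using that nn by (simp add: valid_corruption_def few_missing_def)
  qed
  moreover have "valid_corruption d n \<eta> S (reveal d n S)"
  proof -
    have "{i. i < n \<and> fst (reveal d n S i) j = None} = {}" if "j < d" for j
      using that by (auto simp: reveal_def)
    moreover have "{i. i < n \<and> snd (reveal d n S i) = None} = {}"
      by (auto simp: reveal_def)
    ultimately show ?thesis
      using nn by (auto simp: valid_corruption_def reveal_def)
  qed
  ultimately show ?thesis
    by (simp add: corrupt_def Let_def)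
qed

lemma measurable_data_nth: "i \<in> {..<n} \<Longrightarrow> (\<lambda>S. S i) \<in> data_space d n \<rightarrow>\<^sub>M example_space d"
  unfolding data_space_def by (intro measurable_component_singleton)

lemma measurable_masked:
  "(\<lambda>p. \<lambda>i\<in>{..<n}. f (fst p i, snd p i)) \<in> data_space d n \<Otimes>\<^sub>M PiM {..<n} (\<lambda>_. A) \<rightarrow>\<^sub>M cdata_space d n"
  unfolding cdata_space_def
proof (rule measurable_restrict)
  fix i assume i: "i \<in> {..<n}"
  have [measurable]: "(\<lambda>p. fst p i) \<in> data_space d n \<Otimes>\<^sub>M PiM {..<n} (\<lambda>_. A) \<rightarrow>\<^sub>M example_space d"
    "(\<lambda>p. snd p i) \<in> data_space d n \<Otimes>\<^sub>M PiM {..<n} (\<lambda>_. A) \<rightarrow>\<^sub>M A"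
    using i by (auto intro!: measurable_compose[OF measurable_fst] measurable_compose[OF measurable_snd]
        measurable_component_singleton measurable_data_nth)
  show "(\<lambda>p. f (fst p i, snd p i)) \<in> data_space d n \<Otimes>\<^sub>M PiM {..<n} (\<lambda>_. A) \<rightarrow>\<^sub>M cexample_space d"
    by measurable
qed

lemma measurable_reveal: "reveal d n \<in> data_space d n \<rightarrow>\<^sub>M cdata_space d n"
  unfolding cdata_space_def reveal_def
proof (rule measurable_restrict)
  fix i assume i: "i \<in> {..<n}"
  have fs: "fst \<in> example_space d \<rightarrow>\<^sub>M PiM {..<d} (\<lambda>_. borel)" "snd \<in> example_space d \<rightarrow>\<^sub>M borel"
    unfolding example_space_def vec_space_def by (rule measurable_fst measurable_snd)+
  have "(\<lambda>S. \<lambda>j\<in>{..<d}. Some (fst (S i) j)) \<in> data_space d n \<rightarrow>\<^sub>M obs_space d"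
  proof (rule measurable_restrict)
    fix j assume j: "j \<in> {..<d}"
    show "(\<lambda>S. Some (fst (S i) j)) \<in> data_space d n \<rightarrow>\<^sub>M opt_borel"
      by (rule measurable_compose[OF measurable_compose[OF measurable_compose[OF measurable_data_nth[OF i] fs(1)]
              measurable_component_singleton[OF j]] measurable_Some_opt_borel])
  qed
  moreover have "(\<lambda>S. Some (snd (S i))) \<in> data_space d n \<rightarrow>\<^sub>M opt_borel"
    by (rule measurable_compose[OF measurable_compose[OF measurable_data_nth[OF i] fs(2)] measurable_Some_opt_borel])
  ultimately show "(\<lambda>S. (\<lambda>j\<in>{..<d}. Some (fst (S i) j), Some (snd (S i)))) \<in> data_space d n \<rightarrow>\<^sub>M cexample_space d"
    unfolding cexample_space_def by (rule measurable_Pair)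
qed

lemma measurable_corrupt:
  "case_prod (corrupt d n \<eta> f) \<in> data_space d n \<Otimes>\<^sub>M PiM {..<n} (\<lambda>_. A) \<rightarrow>\<^sub>M cdata_space d n"
proof -
  note [measurable] = measurable_masked measurable_reveal
  have "Measurable.pred (data_space d n \<Otimes>\<^sub>M PiM {..<n} (\<lambda>_. A)) (\<lambda>p. few_missing d n \<eta> (\<lambda>i\<in>{..<n}. f (fst p i, snd p i)))"
    by (rule measurable_compose[OF measurable_masked pred_few_missing])
  then have "(\<lambda>p. if few_missing d n \<eta> (\<lambda>i\<in>{..<n}. f (fst p i, snd p i)) then \<lambda>i\<in>{..<n}. f (fst p i, snd p i)
      else reveal d n (fst p)) \<in> data_space d n \<Otimes>\<^sub>M PiM {..<n} (\<lambda>_. A) \<rightarrow>\<^sub>M cdata_space d n"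
    by (intro measurable_If measurable_masked measurable_compose[OF measurable_fst measurable_reveal]) (simp add: pred_def)
  then show ?thesis
    by (simp add: corrupt_def Let_def case_prod_beta')
qed

lemma measurable_corrupt_fixed:
  "S \<in> space (data_space d n) \<Longrightarrow> corrupt d n \<eta> f S \<in> PiM {..<n} (\<lambda>_. A) \<rightarrow>\<^sub>M cdata_space d n"
  using measurable_compose[OF measurable_Pair1' measurable_corrupt] by simp

lemma prob_space_coin_product: "prob_space (PiM {..<n} (\<lambda>_. A))"
  by (intro prob_space_PiM A)

lemma measurable_coin_adversary: "coin_adversary d n \<eta> A f \<in> data_space d n \<rightarrow>\<^sub>M prob_algebra (cdata_space d n)"
proof (rule measurable_prob_algebraI)
  fix S assume S: "S \<in> space (data_space d n)"
  show "prob_space (coin_adversary d n \<eta> A f S)"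
    unfolding coin_adversary_def
    by (rule prob_space.prob_space_distr[OF prob_space_coin_product measurable_corrupt_fixed[OF S]])
next
  have "(\<lambda>S. distr (PiM {..<n} (\<lambda>_. A)) (cdata_space d n) (corrupt d n \<eta> f S)) \<in> data_space d n \<rightarrow>\<^sub>M subprob_algebra (cdata_space d n)"
  proof (rule measurable_distr2[OF measurable_corrupt])
    show "(\<lambda>S. PiM {..<n} (\<lambda>_. A)) \<in> data_space d n \<rightarrow>\<^sub>M subprob_algebra (PiM {..<n} (\<lambda>_. A))"
      by (intro measurable_const prob_space.M_in_subprob prob_space_coin_product)
  qed
  then show "coin_adversary d n \<eta> A f \<in> data_space d n \<rightarrow>\<^sub>M subprob_algebra (cdata_space d n)"
    by (simp add: coin_adversary_def[abs_def])
qed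

lemma adversary_coin_adversary: "adversary d n \<eta> (coin_adversary d n \<eta> A f)"
  unfolding adversary_def
proof (intro conjI ballI measurable_coin_adversary)
  fix S assume S: "S \<in> space (data_space d n)"
  show "AE Z in coin_adversary d n \<eta> A f S. valid_corruption d n \<eta> S Z"
    unfolding coin_adversary_def
    by (subst AE_distr_iff[OF measurable_corrupt_fixed[OF S]])
      (use pred_valid_corruption[of d n \<eta> S] in \<open>auto simp: pred_def valid_corrupt\<close>)
qed

context
  fixes \<beta> :: "nat \<Rightarrow> real" and \<sigma> :: real and alg :: "(nat \<Rightarrow> (nat \<Rightarrow> real option) \<times> real option) \<Rightarrow> (nat \<Rightarrow> real) measure"
  assumes \<sigma>: "0 \<le> \<sigma>" and alg: "alg \<in> cdata_space d n \<rightarrow>\<^sub>M prob_algebra (vec_space d)"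
begin

lemma sets_lr_data: "sets (lr_data d n \<beta> \<sigma>) = sets (data_space d n)"
  unfolding lr_data_def data_space_def by (intro sets_PiM_cong) simp_all

lemma prob_space_lr_data: "prob_space (lr_data d n \<beta> \<sigma>)"
  unfolding lr_data_def by (intro prob_space_PiM prob_space_lr_example \<sigma>)

lemma measurable_run: "(\<lambda>S. coin_adversary d n \<eta> A f S \<bind> alg) \<in> lr_data d n \<beta> \<sigma> \<rightarrow>\<^sub>M prob_algebra (vec_space d)"
  unfolding measurable_cong_sets[OF sets_lr_data refl]
  by (rule measurable_bind_prob_space[OF measurable_coin_adversary alg])

lemma prob_space_output_dist: "prob_space (output_dist d n \<beta> \<sigma> (coin_adversary d n \<eta> A f) alg)"
  unfolding output_dist_def
  by (rule prob_space_bind'[OF _ measurable_run]) (simp add: space_prob_algebra prob_space_lr_data)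

text \<open>Samples over budget are counted as 0 on the left, so the fallback can only increase the
  right-hand side. The left-hand side involves regressor and mask solely through the law of one
  masked example; this is where equality of the two observed laws will enter.\<close>

lemma output_dist_ge:
  assumes E: "E \<in> sets (vec_space d)"
  shows "(\<integral>\<^sup>+Z. (if few_missing d n \<eta> Z then emeasure (alg Z) E else 0)
      \<partial>PiM {..<n} (\<lambda>_. distr (lr_example d \<beta> \<sigma> \<Otimes>\<^sub>M A) (cexample_space d) f))
    \<le> emeasure (output_dist d n \<beta> \<sigma> (coin_adversary d n \<eta> A f) alg) E"
proof -
  let ?h = "\<lambda>Z. if few_missing d n \<eta> Z then emeasure (alg Z) E else 0"
  let ?A = "PiM {..<n} (\<lambda>_. A)" and ?L = "lr_data d n \<beta> \<sigma>"
  have algE [measurable]: "(\<lambda>Z. emeasure (alg Z) E) \<in> borel_measurable (cdata_space d n)"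
    by (rule measurable_compose[OF measurable_prob_algebraD[OF alg] measurable_emeasure_subprob_algebra[OF E]])
  have h: "?h \<in> borel_measurable (PiM {..<n} (\<lambda>_. cexample_space d))"
    unfolding cdata_space_def[symmetric] by measurable
  have f': "f \<in> lr_example d \<beta> \<sigma> \<Otimes>\<^sub>M A \<rightarrow>\<^sub>M cexample_space d"
    using f by (simp add: measurable_cong_sets[OF sets_pair_measure_cong[OF sets_lr_example refl] refl])
  have "(\<integral>\<^sup>+Z. ?h Z \<partial>PiM {..<n} (\<lambda>_. distr (lr_example d \<beta> \<sigma> \<Otimes>\<^sub>M A) (cexample_space d) f)) =
      (\<integral>\<^sup>+S. \<integral>\<^sup>+a. ?h (\<lambda>i\<in>{..<n}. f (S i, a i)) \<partial>?A \<partial>?L)"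
    using nn_integral_PiM_pair[OF prob_space_lr_example[OF \<sigma>] A f' h] by (simp add: lr_data_def)
  also have "\<dots> \<le> (\<integral>\<^sup>+S. \<integral>\<^sup>+a. emeasure (alg (corrupt d n \<eta> f S a)) E \<partial>?A \<partial>?L)"
    by (intro nn_integral_mono) (auto simp: corrupt_def Let_def)
  also have "\<dots> = (\<integral>\<^sup>+S. emeasure (coin_adversary d n \<eta> A f S \<bind> alg) E \<partial>?L)"
  proof (rule nn_integral_cong)
    fix S assume "S \<in> space ?L"
    then have S: "S \<in> space (data_space d n)"
      using sets_eq_imp_space_eq[OF sets_lr_data] by simp
    have "space ?A \<noteq> {}"
      using prob_space.not_empty[OF prob_space_coin_product] .
    then have ne: "space (cdata_space d n) \<noteq> {}"
      using measurable_space[OF measurable_corrupt_fixed[OF S]] by blast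
    have "emeasure (coin_adversary d n \<eta> A f S \<bind> alg) E = (\<integral>\<^sup>+Z. emeasure (alg Z) E \<partial>coin_adversary d n \<eta> A f S)"
      by (rule emeasure_bind[OF _ _ E]) (use ne measurable_prob_algebraD[OF alg] in \<open>simp_all add: coin_adversary_def\<close>)
    also have "\<dots> = (\<integral>\<^sup>+a. emeasure (alg (corrupt d n \<eta> f S a)) E \<partial>?A)"
      unfolding coin_adversary_def by (rule nn_integral_distr[OF measurable_corrupt_fixed[OF S]]) simp
    finally show "(\<integral>\<^sup>+a. emeasure (alg (corrupt d n \<eta> f S a)) E \<partial>?A) = emeasure (coin_adversary d n \<eta> A f S \<bind> alg) E" ..
  qed
  also have "\<dots> = emeasure (output_dist d n \<beta> \<sigma> (coin_adversary d n \<eta> A f) alg) E"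
    unfolding output_dist_def
    by (rule emeasure_bind[symmetric, OF _ measurable_prob_algebraD[OF measurable_run] E])
      (rule prob_space.not_empty[OF prob_space_lr_data])
  finally show ?thesis .
qed

end

end

text \<open>Markov's inequality for $2^N$, where $N$ counts the hidden entries of a coordinate.\<close>

lemma emeasure_many_missing:
  assumes Q: "prob_space Q" and sQ: "sets Q = sets (cexample_space d)"
    and p: "0 \<le> p" "\<And>j. j < d \<Longrightarrow> emeasure Q {z \<in> space (cexample_space d). fst z j = None} \<le> ennreal p"
  shows "emeasure (PiM {..<n} (\<lambda>_. Q)) {Z \<in> space (PiM {..<n} (\<lambda>_. Q)). \<not> few_missing d n \<eta> Z}
    \<le> ennreal (real d * exp ((p - \<eta> * ln 2) * real n))"
proof -
  let ?P = "PiM {..<n} (\<lambda>_. Q)"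
  have sP [measurable_cong]: "sets ?P = sets (cdata_space d n)"
    unfolding cdata_space_def by (intro sets_PiM_cong sQ) simp
  interpret Q: product_sigma_finite "\<lambda>_::nat. Q"
    using Q by (simp add: product_sigma_finite_def prob_space_imp_sigma_finite)
  let ?B = "\<lambda>j. {Z \<in> space ?P. \<not> real (card {i. i < n \<and> fst (Z i) j = None}) \<le> \<eta> * real n}"
  have Bm: "?B j \<in> sets ?P" if "j < d" for j
  proof -
    have "Measurable.pred (cdata_space d n) (\<lambda>Z. real (card {i. i < n \<and> fst (Z i) j = None}) \<le> \<eta> * real n)"
      using that by (intro pred_card_le measurable_compose[OF measurable_cdata_coord pred_opt_borel_eq]) auto
    then have "Measurable.pred (cdata_space d n) (\<lambda>Z. \<not> real (card {i. i < n \<and> fst (Z i) j = None}) \<le> \<eta> * real n)"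
      by (rule pred_intros_logic(2))
    then show ?thesis
      by (simp only: pred_def sP sets_eq_imp_space_eq[OF sP])
  qed
  have B: "emeasure ?P (?B j) \<le> ennreal (exp ((p - \<eta> * ln 2) * real n))" if j: "j < d" for j
  proof -
    \<comment> \<open>This is 2 to the power of the indicator that the entry is hidden. Its mean is
      at most \<open>1 + p\<close>, and the product over the sample is \<open>2 ^ N\<close>, with
      \<open>N\<close> the number of examples whose coordinate \<open>j\<close> is hidden.\<close>
    let ?u = "\<lambda>z. (if fst z j = None then 2 else 1) :: ennreal"
    have "Measurable.pred (cexample_space d) (\<lambda>z. fst z j = None)"
      by (rule pred_obs_missing[OF j])
    then have pQ [measurable]: "Measurable.pred Q (\<lambda>z. fst z j = None)"
      by (simp add: measurable_cong_sets[OF sQ refl])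
    have u: "(\<integral>\<^sup>+z. ?u z \<partial>Q) \<le> ennreal (1 + p)"
    proof -
      have "(\<integral>\<^sup>+z. ?u z \<partial>Q) = (\<integral>\<^sup>+z. 1 + indicator {z \<in> space Q. fst z j = None} z \<partial>Q)"
        by (intro nn_integral_cong) (auto simp: indicator_def one_add_one)
      also have "\<dots> = 1 + emeasure Q {z \<in> space Q. fst z j = None}"
        using prob_space.emeasure_space_1[OF Q] pQ
        by (subst nn_integral_add) (simp_all add: pred_def)
      also have "\<dots> \<le> 1 + ennreal p"
        using p(2)[OF j] sets_eq_imp_space_eq[OF sQ] by simp
      finally show ?thesis
        using p(1) by (simp add: ennreal_plus)
    qed
    have "emeasure ?P (?B j) = (\<integral>\<^sup>+Z. indicator (?B j) Z \<partial>?P)"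
      using Bm[OF j] by simp
    also have "\<dots> \<le> (\<integral>\<^sup>+Z. ennreal (exp (- (\<eta> * ln 2 * real n))) * (\<Prod>i<n. ?u (Z i)) \<partial>?P)"
    proof (rule nn_integral_mono)
      fix Z assume "Z \<in> space ?P"
      show "indicator (?B j) Z \<le> ennreal (exp (- (\<eta> * ln 2 * real n))) * (\<Prod>i<n. ?u (Z i))"
      proof (cases "Z \<in> ?B j")
        case True
        let ?c = "card {i. i < n \<and> fst (Z i) j = None}"
        have "{..<n} \<inter> {i. fst (Z i) j = None} = {i. i < n \<and> fst (Z i) j = None}"
          by auto
        then have pr: "(\<Prod>i<n. ?u (Z i)) = 2 ^ ?c"
          by (simp add: prod.If_cases)
        have "\<eta> * real n * ln 2 \<le> real ?c * ln 2"
          using True by (intro mult_right_mono) auto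
        then have "exp (\<eta> * ln 2 * real n) \<le> exp (real ?c * ln 2)"
          by (simp add: mult.commute mult.left_commute)
        also have "exp (real ?c * ln 2) = 2 ^ ?c"
          by (simp add: exp_of_nat_mult)
        finally have "1 \<le> exp (- (\<eta> * ln 2 * real n)) * 2 ^ ?c"
          by (simp add: exp_minus divide_simps)
        then have "ennreal 1 \<le> ennreal (exp (- (\<eta> * ln 2 * real n)) * 2 ^ ?c)"
          by (rule ennreal_leI)
        also have "\<dots> = ennreal (exp (- (\<eta> * ln 2 * real n))) * 2 ^ ?c"
          by (simp add: ennreal_mult ennreal_power[symmetric])
        finally show ?thesis
          using True pr by simp
      qed simp
    qed
    also have "\<dots> = ennreal (exp (- (\<eta> * ln 2 * real n))) * (\<integral>\<^sup>+Z. (\<Prod>i<n. ?u (Z i)) \<partial>?P)"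
    proof (rule nn_integral_cmult)
      show "(\<lambda>Z. \<Prod>i<n. ?u (Z i)) \<in> borel_measurable ?P"
      proof (intro borel_measurable_prod_ennreal)
        fix i assume i: "i \<in> {..<n}"
        have "?u \<in> borel_measurable Q"
          by measurable
        from measurable_compose[OF measurable_component_singleton[OF i] this]
        show "(\<lambda>Z. ?u (Z i)) \<in> borel_measurable ?P" .
      qed
    qed
    also have "(\<integral>\<^sup>+Z. (\<Prod>i<n. ?u (Z i)) \<partial>?P) = (\<Prod>i<n. \<integral>\<^sup>+z. ?u z \<partial>Q)"
      by (rule Q.product_nn_integral_prod) simp_all
    also have "\<dots> \<le> ennreal (1 + p) ^ n"
      using u by (simp add: power_mono)
    also have "\<dots> = ennreal ((1 + p) ^ n)"
      using p(1) by (intro ennreal_power) simp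
    also have "(1 + p) ^ n \<le> exp (p * real n)"
    proof -
      have "(1 + p) ^ n \<le> exp p ^ n"
        using p(1) exp_ge_add_one_self[of p] by (intro power_mono) auto
      then show ?thesis
        by (simp add: exp_of_nat_mult[symmetric] mult.commute)
    qed
    also have "ennreal (exp (- (\<eta> * ln 2 * real n))) * ennreal (exp (p * real n)) = ennreal (exp ((p - \<eta> * ln 2) * real n))"
      by (simp add: ennreal_mult[symmetric] exp_add[symmetric] algebra_simps)
    finally show ?thesis
      by (simp add: mult_left_mono ennreal_leI)
  qed
  have "{Z \<in> space ?P. \<not> few_missing d n \<eta> Z} = (\<Union>j\<in>{..<d}. ?B j)"
    unfolding few_missing_def by blast
  moreover have "emeasure ?P (\<Union>j\<in>{..<d}. ?B j) \<le> (\<Sum>j<d. emeasure ?P (?B j))"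
    by (rule emeasure_subadditive_finite) (use Bm in blast)+
  ultimately have "emeasure ?P {Z \<in> space ?P. \<not> few_missing d n \<eta> Z} \<le> (\<Sum>j<d. emeasure ?P (?B j))"
    by (simp only:)
  also have "\<dots> \<le> (\<Sum>j<d. ennreal (exp ((p - \<eta> * ln 2) * real n)))"
    by (intro sum_mono B) auto
  also have "\<dots> = ennreal (real d * exp ((p - \<eta> * ln 2) * real n))"
    by (simp add: ennreal_mult ennreal_of_nat_eq_real_of_nat)
  finally show ?thesis .
qed

subsection \<open>Two opposite regressors\<close>

lemma masking_kernel_observe: "0 \<le> \<eta> \<Longrightarrow> masking_kernel (Suc m) \<eta> (coins m) (observe m)"
proof (rule masking_kernel.intro; (rule prob_space_coins measurable_observe)?)
  fix j x y and a :: "(nat \<Rightarrow> real) \<times> nat" assume j: "j < Suc m"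
  then show "fst (observe m ((x, y), a)) j = None \<or> fst (observe m ((x, y), a)) j = Some (x j)"
    using sym_mask_values[OF j, of x "fst a" "snd a"] by (simp add: observe_def)
qed (simp_all add: observe_def)

lemma masking_kernel_observe_mirrored: "0 \<le> \<eta> \<Longrightarrow> masking_kernel (Suc m) \<eta> (coins m) (observe_mirrored m)"
proof (rule masking_kernel.intro; (rule prob_space_coins measurable_observe_mirrored)?)
  fix j x y and a :: "(nat \<Rightarrow> real) \<times> nat" assume j: "j < Suc m"
  then show "fst (observe_mirrored m ((x, y), a)) j = None \<or> fst (observe_mirrored m ((x, y), a)) j = Some (x j)"
    using sym_mask_values[OF j, of "neg_vec (Suc m) x" "fst a" "snd a"]
    by (auto simp: observe_mirrored_def neg_obs_def neg_vec_def)
qed (simp_all add: observe_mirrored_def)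

lemma vnorm_const_vec: "0 \<le> b \<Longrightarrow> 1 \<le> d \<Longrightarrow> \<bar>c\<bar> = b / sqrt (real d) \<Longrightarrow> vnorm d (const_vec d c) = b"
proof -
  assume b: "0 \<le> b" and d: "1 \<le> d" and c: "\<bar>c\<bar> = b / sqrt (real d)"
  have "c\<^sup>2 = \<bar>c\<bar>\<^sup>2"
    by simp
  also have "\<dots> = b\<^sup>2 / real d"
    unfolding c by (simp add: power_divide)
  finally have "c\<^sup>2 = b\<^sup>2 / real d" .
  moreover have "(\<Sum>j<d. (const_vec d c j)\<^sup>2) = (\<Sum>j<d. c\<^sup>2)"
    by (intro sum.cong) (auto simp: const_vec_def)
  ultimately show ?thesis
    using b d by (simp add: vnorm_def)
qed

lemma measurable_vnorm_ge:
  "{v \<in> space (vec_space d). vnorm d (\<lambda>j. v j - \<beta> j) \<ge> r} \<in> sets (vec_space d)"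
proof -
  have "(\<lambda>v. \<Sum>j<d. (v j - \<beta> j)\<^sup>2) \<in> borel_measurable (vec_space d)"
  proof (rule borel_measurable_sum)
    fix j assume "j \<in> {..<d}"
    then have [measurable]: "(\<lambda>v. v j) \<in> borel_measurable (vec_space d)"
      unfolding vec_space_def by (rule measurable_component_singleton)
    show "(\<lambda>v. (v j - \<beta> j)\<^sup>2) \<in> borel_measurable (vec_space d)"
      by measurable
  qed
  then have [measurable]: "(\<lambda>v. vnorm d (\<lambda>j. v j - \<beta> j)) \<in> borel_measurable (vec_space d)"
    unfolding vnorm_def by measurable
  show ?thesis by measurable
qed

text \<open>Parallelogram law: the squared distances of \<open>v\<close> to the two opposite vectors
  add up to \<open>2 * |v|^2 + 2 * b^2\<close>, whereas two distances below
  \<open>b / sqrt 2\<close> would give less than \<open>b^2\<close>.\<close>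

lemma far_from_one_of_opposites:
  assumes b: "vnorm d (const_vec d c) = b" "vnorm d (const_vec d (- c)) = b"
  shows "b / sqrt 2 \<le> vnorm d (\<lambda>j. v j - const_vec d c j) \<or> b / sqrt 2 \<le> vnorm d (\<lambda>j. v j - const_vec d (- c) j)"
proof (rule ccontr)
  let ?u = "const_vec d c" and ?w = "const_vec d (- c)"
  assume "\<not> ?thesis"
  then have lt: "vnorm d (\<lambda>j. v j - ?u j) < b / sqrt 2" "vnorm d (\<lambda>j. v j - ?w j) < b / sqrt 2"
    by simp_all
  have nn: "0 \<le> (\<Sum>j<d. (h j)\<^sup>2)" for h :: "nat \<Rightarrow> real"
    by (intro sum_nonneg) simp
  have sq: "(vnorm d h)\<^sup>2 = (\<Sum>j<d. (h j)\<^sup>2)" "0 \<le> vnorm d h" for h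
    using nn[of h] by (simp_all add: vnorm_def)
  have "(vnorm d (\<lambda>j. v j - ?u j))\<^sup>2 < (b / sqrt 2)\<^sup>2" "(vnorm d (\<lambda>j. v j - ?w j))\<^sup>2 < (b / sqrt 2)\<^sup>2"
    using lt sq(2) by (auto intro!: power_strict_mono)
  then have "(\<Sum>j<d. (v j - ?u j)\<^sup>2) + (\<Sum>j<d. (v j - ?w j)\<^sup>2) < b\<^sup>2"
    by (simp add: sq power_divide)
  moreover have "(\<Sum>j<d. (v j - ?u j)\<^sup>2) + (\<Sum>j<d. (v j - ?w j)\<^sup>2) =
      2 * (\<Sum>j<d. (v j)\<^sup>2) + 2 * (\<Sum>j<d. (?u j)\<^sup>2)"
    unfolding sum_distrib_left sum.distrib[symmetric]
    by (intro sum.cong) (auto simp: const_vec_def power2_eq_square algebra_simps)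
  moreover have "(\<Sum>j<d. (?u j)\<^sup>2) = b\<^sup>2"
    using sq(1)[of ?u] b by simp
  ultimately show False
    using nn[of v] zero_le_power2[of b] by linarith
qed

text \<open>Here the constants meet. Let \<open>q\<close> be the root of the dimension. From
  \<open>4 / q \<le> \<eta> \<le> 1\<close> follows \<open>q \<ge> 4\<close>, so the 1 in the
  numerator is at most \<open>q / 4\<close> and the numerator at most \<open>9/4 * q\<close>. The
  rate is then at most \<open>9/16 * (4 / q)\<close>, hence at most
  \<open>9/16 * \<eta>\<close>.\<close>

lemma missing_rate_bound:
  assumes "4 / sqrt (real (Suc m)) \<le> \<eta>" "\<eta> \<le> 1"
  shows "(1 + 2 * sqrt (real m)) / real (Suc m) - \<eta> * ln 2 \<le> - (1 / 10) * \<eta>"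
proof -
  define q where "q = sqrt (real (Suc m))"
  have q: "0 < q" "real (Suc m) = q * q"
    by (simp_all add: q_def)
  have "4 / q \<le> 1"
    using order_trans[OF assms] by (simp only: q_def)
  then have q4: "4 \<le> q"
    using q by (simp add: divide_le_eq)
  have "sqrt (real m) \<le> q"
    by (simp add: q_def)
  then have "1 + 2 * sqrt (real m) \<le> 9 / 4 * q"
    using q4 by simp
  then have "(1 + 2 * sqrt (real m)) / real (Suc m) \<le> 9 / 4 * q / (q * q)"
    unfolding q(2) using q(1) by (intro divide_right_mono) auto
  also have "\<dots> = 9 / 16 * (4 / q)"
    using q by simp
  also have "\<dots> \<le> 9 / 16 * \<eta>"
    using assms(1) by (simp add: q_def del: of_nat_Suc)
  finally have "(1 + 2 * sqrt (real m)) / real (Suc m) \<le> 9 / 16 * \<eta>" .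
  \<comment> \<open>The margin between the hiding rate and the Chernoff threshold:
    \<open>9/16 - 2/3 = - 5/48\<close>, which is below \<open>- 1/10\<close>.\<close>
  moreover have "\<eta> * (2 / 3) \<le> \<eta> * ln 2"
  proof (rule mult_left_mono[OF ln2_ge_two_thirds])
    show "0 \<le> \<eta>"
      using assms(1) by (rule order_trans[rotated]) simp
  qed
  moreover have "0 \<le> \<eta>"
    using assms(1) by (rule order_trans[rotated]) simp
  ultimately show ?thesis
    by linarith
qed

text \<open>In both experiments the masked examples, before the fallback, are independent with the
  common law \<open>observed_law m c \<sigma>\<close>. On a sample within budget the output falls
  into \<open>E1\<close> or \<open>E2\<close>, so the two probabilities add up to at least the
  probability that the budget is kept.\<close>

lemma opposite_regressors:
  fixes d m n :: nat and c \<sigma> \<eta> :: real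
    and alg :: "(nat \<Rightarrow> (nat \<Rightarrow> real option) \<times> real option) \<Rightarrow> (nat \<Rightarrow> real) measure"
  assumes d_def: "d = Suc m" and \<sigma>: "0 \<le> \<sigma>" and \<eta>: "4 / sqrt (real d) \<le> \<eta>" "\<eta> \<le> 1"
    and alg: "alg \<in> cdata_space d n \<rightarrow>\<^sub>M prob_algebra (vec_space d)"
    and E: "E1 \<in> sets (vec_space d)" "E2 \<in> sets (vec_space d)" "space (vec_space d) \<subseteq> E1 \<union> E2"
  shows "1 - real d * exp (- (1 / 10) * \<eta> * real n) \<le>
    measure (output_dist d n (const_vec d c) \<sigma> (coin_adversary d n \<eta> (coins m) (observe m)) alg) E1 +
    measure (output_dist d n (const_vec d (- c)) \<sigma> (coin_adversary d n \<eta> (coins m) (observe_mirrored m)) alg) E2"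
proof -
  have \<eta>0: "0 \<le> \<eta>"
    using \<eta>(1) by (rule order_trans[rotated]) simp
  interpret K1: masking_kernel d n \<eta> "coins m" "observe m"
    unfolding d_def by (rule masking_kernel_observe[OF \<eta>0])
  interpret K2: masking_kernel d n \<eta> "coins m" "observe_mirrored m"
    unfolding d_def by (rule masking_kernel_observe_mirrored[OF \<eta>0])
  let ?O1 = "output_dist d n (const_vec d c) \<sigma> (coin_adversary d n \<eta> (coins m) (observe m)) alg"
    and ?O2 = "output_dist d n (const_vec d (- c)) \<sigma> (coin_adversary d n \<eta> (coins m) (observe_mirrored m)) alg"
  interpret O1: prob_space ?O1
    by (rule K1.prob_space_output_dist[OF \<sigma> alg])
  interpret O2: prob_space ?O2
    by (rule K2.prob_space_output_dist[OF \<sigma> alg])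
  let ?Q = "observed_law m c \<sigma>"
  let ?P = "PiM {..<n} (\<lambda>_. ?Q)"
  have Q: "prob_space ?Q"
    by (rule prob_space_observed_law[OF \<sigma>])
  interpret P: prob_space ?P
    by (intro prob_space_PiM Q)
  have sQ: "sets ?Q = sets (cexample_space d)"
    by (simp add: observed_law_def d_def)
  have sP: "sets ?P = sets (cdata_space d n)"
    unfolding cdata_space_def by (intro sets_PiM_cong sQ) simp
  let ?h = "\<lambda>E Z. if few_missing d n \<eta> Z then emeasure (alg Z) E else 0"
  have hm: "?h E \<in> borel_measurable ?P" if "E \<in> sets (vec_space d)" for E
  proof -
    have [measurable]: "(\<lambda>Z. emeasure (alg Z) E) \<in> borel_measurable (cdata_space d n)"
      by (rule measurable_compose[OF measurable_prob_algebraD[OF alg] measurable_emeasure_subprob_algebra[OF that]])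
    show ?thesis
      unfolding measurable_cong_sets[OF sP refl] by measurable
  qed
  have o1: "(\<integral>\<^sup>+Z. ?h E1 Z \<partial>?P) \<le> emeasure ?O1 E1"
    using K1.output_dist_ge[OF \<sigma> alg E(1), of "const_vec d c"] by (simp add: observed_law_def d_def)
  have o2: "(\<integral>\<^sup>+Z. ?h E2 Z \<partial>?P) \<le> emeasure ?O2 E2"
    using K2.output_dist_ge[OF \<sigma> alg E(2), of "const_vec d (- c)"] observed_law_mirrored[OF \<sigma>, of m c]
    by (simp add: d_def)
  let ?F = "{Z \<in> space ?P. few_missing d n \<eta> Z}" and ?M = "{Z \<in> space ?P. \<not> few_missing d n \<eta> Z}"
  have Fm: "?F \<in> sets ?P"
    using pred_few_missing[of d n \<eta>] unfolding pred_def sP sets_eq_imp_space_eq[OF sP] .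
  have FM: "space ?P - ?F = ?M"
    by blast
  have "emeasure ?P ?F = (\<integral>\<^sup>+Z. indicator ?F Z \<partial>?P)"
    using Fm by simp
  also have "\<dots> \<le> (\<integral>\<^sup>+Z. ?h E1 Z + ?h E2 Z \<partial>?P)"
  proof (rule nn_integral_mono)
    fix Z assume "Z \<in> space ?P"
    then have Z: "Z \<in> space (cdata_space d n)"
      by (simp only: sets_eq_imp_space_eq[OF sP])
    then have algZ: "sets (alg Z) = sets (vec_space d)" "prob_space (alg Z)"
      using measurable_space[OF alg Z] by (simp_all add: space_prob_algebra)
    have "1 = emeasure (alg Z) (space (alg Z))"
      using prob_space.emeasure_space_1[OF algZ(2)] by simp
    also have "\<dots> \<le> emeasure (alg Z) (E1 \<union> E2)"
      using E algZ(1) sets_eq_imp_space_eq[OF algZ(1)] by (intro emeasure_mono) auto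
    also have "\<dots> \<le> emeasure (alg Z) E1 + emeasure (alg Z) E2"
      using E algZ(1) by (intro emeasure_subadditive) auto
    finally show "indicator ?F Z \<le> ?h E1 Z + ?h E2 Z"
      by (simp add: indicator_def)
  qed
  also have "\<dots> = (\<integral>\<^sup>+Z. ?h E1 Z \<partial>?P) + (\<integral>\<^sup>+Z. ?h E2 Z \<partial>?P)"
    by (rule nn_integral_add[OF hm[OF E(1)] hm[OF E(2)]])
  also have "\<dots> \<le> emeasure ?O1 E1 + emeasure ?O2 E2"
    by (rule add_mono[OF o1 o2])
  also have "\<dots> = ennreal (measure ?O1 E1 + measure ?O2 E2)"
    by (simp add: O1.emeasure_eq_measure O2.emeasure_eq_measure)
  finally have F: "P.prob ?F \<le> measure ?O1 E1 + measure ?O2 E2"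
    unfolding P.emeasure_eq_measure by (subst (asm) ennreal_le_iff) simp_all
  have "emeasure ?P ?M \<le> ennreal (real d * exp (((1 + 2 * sqrt (real m)) / real d - \<eta> * ln 2) * real n))"
  proof (rule emeasure_many_missing[OF Q sQ])
    show "emeasure ?Q {z \<in> space (cexample_space d). fst z j = None} \<le> ennreal ((1 + 2 * sqrt (real m)) / real d)"
      if "j < d" for j
      using emeasure_observed_law_missing[OF \<sigma>, of j m c] that by (simp only: d_def)
  qed simp
  also have "\<dots> \<le> ennreal (real d * exp (- (1 / 10) * \<eta> * real n))"
  proof -
    have "((1 + 2 * sqrt (real m)) / real d - \<eta> * ln 2) * real n \<le> - (1 / 10) * \<eta> * real n"
      using missing_rate_bound[of m \<eta>] \<eta> by (intro mult_right_mono) (simp_all only: d_def of_nat_0_le_iff)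
    then show ?thesis
      by (intro ennreal_leI mult_left_mono) simp_all
  qed
  finally have "P.prob ?M \<le> real d * exp (- (1 / 10) * \<eta> * real n)"
    by (simp add: P.emeasure_eq_measure)
  moreover have "P.prob ?M = 1 - P.prob ?F"
    using P.prob_compl[OF Fm] by (simp only: FM)
  ultimately show ?thesis
    using F by linarith
qed

text \<open>The algorithm decides which of the two opposite regressors is bad for it: the failure
  probabilities have a sum close to 1, so one of them is close to 1/2 or larger. The rate
  \<open>1/10\<close> for \<open>\<kappa>\<close> is the one obtained in
  \<open>missing_rate_bound\<close>.\<close>

theorem theorem1:
  "\<exists>\<kappa>::real. \<kappa> > 0 \<and>
    (\<forall>(d::nat) (\<sigma>::real) (b::real) (\<eta>::real) (n::nat)
        (alg :: (nat \<Rightarrow> (nat \<Rightarrow> real option) \<times> real option) \<Rightarrow> (nat \<Rightarrow> real) measure).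
      d \<ge> 1 \<longrightarrow> \<sigma> \<ge> 0 \<longrightarrow> b \<ge> 0 \<longrightarrow> 4 / sqrt (real d) \<le> \<eta> \<longrightarrow> \<eta> \<le> 1 \<longrightarrow>
      alg \<in> measurable (cdata_space d n) (prob_algebra (vec_space d)) \<longrightarrow>
      (\<exists>\<beta> adv. \<beta> \<in> space (vec_space d) \<and> vnorm d \<beta> = b \<and> adversary d n \<eta> adv \<and>
         measure (output_dist d n \<beta> \<sigma> adv alg)
           {\<beta>h \<in> space (vec_space d). vnorm d (\<lambda>j. \<beta>h j - \<beta> j) \<ge> vnorm d \<beta> / sqrt 2}
         \<ge> (1 - real (d + 1) * exp (- \<kappa> * \<eta> * real n)) / 2))"
proof (rule exI[of _ "1 / 10"], intro conjI allI impI)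
  fix d n :: nat and \<sigma> b \<eta> :: real
    and alg :: "(nat \<Rightarrow> (nat \<Rightarrow> real option) \<times> real option) \<Rightarrow> (nat \<Rightarrow> real) measure"
  assume d: "1 \<le> d" and \<sigma>: "0 \<le> \<sigma>" and b: "0 \<le> b" and \<eta>: "4 / sqrt (real d) \<le> \<eta>" "\<eta> \<le> 1"
    and alg: "alg \<in> cdata_space d n \<rightarrow>\<^sub>M prob_algebra (vec_space d)"
  obtain m where m: "d = Suc m"
    using d by (cases d) auto
  have \<eta>0: "0 \<le> \<eta>"
    using \<eta>(1) by (rule order_trans[rotated]) simp
  define c where "c = b / sqrt (real d)"
  let ?E = "\<lambda>c. {v \<in> space (vec_space d). vnorm d (\<lambda>j. v j - const_vec d c j) \<ge> b / sqrt 2}"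
  let ?a1 = "coin_adversary d n \<eta> (coins m) (observe m)"
    and ?a2 = "coin_adversary d n \<eta> (coins m) (observe_mirrored m)"
  \<comment> \<open>Here \<open>x\<close> is the union bound over the \<open>d\<close> coordinates
    and \<open>e\<close> one further exponential, which accounts for the factor \<open>d + 1\<close>
    in the statement.\<close>
  have half: "(1 - (x + e)) / 2 \<le> p \<or> (1 - (x + e)) / 2 \<le> q" if "1 - x \<le> p + q" "0 \<le> e" for x e p q :: real
  proof (rule ccontr)
    assume "\<not> ?thesis"
    then have "p < (1 - (x + e)) / 2" "q < (1 - (x + e)) / 2"
      by simp_all
    then show False
      using that by (simp add: less_divide_eq)
  qed
  have nrm: "vnorm d (const_vec d c) = b" "vnorm d (const_vec d (- c)) = b"
    by (rule vnorm_const_vec[OF b d]; use b in \<open>simp add: c_def\<close>)+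
  have sp: "const_vec d c' \<in> space (vec_space d)" for c'
    by (simp add: const_vec_def vec_space_def space_PiM)
  have adv: "adversary d n \<eta> ?a1" "adversary d n \<eta> ?a2"
    unfolding m by (rule masking_kernel.adversary_coin_adversary masking_kernel_observe
        masking_kernel_observe_mirrored \<eta>0)+
  have "1 - real d * exp (- (1 / 10) * \<eta> * real n) \<le>
    measure (output_dist d n (const_vec d c) \<sigma> ?a1 alg) (?E c) +
    measure (output_dist d n (const_vec d (- c)) \<sigma> ?a2 alg) (?E (- c))"
    using far_from_one_of_opposites[OF nrm]
    by (intro opposite_regressors[OF m \<sigma> \<eta> alg] measurable_vnorm_ge) auto
  moreover have "0 \<le> exp (- (1 / 10) * \<eta> * real n)"
    by simp
  ultimately have "(1 - real (d + 1) * exp (- (1 / 10) * \<eta> * real n)) / 2 \<le> measure (output_dist d n (const_vec d c) \<sigma> ?a1 alg) (?E c) \<or>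
    (1 - real (d + 1) * exp (- (1 / 10) * \<eta> * real n)) / 2 \<le> measure (output_dist d n (const_vec d (- c)) \<sigma> ?a2 alg) (?E (- c))"
    unfolding of_nat_add of_nat_1 distrib_right mult_1 by (rule half)
  then show "\<exists>\<beta> adv. \<beta> \<in> space (vec_space d) \<and> vnorm d \<beta> = b \<and> adversary d n \<eta> adv \<and>
         measure (output_dist d n \<beta> \<sigma> adv alg)
           {\<beta>h \<in> space (vec_space d). vnorm d (\<lambda>j. \<beta>h j - \<beta> j) \<ge> vnorm d \<beta> / sqrt 2}
         \<ge> (1 - real (d + 1) * exp (- (1 / 10) * \<eta> * real n)) / 2"
  proof
    assume "(1 - real (d + 1) * exp (- (1 / 10) * \<eta> * real n)) / 2 \<le> measure (output_dist d n (const_vec d c) \<sigma> ?a1 alg) (?E c)"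
    then show ?thesis
      using sp nrm adv by (intro exI[of _ "const_vec d c"] exI[of _ ?a1]) simp
  next
    assume "(1 - real (d + 1) * exp (- (1 / 10) * \<eta> * real n)) / 2 \<le> measure (output_dist d n (const_vec d (- c)) \<sigma> ?a2 alg) (?E (- c))"
    then show ?thesis
      using sp nrm adv by (intro exI[of _ "const_vec d (- c)"] exI[of _ ?a2]) simp
  qed
qed simp

end
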